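(* Let $n\ge3$ and let $\Sigma$ be a closed hypersurface immersed in $\mathbb R^n$. If $\Sigma$ is a self-expander to the weighted generalized inverse curvature flow, then $\Sigma$ is a round hypersphere centered at the origin.
   Context: All hypersurfaces are assumed connected, closed and orientable. $\nu$ denotes the outward pointing unit normal vector field of $\Sigma\subset\mathbb R^n$, $X$ the position vector, and $\lambda_1,\dots,\lambda_{n-1}$ the principal curvatures with respect to $\nu$, with the sign convention that round hyperspheres (with outward normal) have positive principal curvatures. The normalized $j$-th mean curvature is $H_j=\binom{n-1}{j}^{-1}\sigma_j(\lambda_1,\dots,\lambda_{n-1})$, where $\sigma_j$ is the $j$-th elementary symmetric function, and $H_0=1$. The weighted generalized inverse curvature flow is $$\frac{d}{dt}\mathcal F=\sum_{0\le i<j\le n-1}a_{i,j}\left(\frac{H_i}{H_j}\right)^{\frac1{j-i}}\nu,$$ where the weights $a_{i,j}=a_{i,j}(x)$, $0\le i<j\le n-1$, are non-negative functions on the hypersurface with $\sum_{0\le i<j\le n-1}a_{i,j}(x)=1$. Let $k$ be the largest $j$ such that $a_{i,j}$ is not identically zero for some $i<j$. A hypersurface $\Sigma$ with $H_k>0$ is called a self-expander to this flow if there exists a constant $\mu>0$ such that on $\Sigma$ $$\sum_{0\le i<j\le k}a_{i,j}\left(\frac{H_i}{H_j}\right)^{\frac1{j-i}}=\mu\,\langle X,\nu\rangle .$$ *)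

theory Defs
  imports "HOL-Analysis.Analysis"
begin

section \<open>Smooth maps and smooth manifolds\<close>

(* Meant for open S: all iterated directional derivatives of f up to order k exist and are
   continuous on S. *)
primrec Ck_on :: "nat \<Rightarrow> 'a::euclidean_space set \<Rightarrow> ('a \<Rightarrow> 'b::euclidean_space) \<Rightarrow> bool" where
  "Ck_on 0 S f \<longleftrightarrow> continuous_on S f"
| "Ck_on (Suc k) S f \<longleftrightarrow>
     (\<forall>x\<in>S. f differentiable (at x)) \<and>
     (\<forall>v. Ck_on k S (\<lambda>x. frechet_derivative f (at x) v))"

definition smooth_on :: "'a::euclidean_space set \<Rightarrow> ('a \<Rightarrow> 'b::euclidean_space) \<Rightarrow> bool" where
  "smooth_on S f \<longleftrightarrow> (\<forall>k. Ck_on k S f)"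

type_synonym ('p, 'm) chart = "'p set \<times> ('p \<Rightarrow> real ^ 'm)"

definition smooth_atlas :: "'p topology \<Rightarrow> ('p, 'm::finite) chart set \<Rightarrow> bool" where
  "smooth_atlas M A \<longleftrightarrow>
     (\<Union>(U, \<phi>)\<in>A. U) = topspace M \<and>
     (\<forall>(U, \<phi>)\<in>A. openin M U \<and> open (\<phi> ` U) \<and>
        homeomorphic_map (subtopology M U) (top_of_set (\<phi> ` U)) \<phi>) \<and>
     (\<forall>(U, \<phi>)\<in>A. \<forall>(V, \<psi>)\<in>A. smooth_on (\<phi> ` (U \<inter> V)) (\<psi> \<circ> inv_into U \<phi>))"

definition closed_smooth_manifold :: "'p topology \<Rightarrow> ('p, 'm::finite) chart set \<Rightarrow> bool" where
  "closed_smooth_manifold M A \<longleftrightarrow>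
     topspace M \<noteq> {} \<and> Hausdorff_space M \<and> second_countable M \<and>
     compact_space M \<and> connected_space M \<and> smooth_atlas M A"

definition smooth_map :: "('p, 'm::finite) chart set \<Rightarrow> ('p \<Rightarrow> 'b::euclidean_space) \<Rightarrow> bool" where
  "smooth_map A f \<longleftrightarrow> (\<forall>(U, \<phi>)\<in>A. smooth_on (\<phi> ` U) (f \<circ> inv_into U \<phi>))"

(* Differential of f at p, with tangent vectors at p written in the coordinates of the chart. *)
definition chart_differential ::
  "('p, 'm::finite) chart \<Rightarrow> ('p \<Rightarrow> 'b::euclidean_space) \<Rightarrow> 'p \<Rightarrow> real ^ 'm \<Rightarrow> 'b" where
  "chart_differential c f p =
     (case c of (U, \<phi>) \<Rightarrow> frechet_derivative (f \<circ> inv_into U \<phi>) (at (\<phi> p)))"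


section \<open>Closed immersed hypersurfaces\<close>

(* The hypersurface is the immersion X together with its domain M, which may be covered
   non-injectively. *)
definition closed_immersed_hypersurface ::
  "'p topology \<Rightarrow> ('p, 'm::finite) chart set \<Rightarrow> ('p \<Rightarrow> real ^ 'n::finite) \<Rightarrow> bool" where
  "closed_immersed_hypersurface M A X \<longleftrightarrow>
     CARD('n) = CARD('m) + 1 \<and> closed_smooth_manifold M A \<and> smooth_map A X \<and>
     (\<forall>c\<in>A. \<forall>p\<in>fst c. inj (chart_differential c X p))"

(* Existence of such a field is orientability of the immersed hypersurface. *)
definition unit_normal_field ::
  "('p, 'm::finite) chart set \<Rightarrow> ('p \<Rightarrow> real ^ 'n::finite) \<Rightarrow> ('p \<Rightarrow> real ^ 'n) \<Rightarrow> bool" where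
  "unit_normal_field A X \<nu> \<longleftrightarrow>
     smooth_map A \<nu> \<and>
     (\<forall>c\<in>A. \<forall>p\<in>fst c. norm (\<nu> p) = 1 \<and> (\<forall>v. \<nu> p \<bullet> chart_differential c X p v = 0))"

(* An immersed hypersurface need not bound a region.  Outward means: at some point where the
   hypersurface touches an enclosing sphere, the normal points out of that sphere.  A closed
   connected hypersurface has just the two fields \<nu> and -\<nu>; if it is embedded, this singles out
   the one pointing out of the bounded region. *)
definition outward_unit_normal ::
  "'p topology \<Rightarrow> ('p, 'm::finite) chart set \<Rightarrow> ('p \<Rightarrow> real ^ 'n::finite) \<Rightarrow>
   ('p \<Rightarrow> real ^ 'n) \<Rightarrow> bool" where
  "outward_unit_normal M A X \<nu> \<longleftrightarrow>
     unit_normal_field A X \<nu> \<and>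
     (\<exists>z. \<exists>p\<in>topspace M. (\<forall>q\<in>topspace M. dist z (X q) \<le> dist z (X p)) \<and>
        (X p - z) \<bullet> \<nu> p > 0)"


section \<open>Principal curvatures and mean curvatures\<close>

(* The vectors e i form a basis of principal directions at p, orthonormal for the metric induced
   by X, and the shape operator is the differential of \<nu>.  With this sign the sphere of radius r
   with outward normal \<nu> = X / r has all principal curvatures equal to 1 / r. *)
definition is_principal_curvatures ::
  "('p, 'm::finite) chart set \<Rightarrow> ('p \<Rightarrow> real ^ 'n::finite) \<Rightarrow> ('p \<Rightarrow> real ^ 'n) \<Rightarrow> 'p \<Rightarrow>
   ('m \<Rightarrow> real) \<Rightarrow> bool" where
  "is_principal_curvatures A X \<nu> p \<kappa> \<longleftrightarrow>
     (\<exists>c\<in>A. p \<in> fst c \<and> (\<exists>e :: 'm \<Rightarrow> real ^ 'm.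
        (\<forall>i j. chart_differential c X p (e i) \<bullet> chart_differential c X p (e j) =
           (if i = j then 1 else 0)) \<and>
        (\<forall>i. chart_differential c \<nu> p (e i) = \<kappa> i *\<^sub>R chart_differential c X p (e i))))"

(* Exists because the shape operator is self-adjoint; unique up to the order of the indices,
   to which the mean curvatures below are insensitive. *)
definition principal_curvatures ::
  "('p, 'm::finite) chart set \<Rightarrow> ('p \<Rightarrow> real ^ 'n::finite) \<Rightarrow> ('p \<Rightarrow> real ^ 'n) \<Rightarrow> 'p \<Rightarrow>
   'm \<Rightarrow> real" where
  "principal_curvatures A X \<nu> p = (SOME \<kappa>. is_principal_curvatures A X \<nu> p \<kappa>)"

definition elem_sym :: "nat \<Rightarrow> ('m::finite \<Rightarrow> real) \<Rightarrow> real" where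
  "elem_sym j \<kappa> = (\<Sum>S\<in>{S. card S = j}. \<Prod>i\<in>S. \<kappa> i)"

definition mean_curvature ::
  "('p, 'm::finite) chart set \<Rightarrow> ('p \<Rightarrow> real ^ 'n::finite) \<Rightarrow> ('p \<Rightarrow> real ^ 'n) \<Rightarrow> nat \<Rightarrow> 'p \<Rightarrow>
   real" where
  "mean_curvature A X \<nu> j p =
     elem_sym j (principal_curvatures A X \<nu> p) / real (CARD('m) choose j)"


section \<open>The weighted flow and its self-expanders\<close>

(* The argument d is the dimension n - 1 of the hypersurface. *)
definition flow_weights :: "nat \<Rightarrow> 'p set \<Rightarrow> (nat \<Rightarrow> nat \<Rightarrow> 'p \<Rightarrow> real) \<Rightarrow> bool" where
  "flow_weights d P a \<longleftrightarrow>
     (\<forall>p\<in>P. (\<forall>j\<le>d. \<forall>i<j. 0 \<le> a i j p) \<and> (\<Sum>j\<le>d. \<Sum>i<j. a i j p) = 1)"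

definition top_index :: "nat \<Rightarrow> 'p set \<Rightarrow> (nat \<Rightarrow> nat \<Rightarrow> 'p \<Rightarrow> real) \<Rightarrow> nat" where
  "top_index d P a = Max {j. j \<le> d \<and> (\<exists>i<j. \<exists>p\<in>P. a i j p \<noteq> 0)}"

(* Only H k > 0 is required.  For an outward normal this forces H j > 0 for all j < k, so the
   totalized quotients and roots are only ever used at positive arguments. *)
definition self_expander ::
  "'p topology \<Rightarrow> ('p, 'm::finite) chart set \<Rightarrow> ('p \<Rightarrow> real ^ 'n::finite) \<Rightarrow>
   ('p \<Rightarrow> real ^ 'n) \<Rightarrow> (nat \<Rightarrow> nat \<Rightarrow> 'p \<Rightarrow> real) \<Rightarrow> bool" where
  "self_expander M A X \<nu> a \<longleftrightarrow>
     (let k = top_index (CARD('n) - 1) (topspace M) a; H = mean_curvature A X \<nu> in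
        (\<forall>p\<in>topspace M. H k p > 0) \<and>
        (\<exists>\<mu>>0. \<forall>p\<in>topspace M.
           (\<Sum>j\<le>k. \<Sum>i<j. a i j p * root (j - i) (H i p / H j p)) = \<mu> * (X p \<bullet> \<nu> p)))"

(* As an immersed hypersurface: the immersion is injective, not merely onto the sphere. *)
definition round_hypersphere_at_origin :: "'p topology \<Rightarrow> ('p \<Rightarrow> real ^ 'n::finite) \<Rightarrow> bool" where
  "round_hypersphere_at_origin M X \<longleftrightarrow>
     inj_on X (topspace M) \<and> (\<exists>r>0. X ` topspace M = sphere 0 r)"

end

theory Submission
  imports Defs "HOL-Computational_Algebra.Fundamental_Theorem_Algebra"
begin

text \<open>At a point where |X| is maximal the hypersurface is at least as curved as the enclosing sphere,
  and the self-expander equation gives \<mu> \<le> 1.  Starting from the outward touching point, positivity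
  of H 1, ..., H k spreads over the connected hypersurface, so the inequality
  H j \<le> H i * H 1 ^ (j - i) bounds every quotient root from below by 1 / H 1.  Hence
  1 \<le> \<langle>X, \<nu>\<rangle> * H 1 everywhere, which says that |X|^2 is superharmonic, as its Laplacian is
  2 * (n - 1) * (1 - \<langle>X, \<nu>\<rangle> * H 1).  By the strong minimum principle |X| is constant, and X is a
  local homeomorphism from a compact connected manifold to a simply connected sphere, hence bijective.\<close>

section \<open>Elementary symmetric functions\<close>

text \<open>The weights \<open>a i j\<close> are arbitrary functions, with no regularity at all, so
  the self-expander equation is never differentiated: it enters only pointwise, through bounds on a
  weighted mean. The curvatures come from a choice, so neither they nor the principal frames are
  known to vary continuously. Signs of \<open>H j\<close> are therefore read off the polynomial det
  (t g + h) in \<open>t\<close>, with g and h the first and second fundamental forms, whose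
  coefficients are continuous; and the minimum principle is stated for directions that may jump from
  point to point, subject only to locally uniform bounds. Positivity spreads because differentiation
  preserves real-rootedness: \<open>H 0\<close>, ..., \<open>H k\<close> are also the normalized
  symmetric functions of some \<open>k\<close> real numbers with product \<open>H k\<close>. If all
  of them are nonnegative and \<open>H k\<close> is positive, then these \<open>k\<close> numbers
  are positive, so the cone of positive \<open>H j\<close> cannot be left through its
  boundary.\<close>

definition lin_prod :: "'a::idom multiset \<Rightarrow> 'a poly" where
  "lin_prod A = (\<Prod>a\<in>#A. [:a, 1:])"

lemma lin_prod_empty [simp]: "lin_prod {#} = 1"
  by (simp add: lin_prod_def)

lemma lin_prod_add [simp]: "lin_prod (add_mset a A) = [:a, 1:] * lin_prod A"
  by (simp add: lin_prod_def)

lemma lin_prod_monic: "degree (lin_prod A) = size A \<and> lead_coeff (lin_prod A) = 1"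
proof (induction A)
  case (add a A)
  then have "lin_prod A \<noteq> 0" by auto
  then have d: "degree ([:a, 1:] * lin_prod A) = Suc (size A)"
    using add by (simp add: degree_mult_eq del: mult_pCons_left)
  have "lead_coeff ([:a, 1:] * lin_prod A) = 1"
    using add by (subst lead_coeff_mult) auto
  with d show ?case by (simp only: lin_prod_add size_add_mset)
qed simp

lemma poly_lin_prod_of_real:
  fixes A :: "real multiset"
  shows "poly (lin_prod (image_mset complex_of_real A)) (of_real x) = of_real (poly (lin_prod A) x)"
    and "poly (pderiv (lin_prod (image_mset complex_of_real A))) (of_real x)
           = of_real (poly (pderiv (lin_prod A)) x)"
proof (induction A)
  case (add a A)
  { case 1 then show ?case using add by simp }
  { case 2 then show ?case using add by (simp add: pderiv_mult pderiv_pCons del: mult_pCons_left) }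
qed simp_all

text \<open>The logarithmic derivative of \<open>P\<close> is the sum of the 1 / (z + a), and each
  summand has imaginary part of sign opposite to that of \<open>z\<close>, so they cannot cancel.
  Thus for nonempty \<open>A\<close> the derivative has no zero off the real axis.\<close>

lemma pderiv_lin_prod_log:
  fixes A :: "real multiset" and z :: complex
  assumes "Im z \<noteq> 0"
  defines "P \<equiv> lin_prod (image_mset complex_of_real A)"
  shows "poly P z \<noteq> 0"
    and "A \<noteq> {#} \<Longrightarrow> Im (poly (pderiv P) z / poly P z) * Im z < 0"
  unfolding P_def
proof (induction A)
  case (add a A)
  let ?P = "lin_prod (image_mset complex_of_real A)"
  have nz: "z + of_real a \<noteq> 0" using assms(1) by (auto simp: complex_eq_iff)
  { case 1 then show ?case using add nz by (simp add: add.commute del: mult_pCons_left) }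
  { case 2
    have "poly (pderiv (lin_prod (image_mset complex_of_real (add_mset a A)))) z
          = poly ?P z + (z + of_real a) * poly (pderiv ?P) z"
      by (simp add: pderiv_mult pderiv_pCons add.commute del: mult_pCons_left)
    moreover have "poly (lin_prod (image_mset complex_of_real (add_mset a A))) z = (z + of_real a) * poly ?P z"
      by (simp add: add.commute del: mult_pCons_left)
    ultimately have eq: "poly (pderiv (lin_prod (image_mset complex_of_real (add_mset a A)))) z
        / poly (lin_prod (image_mset complex_of_real (add_mset a A))) z
        = 1 / (z + of_real a) + poly (pderiv ?P) z / poly ?P z"
      using nz add(1) by (simp add: field_simps)
    have "Im (1 / (z + of_real a)) * Im z < 0"
    proof -
      have "Im (1 / (z + of_real a)) = - Im z / (cmod (z + of_real a))\<^sup>2"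
        by (simp add: inverse_eq_divide[symmetric] cmod_power2)
      moreover have "(cmod (z + of_real a))\<^sup>2 > 0" using nz by simp
      ultimately show ?thesis using assms(1)
        by (simp add: divide_neg_pos power2_eq_square[symmetric])
    qed
    moreover have "Im (poly (pderiv ?P) z / poly ?P z) * Im z \<le> 0"
      using add(2) by (cases "A = {#}") auto
    ultimately show ?case unfolding eq by (simp add: distrib_right) }
qed simp_all

text \<open>Differentiation preserves real-rootedness: the derivative splits over the complex
  numbers, all its roots are real by the preceding lemma, and the factorization descends because a
  real polynomial is determined by its values.\<close>

lemma pderiv_lin_prod:
  fixes A :: "real multiset"
  assumes "size A = Suc k"
  obtains B where "size B = k" "pderiv (lin_prod A) = smult (real (Suc k)) (lin_prod B)"
proof -
  let ?Q = "pderiv (lin_prod (image_mset complex_of_real A))"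
  have deg: "degree (lin_prod (image_mset complex_of_real A)) = Suc k"
    "lead_coeff (lin_prod (image_mset complex_of_real A)) = 1"
    using lin_prod_monic[of "image_mset complex_of_real A"] assms by auto
  have dQ: "degree ?Q = k" using deg by (simp add: degree_pderiv)
  have lQ: "lead_coeff ?Q = of_nat (Suc k)" unfolding dQ using deg by (simp add: coeff_pderiv)
  have "?Q \<noteq> 0" using lQ by (metis leading_coeff_0_iff of_nat_neq_0)
  then obtain C where C: "size C = k" "?Q = smult (of_nat (Suc k)) (\<Prod>x\<in>#C. [:-x, 1:])"
    using alg_closed_imp_factorization[of ?Q] dQ lQ by metis
  have real: "Im x = 0" if "x \<in># C" for x
  proof (rule ccontr)
    assume "Im x \<noteq> 0"
    from pderiv_lin_prod_log[OF this, of A] assms have "poly ?Q x \<noteq> 0" by (cases "A = {#}") auto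
    moreover have "[:-x,1:] dvd (\<Prod>x\<in>#C. [:-x, 1:])"
      using that by (intro dvd_prod_mset) auto
    then have "poly (\<Prod>x\<in>#C. [:-x, 1:]) x = 0" using poly_eq_0_iff_dvd by blast
    ultimately show False by (simp add: C)
  qed
  \<comment> \<open>The sign matches the convention that \<open>lin_prod\<close> has the negatives
    of the entries as roots.\<close>
  define B where "B = image_mset (\<lambda>x. - Re x) C"
  have "image_mset (\<lambda>x. [:-x,1:]) C = image_mset (\<lambda>x. [:complex_of_real (- Re x),1:]) C"
    using real by (intro image_mset_cong) (simp add: complex_eq_iff)
  then have "?Q = smult (of_nat (Suc k)) (lin_prod (image_mset complex_of_real B))"
    unfolding C(2) by (simp add: lin_prod_def B_def image_mset.compositionality o_def)
  then have "complex_of_real (poly (pderiv (lin_prod A)) x) = of_real (poly (smult (real (Suc k)) (lin_prod B)) x)" for x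
    using poly_lin_prod_of_real(2)[of A x] poly_lin_prod_of_real(1)[of B x] by simp
  then have "poly (pderiv (lin_prod A)) = poly (smult (real (Suc k)) (lin_prod B))"
    using of_real_eq_iff by blast
  then have "pderiv (lin_prod A) = smult (real (Suc k)) (lin_prod B)"
    by (simp only: poly_eq_poly_eq_iff)
  moreover have "size B = k" using C by (simp add: B_def)
  ultimately show ?thesis using that by blast
qed

lemma coeff_lin_prod_pos:
  fixes A :: "real multiset"
  assumes "\<And>a. a \<in># A \<Longrightarrow> a > 0" "i \<le> size A"
  shows "coeff (lin_prod A) i > 0"
  using assms
proof (induction A arbitrary: i)
  case (add a A)
  have a: "a > 0" using add by auto
  have nn: "coeff (lin_prod A) j \<ge> 0" for j
    using add by (cases "j \<le> size A") (force intro: less_imp_le, simp add: coeff_eq_0 lin_prod_monic)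
  show ?case
  proof (cases i)
    case 0 then show ?thesis using add a by simp
  next
    case (Suc j)
    then have "coeff (lin_prod A) j > 0" using add by auto
    with Suc a nn[of i] show ?thesis by (simp add: add_nonneg_pos)
  qed
qed (simp)

text \<open>If \<open>a\<close> were nonpositive, the root \<open>-a\<close> would be nonnegative,
  where a polynomial with nonnegative coefficients is at least its constant coefficient.\<close>

lemma lin_prod_nonneg_coeffs_imp_pos:
  fixes A :: "real multiset"
  assumes "\<And>i. i \<le> size A \<Longrightarrow> coeff (lin_prod A) i \<ge> 0" "coeff (lin_prod A) 0 > 0" "a \<in># A"
  shows "a > 0"
proof (rule ccontr)
  assume "\<not> a > 0"
  have "[:a,1:] dvd lin_prod A" unfolding lin_prod_def
    using assms(3) by (intro dvd_prod_mset) auto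
  then have z: "poly (lin_prod A) (-a) = 0" using poly_eq_0_iff_dvd[of _ "-a"] by simp
  have "poly (lin_prod A) (-a) = (\<Sum>i\<le>size A. coeff (lin_prod A) i * (-a)^i)"
    by (simp add: poly_altdef lin_prod_monic)
  also have "\<dots> \<ge> coeff (lin_prod A) 0 * (-a)^0"
    using assms(1) \<open>\<not> a > 0\<close> by (intro member_le_sum) auto
  finally show False using z assms(2) by simp
qed

text \<open>Coefficient 0 is the product of the entries and coefficient 1 is that product times the
  sum of reciprocals, so this is the inequality of arithmetic and harmonic means with the
  denominators cleared.\<close>

lemma lin_prod_am_hm:
  fixes A :: "real multiset"
  assumes "\<And>a. a \<in># A \<Longrightarrow> a > 0"
  shows "(real (size A))\<^sup>2 * coeff (lin_prod A) 0 \<le> coeff (lin_prod A) 1 * sum_mset A"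
  using assms
proof (induction A)
  case (add b A)
  let ?N = "real (size A)" and ?c0 = "coeff (lin_prod A) 0" and ?c1 = "coeff (lin_prod A) 1" and ?s = "sum_mset A"
  have b: "b > 0" using add by auto
  have c0: "?c0 > 0" using add by (intro coeff_lin_prod_pos) auto
  have c1: "?c1 \<ge> 0" using add coeff_lin_prod_pos[of A 1]
    by (cases "size A = 0") (auto simp: Suc_le_eq intro!: less_imp_le)
  have s: "?s \<ge> 0" using add.prems by (induction A) (auto simp: less_imp_le intro!: add_nonneg_nonneg)
  have IH: "?N\<^sup>2 * ?c0 \<le> ?c1 * ?s" using add by auto
  \<comment> \<open>Once the induction hypothesis times \<open>b\<close> is used, the claim for
    \<open>add_mset b A\<close> reduces to
    \<open>2 * ?N * b * ?c0 \<le> b\<^sup>2 * ?c1 + ?c0 * ?s\<close>. It is the inequality of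
    arithmetic and geometric means for the two terms on the right, squared to avoid roots.\<close>
  have "(2 * ?N * b * ?c0)\<^sup>2 \<le> (b\<^sup>2 * ?c1 + ?c0 * ?s)\<^sup>2"
  proof -
    have "(2 * ?N * b * ?c0)\<^sup>2 = 4 * b\<^sup>2 * ?c0 * (?N\<^sup>2 * ?c0)" by (simp add: power2_eq_square)
    also have "\<dots> \<le> 4 * b\<^sup>2 * ?c0 * (?c1 * ?s)" using IH c0 by (intro mult_left_mono) auto
    also have "\<dots> \<le> (b\<^sup>2 * ?c1 + ?c0 * ?s)\<^sup>2"
      using zero_le_power2[of "b\<^sup>2 * ?c1 - ?c0 * ?s"] by (simp add: power2_eq_square algebra_simps)
    finally show ?thesis .
  qed
  then have "2 * ?N * b * ?c0 \<le> b\<^sup>2 * ?c1 + ?c0 * ?s"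
    by (rule power2_le_imp_le) (use c0 c1 s in auto)
  moreover have "b * (?N\<^sup>2 * ?c0) \<le> b * (?c1 * ?s)" using IH b by auto
  ultimately show ?case
    by (simp add: power2_eq_square algebra_simps)
qed simp

lemma coeff_lin_prod_subleading:
  fixes A :: "real multiset"
  shows "size A = Suc l \<Longrightarrow> coeff (lin_prod A) l = sum_mset A"
proof (induction A arbitrary: l)
  case (add a A)
  have "coeff (lin_prod A) (size A) = 1" using lin_prod_monic[of A] by metis
  with add show ?case by (cases l) auto
qed simp

section \<open>Inequalities between normalized elementary symmetric functions\<close>

definition norm_elem_sym :: "nat \<Rightarrow> ('m::finite \<Rightarrow> real) \<Rightarrow> real" where
  "norm_elem_sym j \<kappa> = elem_sym j \<kappa> / real (CARD('m) choose j)"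

lemma prod_linear_eq_elem_sym:
  fixes \<kappa> :: "'m::finite \<Rightarrow> real" and x :: real
  shows "(\<Prod>i\<in>UNIV. x + \<kappa> i) = (\<Sum>l\<le>CARD('m). elem_sym l \<kappa> * x ^ (CARD('m) - l))"
proof -
  have "(\<Prod>i\<in>UNIV. x + \<kappa> i) = (\<Prod>i\<in>UNIV. \<kappa> i + x)" by (simp add: add.commute)
  also have "\<dots> = (\<Sum>S\<in>UNIV. prod \<kappa> S * x ^ (CARD('m) - card S))"
    by (subst prod_add) (auto simp: Compl_eq_Diff_UNIV card_Diff_subset)
  also have "\<dots> = (\<Sum>l\<le>CARD('m). \<Sum>S\<in>{S\<in>UNIV. card S = l}. prod \<kappa> S * x ^ (CARD('m) - card S))"
    by (rule sum.group[symmetric]) (auto simp: card_mono)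
  also have "\<dots> = (\<Sum>l\<le>CARD('m). elem_sym l \<kappa> * x ^ (CARD('m) - l))"
    unfolding elem_sym_def sum_distrib_right by (intro sum.cong) auto
  finally show ?thesis .
qed

text \<open>Differentiating and dividing by the degree removes one root and keeps every normalized
  symmetric function except the last. Descending from \<open>CARD('m)\<close> to \<open>k\<close>
  yields \<open>k\<close> real numbers with product \<open>norm_elem_sym k \<kappa>\<close>, and the
  next two lemmas argue with these instead of \<open>\<kappa>\<close>.\<close>

lemma norm_elem_sym_coeffs:
  fixes \<kappa> :: "'m::finite \<Rightarrow> real"
  assumes "k \<le> CARD('m)"
  shows "\<exists>A. size A = k \<and> (\<forall>l\<le>k. coeff (lin_prod A) (k - l) = real (k choose l) * norm_elem_sym l \<kappa>)"
  using assms
proof (induction rule: inc_induct)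
  case base
  let ?A = "image_mset \<kappa> (mset_set UNIV)"
  have "poly (lin_prod ?A) x = poly (\<Sum>l\<le>CARD('m). monom (elem_sym l \<kappa>) (CARD('m) - l)) x" for x
  proof -
    have "poly (lin_prod ?A) x = (\<Prod>i\<in>UNIV. x + \<kappa> i)"
      by (simp add: lin_prod_def poly_prod_mset image_mset.compositionality o_def add.commute
          prod_unfold_prod_mset)
    also have "\<dots> = poly (\<Sum>l\<le>CARD('m). monom (elem_sym l \<kappa>) (CARD('m) - l)) x"
      unfolding prod_linear_eq_elem_sym by (simp add: poly_sum poly_monom)
    finally show ?thesis .
  qed
  then have *: "lin_prod ?A = (\<Sum>l\<le>CARD('m). monom (elem_sym l \<kappa>) (CARD('m) - l))"
    by (simp add: poly_eq_poly_eq_iff[symmetric] fun_eq_iff)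
  have "coeff (lin_prod ?A) (CARD('m) - l) = elem_sym l \<kappa>" if "l \<le> CARD('m)" for l
  proof -
    have "coeff (lin_prod ?A) (CARD('m) - l) = (\<Sum>j\<le>CARD('m). if j = l then elem_sym j \<kappa> else 0)"
      unfolding * coeff_sum using that by (intro sum.cong) auto
    then show ?thesis using that by simp
  qed
  then show ?case by (intro exI[of _ ?A]) (auto simp: norm_elem_sym_def)
next
  case (step k)
  then obtain A where A: "size A = Suc k"
    "\<And>l. l \<le> Suc k \<Longrightarrow> coeff (lin_prod A) (Suc k - l) = real (Suc k choose l) * norm_elem_sym l \<kappa>"
    by auto
  obtain B where B: "size B = k" "pderiv (lin_prod A) = smult (real (Suc k)) (lin_prod B)"
    using pderiv_lin_prod[OF A(1)] by blast
  have "coeff (lin_prod B) (k - l) = real (k choose l) * norm_elem_sym l \<kappa>" if "l \<le> k" for l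
  proof -
    have "real (Suc k) * coeff (lin_prod B) (k - l) = coeff (pderiv (lin_prod A)) (k - l)"
      by (simp add: B)
    also have "\<dots> = real (Suc k - l) * (real (Suc k choose l) * norm_elem_sym l \<kappa>)"
      using that A(2)[of l] by (simp add: coeff_pderiv Suc_diff_le)
    \<comment> \<open>The absorption identity is what makes the binomial normalization survive the
      derivative.\<close>
    also have "\<dots> = real (Suc k) * (real (k choose l) * norm_elem_sym l \<kappa>)"
    proof -
      have "(Suc k - l) * (Suc k choose l) = Suc k * (k choose l)"
        using binomial_absorb_comp[of "Suc k" l] by simp
      then show ?thesis by (metis mult.assoc of_nat_mult)
    qed
    finally show ?thesis by (simp del: of_nat_Suc)
  qed
  with B show ?case by blast
qed

text \<open>The \<open>k\<close> reduced numbers have nonnegative coefficients and positive product,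
  so they are positive, and then all coefficients are. This excludes boundary points of the
  positivity set as long as the top function is positive.\<close>

lemma norm_elem_sym_closure_pos:
  fixes \<kappa> :: "'m::finite \<Rightarrow> real"
  assumes "k \<le> CARD('m)" "\<And>l. l \<le> k \<Longrightarrow> norm_elem_sym l \<kappa> \<ge> 0" "norm_elem_sym k \<kappa> > 0" "l \<le> k"
  shows "norm_elem_sym l \<kappa> > 0"
proof -
  obtain A where A: "size A = k" 
    "\<And>l. l \<le> k \<Longrightarrow> coeff (lin_prod A) (k - l) = real (k choose l) * norm_elem_sym l \<kappa>"
    using norm_elem_sym_coeffs[OF assms(1)] by blast
  have c: "coeff (lin_prod A) i \<ge> 0" if "i \<le> size A" for i
    using A(2)[of "k - i"] assms(2)[of "k - i"] that A(1) by simp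
  have "coeff (lin_prod A) 0 > 0" using A(2)[of k] assms(3) by simp
  then have "\<And>a. a \<in># A \<Longrightarrow> a > 0" using lin_prod_nonneg_coeffs_imp_pos[OF c] by blast
  from coeff_lin_prod_pos[OF this, of A "k - l"] show ?thesis
    using A assms(4) by (simp add: zero_less_mult_iff)
qed

text \<open>The arithmetic-harmonic inequality for the \<open>Suc l\<close> reduced numbers:
  coefficients 0 and 1 and the sum of the entries are the normalized functions of index
  \<open>Suc l\<close>, \<open>l\<close> and 1, the last two times \<open>Suc l\<close>, so the
  square of \<open>Suc l\<close> cancels.\<close>

lemma norm_elem_sym_Suc_le:
  fixes \<kappa> :: "'m::finite \<Rightarrow> real"
  assumes "Suc l \<le> CARD('m)" "\<And>j. j \<le> Suc l \<Longrightarrow> norm_elem_sym j \<kappa> > 0"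
  shows "norm_elem_sym (Suc l) \<kappa> \<le> norm_elem_sym 1 \<kappa> * norm_elem_sym l \<kappa>"
proof -
  obtain A where A: "size A = Suc l" 
    "\<And>j. j \<le> Suc l \<Longrightarrow> coeff (lin_prod A) (Suc l - j) = real (Suc l choose j) * norm_elem_sym j \<kappa>"
    using norm_elem_sym_coeffs[OF assms(1)] by blast
  have c: "coeff (lin_prod A) i \<ge> 0" if "i \<le> size A" for i
    using A(2)[of "Suc l - i"] assms(2)[of "Suc l - i"] that A(1) by simp
  have c0: "coeff (lin_prod A) 0 = norm_elem_sym (Suc l) \<kappa>" using A(2)[of "Suc l"] by simp
  then have "\<And>a. a \<in># A \<Longrightarrow> a > 0"
    using lin_prod_nonneg_coeffs_imp_pos[OF c] assms(2)[of "Suc l"] by simp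
  from lin_prod_am_hm[OF this] have
    "(real (size A))\<^sup>2 * coeff (lin_prod A) 0 \<le> coeff (lin_prod A) 1 * sum_mset A" by blast
  moreover have "sum_mset A = real (Suc l) * norm_elem_sym 1 \<kappa>"
    using A(2)[of 1] coeff_lin_prod_subleading[OF A(1)] by simp
  moreover have "coeff (lin_prod A) 1 = real (Suc l) * norm_elem_sym l \<kappa>"
    using A(2)[of l] by simp
  ultimately have "(real (Suc l))\<^sup>2 * norm_elem_sym (Suc l) \<kappa>
     \<le> (real (Suc l))\<^sup>2 * (norm_elem_sym 1 \<kappa> * norm_elem_sym l \<kappa>)"
    unfolding A(1) c0 by (simp add: power2_eq_square mult_ac)
  then show ?thesis by (subst (asm) mult_le_cancel_left_pos) auto
qed

lemma norm_elem_sym_le_power: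
  fixes \<kappa> :: "'m::finite \<Rightarrow> real"
  assumes "i + d \<le> CARD('m)" "\<And>j. j \<le> i + d \<Longrightarrow> norm_elem_sym j \<kappa> > 0"
  shows "norm_elem_sym (i + d) \<kappa> \<le> norm_elem_sym 1 \<kappa> ^ d * norm_elem_sym i \<kappa>"
  using assms
proof (induction d)
  case (Suc d)
  have "norm_elem_sym (i + Suc d) \<kappa> \<le> norm_elem_sym 1 \<kappa> * norm_elem_sym (i + d) \<kappa>"
    using norm_elem_sym_Suc_le[of "i + d" \<kappa>] Suc.prems by auto
  also have "\<dots> \<le> norm_elem_sym 1 \<kappa> * (norm_elem_sym 1 \<kappa> ^ d * norm_elem_sym i \<kappa>)"
    using Suc.IH Suc.prems by (intro mult_left_mono) (auto intro: less_imp_le)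
  finally show ?case by (simp add: mult.assoc)
qed simp

lemma elem_sym_1: "elem_sym 1 \<kappa> = (\<Sum>i\<in>UNIV. \<kappa> i)"
proof -
  have "{S::'a set. card S = 1} = (\<lambda>i. {i}) ` UNIV" by (auto simp: card_1_singleton_iff)
  then show ?thesis by (simp add: elem_sym_def sum.reindex)
qed

text \<open>Double counting: a set of size \<open>l\<close> has m - l one-point extensions, each
  contributing a new factor of at least \<open>s\<close>, and every set of size \<open>Suc l\<close>
  arises in this way exactly \<open>Suc l\<close> times.\<close>

lemma elem_sym_Suc_ge:
  fixes \<kappa> :: "'m::finite \<Rightarrow> real"
  assumes "\<And>i. \<kappa> i \<ge> s" "s \<ge> 0"
  shows "real (CARD('m) - l) * elem_sym l \<kappa> * s \<le> real (Suc l) * elem_sym (Suc l) \<kappa>"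
proof -
  have nn: "\<kappa> i \<ge> 0" for i using assms order_trans by blast
  have "real (CARD('m) - l) * elem_sym l \<kappa> * s = (\<Sum>S\<in>{S::'m set. card S = l}. \<Sum>i\<in>-S. prod \<kappa> S * s)"
    unfolding elem_sym_def sum_distrib_left sum_distrib_right
    by (intro sum.cong) (auto simp: Compl_eq_Diff_UNIV card_Diff_subset)
  also have "\<dots> \<le> (\<Sum>S\<in>{S::'m set. card S = l}. \<Sum>i\<in>-S. prod \<kappa> S * \<kappa> i)"
    using assms nn by (intro sum_mono mult_left_mono prod_nonneg) auto
  also have "\<dots> = (\<Sum>(S,i)\<in>(SIGMA S:{S. card S = l}. -S). prod \<kappa> S * \<kappa> i)"
    by (rule sum.Sigma) auto
  also have "\<dots> = (\<Sum>(S,i)\<in>(SIGMA S:{S. card S = Suc l}. S). prod \<kappa> S)"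
    by (rule sum.reindex_bij_witness[where i = "\<lambda>(S,i). (S - {i}, i)" and j = "\<lambda>(S,i). (insert i S, i)"])
      (auto simp: mult.commute)
  also have "\<dots> = (\<Sum>S\<in>{S. card S = Suc l}. \<Sum>i\<in>S. prod \<kappa> S)"
    by (rule sum.Sigma[symmetric]) auto
  also have "\<dots> = real (Suc l) * elem_sym (Suc l) \<kappa>"
    unfolding elem_sym_def sum_distrib_left by (intro sum.cong) auto
  finally show ?thesis .
qed

lemma norm_elem_sym_Suc_ge:
  fixes \<kappa> :: "'m::finite \<Rightarrow> real"
  assumes "\<And>i. \<kappa> i \<ge> s" "s \<ge> 0" "l < CARD('m)"
  shows "norm_elem_sym l \<kappa> * s \<le> norm_elem_sym (Suc l) \<kappa>"
proof -
  let ?m = "CARD('m)"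
  have "Suc l * (?m choose Suc l) = (?m - l) * (?m choose l)"
    using binomial_absorption[of l "?m"] binomial_absorb_comp[of ?m l]
    by (metis)
  then have b: "real (Suc l) * real (?m choose Suc l) = real (?m - l) * real (?m choose l)"
    by (metis of_nat_mult)
  have c: "real (?m choose l) > 0" "real (?m choose Suc l) > 0" using assms(3) by auto
  have "real (?m - l) * elem_sym l \<kappa> * s = (real (?m - l) * real (?m choose l)) * (norm_elem_sym l \<kappa> * s)"
    using c by (simp add: norm_elem_sym_def)
  moreover have "real (Suc l) * elem_sym (Suc l) \<kappa> = (real (Suc l) * real (?m choose Suc l)) * norm_elem_sym (Suc l) \<kappa>"
    using c by (simp add: norm_elem_sym_def)
  ultimately have "(real (?m - l) * real (?m choose l)) * (norm_elem_sym l \<kappa> * s)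
     \<le> (real (?m - l) * real (?m choose l)) * norm_elem_sym (Suc l) \<kappa>"
    using elem_sym_Suc_ge[of s \<kappa> l, OF assms(1,2)] b by metis
  then show ?thesis using c assms(3) by (subst (asm) mult_le_cancel_left_pos) auto
qed

text \<open>The counterpart of \<open>norm_elem_sym_le_power\<close>. It serves at a point farthest
  from the origin, where all curvatures have a common positive lower bound.\<close>

lemma norm_elem_sym_ge_power:
  fixes \<kappa> :: "'m::finite \<Rightarrow> real"
  assumes "\<And>i. \<kappa> i \<ge> s" "s \<ge> 0" "i + d \<le> CARD('m)"
  shows "norm_elem_sym i \<kappa> * s ^ d \<le> norm_elem_sym (i + d) \<kappa>"
  using assms(3)
proof (induction d)
  case (Suc d)
  have "norm_elem_sym i \<kappa> * s ^ Suc d = (norm_elem_sym i \<kappa> * s ^ d) * s" by simp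
  also have "\<dots> \<le> norm_elem_sym (i + d) \<kappa> * s" using Suc assms by (intro mult_right_mono) auto
  also have "\<dots> \<le> norm_elem_sym (i + Suc d) \<kappa>"
    using norm_elem_sym_Suc_ge[of s \<kappa> "i + d", OF assms(1,2)] Suc.prems by simp
  finally show ?case .
qed simp

lemma elem_sym_pos:
  fixes \<kappa> :: "'m::finite \<Rightarrow> real"
  assumes "\<And>i. \<kappa> i > 0" "j \<le> CARD('m)"
  shows "elem_sym j \<kappa> > 0"
proof -
  obtain S :: "'m set" where "card S = j" using assms(2) obtain_subset_with_card_n by metis
  then show ?thesis unfolding elem_sym_def using assms by (intro sum_pos) (auto intro: prod_pos)
qed

lemma norm_elem_sym_pos:
  fixes \<kappa> :: "'m::finite \<Rightarrow> real"
  assumes "\<And>i. \<kappa> i > 0" "j \<le> CARD('m)"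
  shows "norm_elem_sym j \<kappa> > 0"
  using elem_sym_pos[OF assms] assms(2) by (simp add: norm_elem_sym_def)


section \<open>Self-adjoint maps on subspaces\<close>

text \<open>The eigenvector maximizes the Rayleigh quotient on the unit sphere of \<open>W\<close>.
  Symmetry is asked only on \<open>W\<close> because the shape operator, extended to the ambient
  space, is symmetric only on the tangent space.\<close>

lemma self_adjoint_eigenvector:
  fixes L :: "'a::euclidean_space \<Rightarrow> 'a"
  assumes "linear L" "subspace W" "W \<noteq> {0}" "L ` W \<subseteq> W"
    and sym: "\<And>x y. x \<in> W \<Longrightarrow> y \<in> W \<Longrightarrow> L x \<bullet> y = x \<bullet> L y"
  obtains x \<mu> where "x \<in> W" "norm x = 1" "L x = \<mu> *\<^sub>R x"
proof -
  let ?K = "W \<inter> sphere 0 1"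
  have cont: "continuous_on A L" for A
    using assms(1) by (simp add: linear_continuous_on linear_conv_bounded_linear)
  have comp: "compact ?K" using closed_subspace[OF assms(2)] by (intro closed_Int_compact) auto
  obtain z where z: "z \<in> W" "z \<noteq> 0" using assms(2,3) subspace_0 by blast
  have "(1 / norm z) *\<^sub>R z \<in> ?K" using z assms(2) by (simp add: subspace_scale)
  then have "?K \<noteq> {}" by blast
  then obtain x where x: "x \<in> ?K" and max: "\<And>y. y \<in> ?K \<Longrightarrow> L y \<bullet> y \<le> L x \<bullet> x"
    using continuous_attains_sup[OF comp, of "\<lambda>y. L y \<bullet> y"]
      continuous_on_inner[OF cont continuous_on_id] by blast
  define \<mu> where "\<mu> = L x \<bullet> x"
  have le: "L y \<bullet> y \<le> \<mu> * (y \<bullet> y)" if "y \<in> W" for y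
  proof (cases "y = 0")
    case False
    then have "(1 / norm y) *\<^sub>R y \<in> ?K" using that assms(2) by (simp add: subspace_scale)
    from max[OF this] have "L y \<bullet> y / (norm y)\<^sup>2 \<le> \<mu>"
      by (simp add: linear_scale[OF assms(1)] power2_eq_square \<mu>_def)
    then show ?thesis using False by (simp add: field_simps power2_norm_eq_inner[symmetric])
  qed (simp add: linear_0[OF assms(1)])
  have orth: "(L x - \<mu> *\<^sub>R x) \<bullet> y = 0" if y: "y \<in> W" for y
  proof -
    define b where "b = (L x - \<mu> *\<^sub>R x) \<bullet> y"
    define d where "d = L y \<bullet> y - \<mu> * (y \<bullet> y)"
    \<comment> \<open>The inequality \<open>le\<close> at \<open>x + t *\<^sub>R y\<close>: the
      terms of order zero in \<open>t\<close> cancel, and \<open>b\<close> is the first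
      variation.\<close>
    have "2 * t * b + t\<^sup>2 * d \<le> 0" for t
    proof -
      have "x + t *\<^sub>R y \<in> W" using x y assms(2) by (simp add: subspace_add subspace_scale)
      from le[OF this] have "L (x + t *\<^sub>R y) \<bullet> (x + t *\<^sub>R y) \<le> \<mu> * ((x + t *\<^sub>R y) \<bullet> (x + t *\<^sub>R y))" .
      moreover have "L y \<bullet> x = L x \<bullet> y" using sym[of y x] x y by (simp add: inner_commute)
      moreover have "x \<bullet> x = 1" using x by (simp add: norm_eq_1)
      moreover have "L x \<bullet> x = \<mu>" by (simp add: \<mu>_def)
      ultimately show ?thesis
        unfolding b_def d_def linear_add[OF assms(1)] linear_scale[OF assms(1)]
        by (simp add: inner_simps power2_eq_square algebra_simps inner_commute)
    qed
    note q = this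
    have "b = 0"
    proof (rule ccontr)
      assume "b \<noteq> 0"
      \<comment> \<open>Small enough that the quadratic term is at most \<open>t * b\<close> in
        absolute value, which is half of the linear term \<open>2 * t * b\<close>.\<close>
      define t where "t = b / (\<bar>d\<bar> + 1)"
      have "t\<^sup>2 * d \<ge> - (t\<^sup>2 * (\<bar>d\<bar> + 1))"
      proof -
        have "- (\<bar>d\<bar> + 1) \<le> d" by linarith
        from mult_left_mono[OF this, of "t\<^sup>2"] show ?thesis by (simp add: algebra_simps)
      qed
      moreover have "t\<^sup>2 * (\<bar>d\<bar> + 1) = t * b" by (simp add: t_def power2_eq_square)
      moreover have "t * b > 0" using \<open>b \<noteq> 0\<close>
        by (simp add: t_def power2_eq_square[symmetric] add_nonneg_pos)
      ultimately show False using q[of t] by linarith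
    qed
    then show ?thesis by (simp add: b_def)
  qed
  have "L x - \<mu> *\<^sub>R x \<in> W" using x assms(2,4) by (intro subspace_diff subspace_scale) auto
  from orth[OF this] have "L x = \<mu> *\<^sub>R x" by simp
  then show ?thesis using that x by auto
qed

text \<open>Induction on the dimension: the orthogonal complement in \<open>W\<close> of a unit
  eigenvector is again invariant, by symmetry.\<close>

lemma self_adjoint_orthonormal_eigenbasis:
  fixes L :: "'a::euclidean_space \<Rightarrow> 'a"
  assumes "linear L" "subspace W" "L ` W \<subseteq> W"
    and "\<And>x y. x \<in> W \<Longrightarrow> y \<in> W \<Longrightarrow> L x \<bullet> y = x \<bullet> L y"
  obtains B where "B \<subseteq> W" "pairwise orthogonal B" "\<And>b. b \<in> B \<Longrightarrow> norm b = 1" "card B = dim W"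
    "\<And>b. b \<in> B \<Longrightarrow> \<exists>\<mu>. L b = \<mu> *\<^sub>R b"
proof -
  have "\<exists>B \<subseteq> W. pairwise orthogonal B \<and> (\<forall>b\<in>B. norm b = 1) \<and> card B = dim W \<and> (\<forall>b\<in>B. \<exists>\<mu>. L b = \<mu> *\<^sub>R b)"
    using assms
  proof (induction "dim W" arbitrary: W)
    case 0
    then show ?case by (intro exI[of _ "{}"]) auto
  next
    case (Suc d)
    have "W \<noteq> {0}" using Suc(2) by auto
    then obtain x \<mu> where x: "x \<in> W" "norm x = 1" "L x = \<mu> *\<^sub>R x"
      using self_adjoint_eigenvector[OF Suc(3,4) _ Suc(5,6)] by metis
    define V where "V = {y \<in> W. x \<bullet> y = 0}"
    have sV: "subspace V" unfolding V_def using Suc(4)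
      by (auto simp: subspace_def inner_simps)
    have "L ` V \<subseteq> V"
    proof
      fix z assume "z \<in> L ` V"
      then obtain y where y: "z = L y" "y \<in> W" "x \<bullet> y = 0" by (auto simp: V_def)
      have "x \<bullet> L y = L x \<bullet> y" using Suc(6)[of x y] x y by simp
      then show "z \<in> V" using x y Suc(5) by (auto simp: V_def)
    qed
    have spW: "W \<subseteq> span (insert x V)"
    proof
      fix w assume w: "w \<in> W"
      have "w - (x \<bullet> w) *\<^sub>R x \<in> V"
        using w x Suc(4) by (auto simp: V_def subspace_diff subspace_scale inner_diff_right norm_eq_1)
      then have "w - (x \<bullet> w) *\<^sub>R x \<in> span (insert x V)" by (auto intro: span_base)
      moreover have "(x \<bullet> w) *\<^sub>R x \<in> span (insert x V)" by (intro span_scale span_base) auto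
      ultimately have "(w - (x \<bullet> w) *\<^sub>R x) + (x \<bullet> w) *\<^sub>R x \<in> span (insert x V)" by (rule span_add)
      then show "w \<in> span (insert x V)" by simp
    qed
    have xV: "x \<notin> V" using x by (auto simp: V_def norm_eq_1)
    have "dim W \<le> dim (insert x V)" using spW dim_subset dim_span by metis
    moreover have "dim (insert x V) \<le> dim W"
      using x by (intro dim_subset) (auto simp: V_def)
    moreover have "x \<notin> span V" using xV sV by (metis span_eq_iff)
    then have "dim (insert x V) = Suc (dim V)" by (simp add: dim_insert)
    ultimately have dV: "d = dim V" using Suc(2) by simp
    have "V \<subseteq> W" by (auto simp: V_def)
    with Suc(1)[OF dV Suc(3) sV \<open>L ` V \<subseteq> V\<close>] Suc(6) obtain B where
      B: "B \<subseteq> V" "pairwise orthogonal B" "\<forall>b\<in>B. norm b = 1" "card B = dim V" "\<forall>b\<in>B. \<exists>\<mu>. L b = \<mu> *\<^sub>R b"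
      by blast
    have "finite B" using B(2,3) by (metis pairwise_orthogonal_imp_finite)
    have "x \<notin> B" using B xV by auto
    show ?case
    proof (intro exI[of _ "insert x B"] conjI)
      show "insert x B \<subseteq> W" using B x by (auto simp: V_def)
      show "pairwise orthogonal (insert x B)"
        using B by (auto simp: pairwise_insert V_def orthogonal_def inner_commute)
      show "card (insert x B) = dim W" using B dV Suc(2) \<open>finite B\<close> \<open>x \<notin> B\<close> by simp
    qed (use B x in auto)
  qed
  then show ?thesis using that by blast
qed


section \<open>Mixed derivatives and the strong minimum principle\<close>

lemma has_derivative_on_line:
  fixes g :: "'a::real_normed_vector \<Rightarrow> real"
  assumes "(g has_derivative g') (at (x + t *\<^sub>R e))"
  shows "((\<lambda>t. g (x + t *\<^sub>R e)) has_real_derivative g' e) (at t)"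
proof -
  have "((\<lambda>t. x + t *\<^sub>R e) has_derivative (\<lambda>s. s *\<^sub>R e)) (at t)"
    by (auto intro!: derivative_eq_intros)
  from has_derivative_compose[OF this, of g g'] assms
  have "((\<lambda>t. g (x + t *\<^sub>R e)) has_derivative (\<lambda>s. g' (s *\<^sub>R e))) (at t)" by simp
  moreover have "(\<lambda>s. g' (s *\<^sub>R e)) = (\<lambda>s. g' e * s)"
    using has_derivative_linear[OF assms] by (auto simp: linear_scale mult.commute)
  ultimately show ?thesis by (simp add: has_field_derivative_def)
qed

text \<open>On the line through \<open>x\<close> along \<open>e\<close> the first derivative
  vanishes at \<open>x\<close>. If \<open>h e\<close> were negative, it would be negative just
  after, and the mean value theorem would give a value below the minimum. The second derivative is
  needed at \<open>x\<close> only.\<close>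

lemma local_min_derivatives:
  fixes g :: "'a::real_normed_vector \<Rightarrow> real"
  assumes "r > 0"
    and der: "\<And>y. y \<in> ball x r \<Longrightarrow> (g has_derivative g' y) (at y)"
    and der2: "((\<lambda>y. g' y e) has_derivative h) (at x)"
    and min: "\<And>y. y \<in> ball x r \<Longrightarrow> g x \<le> g y"
  shows "g' x e = 0" "h e \<ge> 0"
proof -
  \<comment> \<open>The added 1 covers \<open>e = 0\<close>.\<close>
  define d where "d = r / (norm e + 1)"
  have d: "d > 0" unfolding d_def using assms(1) by (simp add: add_nonneg_pos)
  have in_ball: "x + t *\<^sub>R e \<in> ball x r" if "\<bar>t\<bar> < d" for t
  proof -
    have "\<bar>t\<bar> * norm e \<le> \<bar>t\<bar> * (norm e + 1)" by (intro mult_left_mono) auto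
    also have "\<dots> < d * (norm e + 1)" using that by (intro mult_strict_right_mono) (auto simp: add_nonneg_pos)
    also have "\<dots> = r" by (simp add: d_def add_nonneg_eq_0_iff)
    finally show ?thesis by (simp add: dist_norm)
  qed
  let ?p = "\<lambda>t. g (x + t *\<^sub>R e)"
  have D: "(?p has_real_derivative g' (x + t *\<^sub>R e) e) (at t)" if "\<bar>t\<bar> < d" for t
    using der[OF in_ball[OF that]] by (rule has_derivative_on_line)
  show 0: "g' x e = 0"
    by (rule DERIV_local_min[of ?p _ 0 d]) (use D[of 0] d in_ball min in auto)
  show "h e \<ge> 0"
  proof (rule ccontr)
    assume "\<not> h e \<ge> 0"
    have "((\<lambda>t. g' (x + t *\<^sub>R e) e) has_real_derivative h e) (at 0)"
      using has_derivative_on_line[of "\<lambda>y. g' y e" h x 0 e] der2 by simp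
    from DERIV_neg_dec_right[OF this] \<open>\<not> h e \<ge> 0\<close> 0 obtain d' where d': "d' > 0"
      "\<And>t. 0 < t \<Longrightarrow> t < d' \<Longrightarrow> g' (x + t *\<^sub>R e) e < 0" by auto
    define t where "t = min d d' / 2"
    have t: "0 < t" "t < d" "t < d'" using d d' by (auto simp: t_def)
    obtain s where s: "0 < s" "s < t" "?p t - ?p 0 = (t - 0) * g' (x + s *\<^sub>R e) e"
      using MVT2[of 0 t ?p "\<lambda>s. g' (x + s *\<^sub>R e) e"] D t by auto
    have "g' (x + s *\<^sub>R e) e < 0" using d'(2) s t by auto
    then have "t * g' (x + s *\<^sub>R e) e < 0" using t by (simp add: mult_pos_neg)
    then have "?p t < ?p 0" using s by simp
    then show False using min[OF in_ball[of t]] t by simp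
  qed
qed

lemma mixed_difference_MVT:
  fixes f :: "'a::real_normed_vector \<Rightarrow> real"
  assumes "h > 0"
    and sq: "\<And>s t. 0 \<le> s \<Longrightarrow> s \<le> h \<Longrightarrow> 0 \<le> t \<Longrightarrow> t \<le> h \<Longrightarrow> x + s *\<^sub>R v + t *\<^sub>R w \<in> S"
    and der: "\<And>y. y \<in> S \<Longrightarrow> (f has_derivative f' y) (at y)"
    and der2: "\<And>y. y \<in> S \<Longrightarrow> ((\<lambda>z. f' z v) has_derivative fv y) (at y)"
  obtains s t where "0 < s" "s < h" "0 < t" "t < h"
    "f (x + h *\<^sub>R v + h *\<^sub>R w) - f (x + h *\<^sub>R v) - f (x + h *\<^sub>R w) + f x
       = h\<^sup>2 * fv (x + s *\<^sub>R v + t *\<^sub>R w) w"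
proof -
  let ?g = "\<lambda>s. f ((x + h *\<^sub>R w) + s *\<^sub>R v) - f (x + s *\<^sub>R v)"
  have "(?g has_real_derivative f' ((x + h *\<^sub>R w) + s *\<^sub>R v) v - f' (x + s *\<^sub>R v) v) (at s)"
    if "0 \<le> s" "s \<le> h" for s
    using that assms(1) sq[of s h] sq[of s 0]
    by (intro DERIV_diff has_derivative_on_line der) (auto simp: algebra_simps)
  from MVT2[OF assms(1) this] obtain s where s: "0 < s" "s < h"
    "?g h - ?g 0 = (h - 0) * (f' ((x + h *\<^sub>R w) + s *\<^sub>R v) v - f' (x + s *\<^sub>R v) v)" by blast
  let ?k = "\<lambda>t. f' ((x + s *\<^sub>R v) + t *\<^sub>R w) v"
  have "(?k has_real_derivative fv ((x + s *\<^sub>R v) + t *\<^sub>R w) w) (at t)"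
    if "0 \<le> t" "t \<le> h" for t
    using that s sq[of s t] has_derivative_on_line[OF der2[of "(x + s *\<^sub>R v) + t *\<^sub>R w"]] by simp
  from MVT2[OF assms(1) this] obtain t where t: "0 < t" "t < h"
    "?k h - ?k 0 = (h - 0) * fv ((x + s *\<^sub>R v) + t *\<^sub>R w) w" by blast
  have e: "(x + h *\<^sub>R w) + s *\<^sub>R v = (x + s *\<^sub>R v) + h *\<^sub>R w" by simp
  have "?g h - ?g 0 = h * (?k h - ?k 0)" using s(3) unfolding e by simp
  also have "\<dots> = h\<^sup>2 * fv (x + s *\<^sub>R v + t *\<^sub>R w) w" using t(3) by (simp add: power2_eq_square)
  finally have "?g h - ?g 0 = h\<^sup>2 * fv (x + s *\<^sub>R v + t *\<^sub>R w) w" .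
  moreover have "?g h - ?g 0 = f (x + h *\<^sub>R v + h *\<^sub>R w) - f (x + h *\<^sub>R v) - f (x + h *\<^sub>R w) + f x"
    by (simp add: algebra_simps)
  ultimately show ?thesis using that s t by metis
qed

text \<open>The second difference over a small parallelogram does not change when \<open>v\<close>
  and \<open>w\<close> are exchanged, so the two mixed derivatives agree at two points near
  \<open>x\<close>; continuity moves both points to \<open>x\<close>.\<close>

lemma mixed_derivatives_commute_real:
  fixes f :: "'a::real_normed_vector \<Rightarrow> real"
  assumes "open S" "x \<in> S"
    and der: "\<And>y. y \<in> S \<Longrightarrow> (f has_derivative f' y) (at y)"
    and derv: "\<And>y. y \<in> S \<Longrightarrow> ((\<lambda>z. f' z v) has_derivative fv y) (at y)"
    and derw: "\<And>y. y \<in> S \<Longrightarrow> ((\<lambda>z. f' z w) has_derivative fw y) (at y)"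
    and cont: "continuous_on S (\<lambda>y. fv y w)" "continuous_on S (\<lambda>y. fw y v)"
  shows "fv x w = fw x v"
proof (rule ccontr)
  assume ne: "fv x w \<noteq> fw x v"
  define e where "e = \<bar>fv x w - fw x v\<bar> / 2"
  have e: "e > 0" using ne by (simp add: e_def)
  from cont assms(1,2) have "isCont (\<lambda>y. fv y w) x" "isCont (\<lambda>y. fw y v) x"
    by (simp_all add: continuous_on_eq_continuous_at)
  with e obtain d1 d2 where d: "d1 > 0" "\<And>y. dist y x < d1 \<Longrightarrow> dist (fv y w) (fv x w) < e"
     "d2 > 0" "\<And>y. dist y x < d2 \<Longrightarrow> dist (fw y v) (fw x v) < e"
    unfolding continuous_at_eps_delta by metis
  obtain d3 where d3: "d3 > 0" "ball x d3 \<subseteq> S" using assms(1,2) open_contains_ball by metis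
  define d0 where "d0 = min (min d1 d2) d3"
  define q where "q = norm v + norm w + 1"
  \<comment> \<open>Keeps the parallelogram spanned by \<open>h *\<^sub>R v\<close> and
    \<open>h *\<^sub>R w\<close> within d0 / 2 of \<open>x\<close>.\<close>
  define h where "h = d0 / (2 * q)"
  have n: "q > 0" by (simp add: q_def add_nonneg_pos)
  have d0: "d0 > 0" using d d3 by (simp add: d0_def)
  have h: "h > 0" using d0 n by (simp add: h_def)
  have small: "dist (x + s *\<^sub>R v + t *\<^sub>R w) x < d0" if "0 \<le> s" "s \<le> h" "0 \<le> t" "t \<le> h" for s t
  proof -
    have "dist (x + s *\<^sub>R v + t *\<^sub>R w) x = norm (s *\<^sub>R v + t *\<^sub>R w)" by (simp add: dist_norm add.assoc)
    also have "\<dots> \<le> s * norm v + t * norm w" using that by (intro norm_triangle_le) simp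
    also have "\<dots> \<le> h * norm v + h * norm w" using that by (intro add_mono mult_right_mono) auto
    also have "\<dots> \<le> h * q" using h by (simp add: q_def algebra_simps)
    also have "\<dots> = d0 / 2" using n by (simp add: h_def)
    finally show ?thesis using d0 by linarith
  qed
  have inS: "x + s *\<^sub>R v + t *\<^sub>R w \<in> S" if "0 \<le> s" "s \<le> h" "0 \<le> t" "t \<le> h" for s t
    using small[OF that] d3 by (auto simp: d0_def dist_commute)
  have inS': "x + s *\<^sub>R w + t *\<^sub>R v \<in> S" if "0 \<le> s" "s \<le> h" "0 \<le> t" "t \<le> h" for s t
    using inS[of t s] that by (simp add: add_ac)
  obtain s t where st: "0 < s" "s < h" "0 < t" "t < h"
    "f (x + h *\<^sub>R v + h *\<^sub>R w) - f (x + h *\<^sub>R v) - f (x + h *\<^sub>R w) + f x = h\<^sup>2 * fv (x + s *\<^sub>R v + t *\<^sub>R w) w"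
    using mixed_difference_MVT[OF h inS der derv] by blast
  obtain s' t' where st': "0 < s'" "s' < h" "0 < t'" "t' < h"
    "f (x + h *\<^sub>R w + h *\<^sub>R v) - f (x + h *\<^sub>R w) - f (x + h *\<^sub>R v) + f x = h\<^sup>2 * fw (x + s' *\<^sub>R w + t' *\<^sub>R v) v"
    using mixed_difference_MVT[OF h inS' der derw] by blast
  have "f (x + h *\<^sub>R w + h *\<^sub>R v) = f (x + h *\<^sub>R v + h *\<^sub>R w)" by (simp add: add_ac)
  with st(5) st'(5) have "h\<^sup>2 * fv (x + s *\<^sub>R v + t *\<^sub>R w) w = h\<^sup>2 * fw (x + s' *\<^sub>R w + t' *\<^sub>R v) v"
    by linarith
  then have eq: "fv (x + s *\<^sub>R v + t *\<^sub>R w) w = fw (x + t' *\<^sub>R v + s' *\<^sub>R w) v"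
    using h by (simp add: add_ac)
  have "dist (fv (x + s *\<^sub>R v + t *\<^sub>R w) w) (fv x w) < e"
    using d(2) small[of s t] st by (auto simp: d0_def)
  moreover have "dist (fw (x + t' *\<^sub>R v + s' *\<^sub>R w) v) (fw x v) < e"
    using d(4) small[of t' s'] st' by (auto simp: d0_def)
  ultimately have "\<bar>fv x w - fw x v\<bar> < 2 * e" unfolding eq dist_real_def by linarith
  then show False by (simp add: e_def)
qed

lemma mixed_derivatives_commute:
  fixes f :: "'a::real_normed_vector \<Rightarrow> 'b::euclidean_space"
  assumes "open S" "x \<in> S"
    and der: "\<And>y. y \<in> S \<Longrightarrow> (f has_derivative f' y) (at y)"
    and derv: "\<And>y. y \<in> S \<Longrightarrow> ((\<lambda>z. f' z v) has_derivative fv y) (at y)"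
    and derw: "\<And>y. y \<in> S \<Longrightarrow> ((\<lambda>z. f' z w) has_derivative fw y) (at y)"
    and cont: "continuous_on S (\<lambda>y. fv y w)" "continuous_on S (\<lambda>y. fw y v)"
  shows "fv x w = fw x v"
proof (rule euclidean_eqI)
  fix b :: 'b assume "b \<in> Basis"
  show "fv x w \<bullet> b = fw x v \<bullet> b"
    by (rule mixed_derivatives_commute_real[where f = "\<lambda>y. f y \<bullet> b" and f' = "\<lambda>y u. f' y u \<bullet> b"
          and fv = "\<lambda>y u. fv y u \<bullet> b" and fw = "\<lambda>y u. fw y u \<bullet> b" and S = S])
      (use assms in \<open>auto intro!: has_derivative_inner_left continuous_intros\<close>)
qed

text \<open>Hopf's barrier argument. The assumption \<open>ell\<close> stands for an elliptic
  operator whose directions \<open>e i\<close> at \<open>x\<close> may depend on \<open>x\<close> in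
  any way: they are bounded, they span with a uniform constant, and the sum of second derivatives
  along them is at most \<open>C\<close> times any bound \<open>G\<close> on the gradient at
  \<open>x\<close>.\<close>

lemma strong_minimum_principle:
  fixes f :: "'a::euclidean_space \<Rightarrow> real"
  assumes "open S" "x0 \<in> S" "f x0 = m"
    and der: "\<And>x. x \<in> S \<Longrightarrow> (f has_derivative f' x) (at x)"
    and der2: "\<And>x e. x \<in> S \<Longrightarrow> ((\<lambda>y. f' y e) has_derivative f'' x e) (at x)"
    and min: "\<And>x. x \<in> S \<Longrightarrow> m \<le> f x"
    and ell: "\<And>K. compact K \<Longrightarrow> K \<subseteq> S \<Longrightarrow>
       \<exists>C>0. \<forall>x\<in>K. \<exists>e::'i::finite \<Rightarrow> 'a. (\<forall>i. norm (e i) \<le> C) \<and>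
          (\<forall>y. (norm y)\<^sup>2 \<le> C * (\<Sum>i\<in>UNIV. (e i \<bullet> y)\<^sup>2)) \<and>
          (\<forall>G. (\<forall>w. \<bar>f' x w\<bar> \<le> G * norm w) \<longrightarrow> (\<Sum>i\<in>UNIV. f'' x (e i) (e i)) \<le> C * G)"
  shows "\<exists>r>0. ball x0 r \<subseteq> S \<and> (\<forall>x\<in>ball x0 r. f x = m)"
proof -
  have contf: "continuous_on A f" if "A \<subseteq> S" for A
    using der that by (meson continuous_at_imp_continuous_on has_derivative_continuous subset_eq)
  obtain r where r: "r > 0" "cball x0 r \<subseteq> S" using assms(1,2) open_contains_cball by metis
  \<comment> \<open>With half the radius, the ball about \<open>c0\<close> that reaches the nearest
    minimum point still lies inside \<open>ball x0 r\<close>.\<close>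
  have "f c0 = m" if c0: "c0 \<in> ball x0 (r/2)" for c0
  proof (rule ccontr)
    assume "f c0 \<noteq> m"
    then have fc0: "f c0 > m" using min[of c0] c0 r by (force simp: subset_eq)
    define Z where "Z = {x \<in> cball x0 r. f x = m}"
    have "closed Z" unfolding Z_def
      using continuous_closed_preimage[OF contf[OF r(2)] closed_cball closed_singleton[of m]]
      by (simp add: Int_def vimage_def)
    moreover have x0Z: "x0 \<in> Z" using assms(3) r by (auto simp: Z_def)
    ultimately obtain y where y: "y \<in> Z" "\<And>z. z \<in> Z \<Longrightarrow> dist c0 y \<le> dist c0 z"
      using distance_attains_inf[of Z c0] by blast
    have "x0 \<in> Z" by (fact x0Z)
    define d where "d = dist c0 y"
    have d: "0 < d" "d < r/2"
    proof -
      show "0 < d" using y(1) fc0 by (auto simp: d_def Z_def)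
      have "x0 \<in> Z" using assms(3) r by (auto simp: Z_def)
      from y(2)[OF this] c0 show "d < r/2" by (auto simp: d_def dist_commute)
    qed
    have inr: "dist x0 z < r" if "dist c0 z \<le> d" for z
      using dist_triangle[of x0 z c0] that c0 d by simp
    \<comment> \<open>The ball about \<open>c\<close> of half the radius meets the sphere of radius
      \<open>d\<close> about \<open>c0\<close> only at \<open>y\<close>, so \<open>y\<close> is the
      only minimum point in its closure.\<close>
    define c where "c = midpoint c0 y"
    define \<rho> where "\<rho> = d / 2"
    have \<rho>: "\<rho> > 0" using d by (simp add: \<rho>_def)
    have cy: "dist c y = \<rho>" "dist c0 c = \<rho>" by (simp_all add: c_def \<rho>_def d_def dist_midpoint)
    have fpos: "f z > m" if "dist c z \<le> \<rho>" "z \<noteq> y" for z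
    proof -
      have le: "dist c0 z \<le> d" using dist_triangle[of c0 z c] that cy by (simp add: \<rho>_def)
      have "dist c0 z \<noteq> d"
      proof
        assume eq: "dist c0 z = d"
        have "dist c0 c + dist c z = dist c0 z"
          using dist_triangle[of c0 z c] that cy eq by (simp add: \<rho>_def)
        moreover have cz: "dist c z = \<rho>" using calculation eq cy by (simp add: \<rho>_def)
        \<comment> \<open>Equality in the triangle inequality makes \<open>z - c\<close> and
          \<open>c - c0\<close> parallel; they have the same length, so \<open>z\<close> is the
          reflection of \<open>c0\<close> in \<open>c\<close>, which is \<open>y\<close>.\<close>
        ultimately have "norm (c - c0) *\<^sub>R (z - c) = norm (z - c) *\<^sub>R (c - c0)"
          using norm_triangle_eq[of "c - c0" "z - c"] by (simp add: dist_norm norm_minus_commute)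
        then have "z - c = c - c0" using cz cy \<rho> by (simp add: dist_norm norm_minus_commute)
        then have "z = 2 *\<^sub>R c - c0" by (simp add: algebra_simps scaleR_2)
        then have "z = y" by (simp add: c_def midpoint_def scaleR_add_right)
        then show False using that by simp
      qed
      with le have "z \<notin> Z" using y(2)[of z] by (auto simp: d_def)
      moreover have "z \<in> cball x0 r" using inr[OF le] by simp
      ultimately show ?thesis using min[of z] r by (auto simp: Z_def)
    qed
    \<comment> \<open>The first bound keeps \<open>cball y \<sigma>\<close> away from
      \<open>c\<close>, where the gradient of the barrier vanishes; the second keeps it inside
      \<open>cball x0 r\<close>.\<close>
    define \<sigma> where "\<sigma> = min (\<rho>/2) ((r - dist x0 y)/2)"
    have \<sigma>: "\<sigma> > 0" "\<sigma> \<le> \<rho>/2" "\<sigma> < r - dist x0 y"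
      using \<rho> inr[of y] by (auto simp: \<sigma>_def d_def min_def)
    let ?K = "cball y \<sigma>"
    have KS: "?K \<subseteq> S"
    proof
      fix z assume "z \<in> ?K"
      then have "dist x0 z < r" using dist_triangle[of x0 z y] \<sigma> by simp
      then show "z \<in> S" using r by auto
    qed
    have Kc: "\<rho>/2 \<le> norm (z - c)" "norm (z - c) \<le> 2 * \<rho>" if "z \<in> ?K" for z
    proof -
      have *: "dist y z \<le> \<rho>/2" using that \<sigma> by simp
      show "\<rho>/2 \<le> norm (z - c)" using dist_triangle[of c y z] * cy
        by (simp add: dist_commute dist_norm norm_minus_commute)
      show "norm (z - c) \<le> 2 * \<rho>" using dist_triangle[of c z y] * cy \<rho>
        by (simp add: dist_commute dist_norm norm_minus_commute)
    qed
    obtain C where C: "C > 0" "\<forall>x\<in>?K. \<exists>e::'i \<Rightarrow> 'a. (\<forall>i. norm (e i) \<le> C) \<and>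
          (\<forall>y. (norm y)\<^sup>2 \<le> C * (\<Sum>i\<in>UNIV. (e i \<bullet> y)\<^sup>2)) \<and>
          (\<forall>G. (\<forall>w. \<bar>f' x w\<bar> \<le> G * norm w) \<longrightarrow> (\<Sum>i\<in>UNIV. f'' x (e i) (e i)) \<le> C * G)"
      using ell[OF compact_cball KS] by blast
    define N where "N = real CARD('i)"
    \<comment> \<open>Makes \<open>2 * \<alpha> * (\<rho>/2)\<^sup>2\<close> exceed
      \<open>C * (N * C\<^sup>2 + 2 * C * \<rho>)\<close> by 1/2, so the part of \<open>v''\<close>
      quadratic in \<open>\<alpha>\<close> beats the trace and gradient terms. This is the
      contradiction reached at the end.\<close>
    define \<alpha> where "\<alpha> = (2 * C * (N * C\<^sup>2 + 2 * C * \<rho>) + 1) / \<rho>\<^sup>2"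
    have \<alpha>: "\<alpha> > 0" using C \<rho> by (auto simp: \<alpha>_def N_def intro!: divide_pos_pos add_nonneg_pos)
    define E where "E z = exp (- \<alpha> * ((z - c) \<bullet> (z - c)))" for z
    \<comment> \<open>The barrier: positive inside the sphere of radius \<open>\<rho>\<close> about
      \<open>c\<close>, zero on it and in particular at \<open>y\<close>, negative outside.\<close>
    define v where "v z = E z - exp (- \<alpha> * \<rho>\<^sup>2)" for z
    have E: "E z > 0" "E z \<le> 1" for z using \<alpha> by (auto simp: E_def)
    have dE: "(E has_derivative (\<lambda>w. -2 * \<alpha> * ((z - c) \<bullet> w) * E z)) (at z)" for z
      unfolding E_def
      by (rule derivative_eq_intros refl | simp)+
         (auto simp: fun_eq_iff inner_commute algebra_simps)
    define v' where "v' z w = -2 * \<alpha> * ((z - c) \<bullet> w) * E z" for z w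
    define v'' where "v'' z e w = (4 * \<alpha>\<^sup>2 * ((z - c) \<bullet> e) * ((z - c) \<bullet> w) - 2 * \<alpha> * (e \<bullet> w)) * E z" for z e w
    have dv: "(v has_derivative v' z) (at z)" for z
      unfolding v_def v'_def using has_derivative_diff[OF dE has_derivative_const] by (simp add: fun_eq_iff)
    have dv': "((\<lambda>z. v' z e) has_derivative v'' z e) (at z)" for z e
      unfolding v'_def v''_def
      by (rule derivative_eq_intros dE refl | simp)+
         (auto simp: fun_eq_iff inner_commute algebra_simps power2_eq_square)
    \<comment> \<open>The part of the small sphere where \<open>v\<close> may be nonnegative. It is
      compact and misses \<open>y\<close>, so \<open>f\<close> exceeds \<open>m\<close> there by a
      fixed gap. As \<open>v\<close> is at most 1, half that gap as \<open>\<epsilon>\<close> keeps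
      \<open>f - \<epsilon> v\<close> above \<open>m\<close> on the whole small sphere, while its
      value at \<open>y\<close> is \<open>m\<close>; hence its minimum is interior.\<close>
    define T where "T = sphere y \<sigma> \<inter> cball c \<rho>"
    have "\<exists>\<delta>>0. \<forall>z\<in>T. f z \<ge> m + \<delta>"
    proof (cases "T = {}")
      case False
      have "compact T" by (auto simp: T_def)
      moreover have "T \<subseteq> S" using KS by (auto simp: T_def)
      ultimately obtain z0 where z0: "z0 \<in> T" "\<And>z. z \<in> T \<Longrightarrow> f z0 \<le> f z"
        using continuous_attains_inf[OF _ False contf] by blast
      have "f z0 > m" using z0(1) \<sigma> by (intro fpos) (auto simp: T_def)
      then show ?thesis using z0 by (intro exI[of _ "f z0 - m"]) auto
    qed (auto intro: zero_less_one)
    then obtain \<delta> where \<delta>: "\<delta> > 0" "\<And>z. z \<in> T \<Longrightarrow> f z \<ge> m + \<delta>" by blast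
    define \<epsilon> where "\<epsilon> = \<delta> / 2"
    have \<epsilon>: "\<epsilon> > 0" using \<delta> by (simp add: \<epsilon>_def)
    define g where "g z = f z - \<epsilon> * v z" for z
    define g' where "g' z w = f' z w - \<epsilon> * v' z w" for z w
    have dg: "(g has_derivative g' z) (at z)" if "z \<in> S" for z
      unfolding g_def g'_def using der[OF that] dv by (intro has_derivative_diff has_derivative_mult_right)
    have dg': "((\<lambda>z. g' z e) has_derivative (\<lambda>w. f'' z e w - \<epsilon> * v'' z e w)) (at z)" if "z \<in> S" for z e
      unfolding g'_def using der2[OF that] dv' by (intro has_derivative_diff has_derivative_mult_right)
    have "continuous_on ?K g"
      using dg KS by (meson continuous_at_imp_continuous_on has_derivative_continuous subset_eq)
    then obtain x1 where x1: "x1 \<in> ?K" "\<And>z. z \<in> ?K \<Longrightarrow> g x1 \<le> g z"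
      using continuous_attains_inf[of ?K g] \<sigma> by auto
    have gm: "g z > m" if z: "z \<in> sphere y \<sigma>" for z
    proof (cases "z \<in> cball c \<rho>")
      case True
      have "v z \<le> 1" using E[of z] exp_ge_zero[of "- \<alpha> * \<rho>\<^sup>2"] unfolding v_def by linarith
      then have "\<epsilon> * v z \<le> \<epsilon>" using \<epsilon> by (simp add: mult_left_le)
      moreover have "f z \<ge> m + \<delta>" using \<delta> True z by (auto simp: T_def)
      ultimately show ?thesis using \<delta>(1) unfolding g_def \<epsilon>_def by linarith
    next
      case False
      then have "\<rho> < norm (z - c)" by (simp add: dist_norm norm_minus_commute)
      then have "\<rho>\<^sup>2 < (z - c) \<bullet> (z - c)" using \<rho> by (simp add: power2_norm_eq_inner[symmetric] power_strict_mono)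
      then have "v z < 0" using \<alpha> by (simp add: v_def E_def)
      then have "\<epsilon> * v z < 0" using \<epsilon> by (simp add: mult_pos_neg)
      moreover have "m \<le> f z" using z KS by (intro min) auto
      ultimately show ?thesis by (simp add: g_def)
    qed
    have vy: "v y = 0" using cy
      by (simp add: v_def E_def power2_norm_eq_inner[symmetric] dist_norm norm_minus_commute)
    have "g y = m" using y vy by (simp add: g_def Z_def)
    then have "g x1 \<le> m" using x1(2)[of y] \<sigma> by simp
    then have "x1 \<notin> sphere y \<sigma>" using gm by force
    then have x1b: "x1 \<in> ball y \<sigma>" using x1 by auto
    then obtain s where s: "s > 0" "ball x1 s \<subseteq> ball y \<sigma>" using open_ball open_contains_ball by metis
    have x1S: "x1 \<in> S" using x1 KS by auto
    \<comment> \<open>At the interior minimum the gradient of \<open>f\<close> is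
      \<open>\<epsilon>\<close> times that of the barrier. This supplies the bound \<open>G\<close>,
      so \<open>ell\<close> becomes an inequality about the barrier alone.\<close>
    have crit: "g' x1 e = 0 \<and> 0 \<le> f'' x1 e e - \<epsilon> * v'' x1 e e" for e
    proof -
      have sS: "z \<in> S" "z \<in> ?K" if "z \<in> ball x1 s" for z
        using that s(2) KS ball_subset_cball by (meson subsetD)+
      show ?thesis
        using local_min_derivatives[OF s(1), of x1 g g' e "\<lambda>w. f'' x1 e w - \<epsilon> * v'' x1 e w"]
          dg dg'[OF x1S, of e] sS x1(2) by blast
    qed
    obtain e :: "'i \<Rightarrow> 'a" where e: "\<And>i. norm (e i) \<le> C"
      "\<And>y. (norm y)\<^sup>2 \<le> C * (\<Sum>i\<in>UNIV. (e i \<bullet> y)\<^sup>2)"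
      "\<And>G. (\<forall>w. \<bar>f' x1 w\<bar> \<le> G * norm w) \<Longrightarrow> (\<Sum>i\<in>UNIV. f'' x1 (e i) (e i)) \<le> C * G"
      using C(2) x1(1) by blast
    define n where "n = norm (x1 - c)"
    have n: "\<rho>/2 \<le> n" "n \<le> 2 * \<rho>" using Kc[OF x1(1)] by (auto simp: n_def)
    have "\<bar>f' x1 w\<bar> \<le> (\<epsilon> * (2 * \<alpha> * n * E x1)) * norm w" for w
    proof -
      have "f' x1 w = \<epsilon> * v' x1 w" using crit[of w] by (simp add: g'_def)
      then have "\<bar>f' x1 w\<bar> = \<epsilon> * (2 * \<alpha> * E x1) * \<bar>(x1 - c) \<bullet> w\<bar>"
        using \<epsilon> \<alpha> E[of x1] by (simp add: v'_def abs_mult)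
      also have "\<dots> \<le> \<epsilon> * (2 * \<alpha> * E x1) * (n * norm w)"
        unfolding n_def using \<epsilon> \<alpha> E[of x1] by (intro mult_left_mono Cauchy_Schwarz_ineq2) (auto intro: less_imp_le)
      finally show ?thesis by (simp add: mult_ac)
    qed
    then have up: "(\<Sum>i\<in>UNIV. f'' x1 (e i) (e i)) \<le> C * (\<epsilon> * (2 * \<alpha> * n * E x1))"
      using e(3) by blast
    have "\<epsilon> * v'' x1 u u \<le> f'' x1 u u" for u using crit[of u] by linarith
    then have "\<epsilon> * (\<Sum>i\<in>UNIV. v'' x1 (e i) (e i)) \<le> (\<Sum>i\<in>UNIV. f'' x1 (e i) (e i))"
      unfolding sum_distrib_left by (intro sum_mono)
    with up have "\<epsilon> * (\<Sum>i\<in>UNIV. v'' x1 (e i) (e i)) \<le> \<epsilon> * (C * (2 * \<alpha> * n * E x1))"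
      by (simp add: mult_ac)
    then have "(\<Sum>i\<in>UNIV. v'' x1 (e i) (e i)) \<le> C * (2 * \<alpha> * n * E x1)" using \<epsilon> by simp
    moreover have "(\<Sum>i\<in>UNIV. v'' x1 (e i) (e i))
      = (4 * \<alpha>\<^sup>2 * (\<Sum>i\<in>UNIV. (e i \<bullet> (x1 - c))\<^sup>2) - 2 * \<alpha> * (\<Sum>i\<in>UNIV. (norm (e i))\<^sup>2)) * E x1"
      unfolding v''_def sum_distrib_right[symmetric] sum_subtractf
      by (simp add: sum_distrib_left power2_norm_eq_inner power2_eq_square[of "_ \<bullet> _"] mult_ac inner_commute)
    ultimately have "(4 * \<alpha>\<^sup>2 * (\<Sum>i\<in>UNIV. (e i \<bullet> (x1 - c))\<^sup>2) - 2 * \<alpha> * (\<Sum>i\<in>UNIV. (norm (e i))\<^sup>2)) * E x1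
       \<le> (C * (2 * \<alpha> * n)) * E x1" by (simp add: mult_ac)
    then have "4 * \<alpha>\<^sup>2 * (\<Sum>i\<in>UNIV. (e i \<bullet> (x1 - c))\<^sup>2) - 2 * \<alpha> * (\<Sum>i\<in>UNIV. (norm (e i))\<^sup>2) \<le> C * (2 * \<alpha> * n)"
      using E[of x1] by simp
    moreover have "(\<Sum>i\<in>UNIV. (norm (e i))\<^sup>2) \<le> N * C\<^sup>2"
      using sum_bounded_above[of UNIV "\<lambda>i. (norm (e i))\<^sup>2" "C\<^sup>2"] e(1) by (simp add: N_def power_mono)
    then have "2 * \<alpha> * (\<Sum>i\<in>UNIV. (norm (e i))\<^sup>2) \<le> 2 * \<alpha> * (N * C\<^sup>2)" using \<alpha> by (intro mult_left_mono) auto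
    moreover have "C * (2 * \<alpha> * n) \<le> 2 * \<alpha> * (2 * C * \<rho>)" using n \<alpha> C by (simp add: mult_ac)
    ultimately have "2 * \<alpha> * (2 * \<alpha> * (\<Sum>i\<in>UNIV. (e i \<bullet> (x1 - c))\<^sup>2)) \<le> 2 * \<alpha> * (N * C\<^sup>2 + 2 * C * \<rho>)"
      by (simp add: power2_eq_square algebra_simps)
    then have "2 * \<alpha> * (\<Sum>i\<in>UNIV. (e i \<bullet> (x1 - c))\<^sup>2) \<le> N * C\<^sup>2 + 2 * C * \<rho>" using \<alpha> by simp
    then have "C * (2 * \<alpha> * (\<Sum>i\<in>UNIV. (e i \<bullet> (x1 - c))\<^sup>2)) \<le> C * (N * C\<^sup>2 + 2 * C * \<rho>)" using C by simp
    moreover have "2 * \<alpha> * (\<rho>/2)\<^sup>2 \<le> 2 * \<alpha> * (C * (\<Sum>i\<in>UNIV. (e i \<bullet> (x1 - c))\<^sup>2))"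
    proof -
      have "(\<rho>/2)\<^sup>2 \<le> n\<^sup>2" using n \<rho> by (intro power_mono) auto
      also have "\<dots> \<le> C * (\<Sum>i\<in>UNIV. (e i \<bullet> (x1 - c))\<^sup>2)" using e(2) by (simp add: n_def)
      finally show ?thesis using \<alpha> by simp
    qed
    ultimately have "2 * \<alpha> * (\<rho>/2)\<^sup>2 \<le> C * (N * C\<^sup>2 + 2 * C * \<rho>)" by (simp add: mult_ac)
    moreover have "2 * \<alpha> * (\<rho>/2)\<^sup>2 = (2 * C * (N * C\<^sup>2 + 2 * C * \<rho>) + 1) / 2"
      using \<rho> by (simp add: \<alpha>_def power2_eq_square)
    ultimately show False by simp
  qed
  then show ?thesis using r by (intro exI[of _ "r/2"]) (auto simp: subset_eq)
qed


section \<open>Local homeomorphisms onto simply connected spaces\<close>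

text \<open>One Urysohn function for each pair of basic open sets \<open>U\<close>, \<open>V\<close>
  that admits one, zero on \<open>U\<close> and one off \<open>V\<close>; there are only countably
  many pairs.\<close>

lemma countable_separating_family:
  assumes "compact_space M" "Hausdorff_space M" "second_countable M"
  obtains f :: "nat \<Rightarrow> 'p \<Rightarrow> real" where
    "\<And>n. continuous_map M euclideanreal (f n)" "\<And>n x. \<bar>f n x\<bar> \<le> 1"
    "\<And>x y. x \<in> topspace M \<Longrightarrow> y \<in> topspace M \<Longrightarrow> x \<noteq> y \<Longrightarrow> \<exists>n. f n x \<noteq> f n y"
proof -
  obtain \<B> where \<B>: "countable \<B>" "\<And>V. V \<in> \<B> \<Longrightarrow> openin M V"
    "\<And>U x. openin M U \<Longrightarrow> x \<in> U \<Longrightarrow> \<exists>V\<in>\<B>. x \<in> V \<and> V \<subseteq> U"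
    using assms(3) unfolding second_countable_def by metis
  have normal: "normal_space M" using assms compact_Hausdorff_or_regular_imp_normal_space by blast
  \<comment> \<open>The extra pair keeps the enumerated set nonempty in every case.\<close>
  define P where "P = insert ({},{}) (\<B> \<times> \<B>)"
  define good where "good c F \<longleftrightarrow> continuous_map M euclideanreal F \<and> (\<forall>x. \<bar>F x\<bar> \<le> 1) \<and>
      (\<forall>x\<in>fst c. F x = 0) \<and> (\<forall>x\<in>topspace M - snd c. F x = (1::real))" for c F
  \<comment> \<open>The zero function is the default for pairs without such a function, so that
    every member is continuous and bounded.\<close>
  define G where "G c = (if \<exists>F. good c F then SOME F. good c F else (\<lambda>_. 0))" for c
  have G: "good c (G c)" if "good c F" for c F
  proof -
    have "good c (SOME F. good c F)" using that by (rule someI[where P = "good c"])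
    with that show ?thesis unfolding G_def by auto
  qed
  have G': "continuous_map M euclideanreal (G c)" "\<bar>G c x\<bar> \<le> 1" for c x
  proof -
    have "continuous_map M euclideanreal (G c) \<and> (\<forall>x. \<bar>G c x\<bar> \<le> 1)"
    proof (cases "\<exists>F. good c F")
      case True
      then have "good c (G c)" using G by blast
      then show ?thesis by (simp add: good_def)
    qed (simp add: G_def)
    then show "continuous_map M euclideanreal (G c)" "\<bar>G c x\<bar> \<le> 1" by auto
  qed
  define f where "f n = G (from_nat_into P n)" for n
  have P: "countable P" "P \<noteq> {}" using \<B>(1) by (auto simp: P_def)
  show ?thesis
  proof
    show "continuous_map M euclideanreal (f n)" "\<bar>f n x\<bar> \<le> 1" for n x using G' by (simp_all add: f_def)
    fix x y assume xy: "x \<in> topspace M" "y \<in> topspace M" "x \<noteq> y"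
    obtain V0 where "openin M V0" "x \<in> V0" "y \<notin> V0"
      using assms(2) xy unfolding Hausdorff_space_def by (metis disjnt_iff)
    then obtain V where V: "V \<in> \<B>" "x \<in> V" "y \<notin> V" using \<B>(3) by blast
    have "closedin M {x}" using assms(2) xy by (simp add: closedin_Hausdorff_singleton)
    moreover have "closedin M (topspace M - V)" using \<B>(2)[OF V(1)] by blast
    moreover have "disjnt {x} (topspace M - V)" using V by auto
    ultimately obtain h where h: "continuous_map M (top_of_set {0..1::real}) h" "h ` {x} \<subseteq> {0}" "h ` (topspace M - V) \<subseteq> {1}"
      using Urysohn_lemma[OF normal, of "{x}" "topspace M - V" 0 1] by auto
    have hc: "continuous_map M euclideanreal h" using h(1) by (simp add: continuous_map_in_subtopology)
    have "openin M {z \<in> topspace M. h z \<in> {..<1/2}}"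
      using hc by (rule openin_continuous_map_preimage) (simp flip: open_openin)
    then obtain U where U: "U \<in> \<B>" "x \<in> U" "U \<subseteq> {z \<in> topspace M. h z \<in> {..<1/2}}"
      using \<B>(3) xy h(2) by (metis (no_types, lifting) atLeastLessThan_iff divide_pos_pos image_insert insert_subset lessThan_iff mem_Collect_eq singletonD zero_less_numeral zero_less_one)
    \<comment> \<open>Rescaling turns \<open>h < 1/2\<close> on \<open>U\<close> into the value zero
      on all of \<open>U\<close>; truncation gives the bound at points outside the space
      too.\<close>
    have "good (U, V) (\<lambda>z. min 1 (max 0 (2 * h z - 1)))"
      unfolding good_def
    proof (intro conjI ballI allI)
      show "continuous_map M euclideanreal (\<lambda>z. min 1 (max 0 (2 * h z - 1)))"
        using hc by (intro continuous_intros)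
    qed (use U h in auto)
    from G[OF this] have "good (U, V) (G (U, V))" .
    then have "G (U, V) x = 0" "G (U, V) y = 1" using U V xy by (auto simp: good_def)
    moreover have "(U, V) \<in> P" using U V by (auto simp: P_def)
    then obtain n where "from_nat_into P n = (U, V)" using P by (metis from_nat_into_surj)
    ultimately show "\<exists>n. f n x \<noteq> f n y" by (intro exI[of _ n]) (simp add: f_def)
  qed
qed

text \<open>Moves the abstract space into a normed space, where \<open>covering_space\<close> and
  its lifting theorems apply.\<close>

lemma compact_Hausdorff_embedding:
  assumes "compact_space M" "Hausdorff_space M" "second_countable M"
  obtains G :: "'p \<Rightarrow> (nat \<Rightarrow>\<^sub>C real)" where
    "continuous_map M euclidean G" "inj_on G (topspace M)"
proof -
  obtain f :: "nat \<Rightarrow> 'p \<Rightarrow> real" where f: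
    "\<And>n. continuous_map M euclideanreal (f n)" "\<And>n x. \<bar>f n x\<bar> \<le> 1"
    "\<And>x y. x \<in> topspace M \<Longrightarrow> y \<in> topspace M \<Longrightarrow> x \<noteq> y \<Longrightarrow> \<exists>n. f n x \<noteq> f n y"
    using countable_separating_family[OF assms] by blast
  \<comment> \<open>The weights make the tails uniformly small, so continuity in the supremum norm
    depends on finitely many \<open>f n\<close> at a time.\<close>
  define G where "G x = Bcontfun (\<lambda>n. f n x * (1/2)^n)" for x
  have le: "\<bar>f n x * (1/2)^n\<bar> \<le> (1/2)^n" for n x
    using f(2)[of n x] by (simp add: abs_mult mult_left_le_one_le)
  have G: "apply_bcontfun (G x) n = f n x * (1/2)^n" for x n
  proof -
    have "\<bar>f n x * (1/2)^n\<bar> \<le> 1" for n using le[of n x] power_le_one[of "1/2::real" n] by linarith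
    then have "(\<lambda>n. f n x * (1/2)^n) \<in> bcontfun"
      unfolding bcontfun_def by (auto intro!: boundedI[of _ 1] simp: continuous_on_discrete)
    then show ?thesis unfolding G_def by (simp add: Bcontfun_inverse)
  qed
  have "inj_on G (topspace M)"
  proof (rule inj_onI, rule ccontr)
    fix x y assume "x \<in> topspace M" "y \<in> topspace M" "G x = G y" "x \<noteq> y"
    moreover from this f(3) obtain n where "f n x \<noteq> f n y" by blast
    ultimately show False using G[of x n] G[of y n] by simp
  qed
  moreover have "continuous_map M euclidean G"
    unfolding continuous_map_eq_topcontinuous_at topcontinuous_at_def
  proof (intro ballI conjI allI impI)
    fix x V assume x: "x \<in> topspace M" and "openin euclidean V \<and> G x \<in> V"
    then obtain e where e: "e > 0" "ball (G x) e \<subseteq> V" using open_contains_ball by (metis open_openin)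
    obtain N where N: "(1/2::real)^N < e/4" using e real_arch_pow_inv[of "e/4" "1/2"] by auto
    define U where "U = (\<Inter>n\<in>{..N}. {y \<in> topspace M. f n y \<in> ball (f n x) (e/2)})"
    have "openin M U" unfolding U_def
      by (intro openin_INT2 openin_continuous_map_preimage[OF f(1)]) (auto simp flip: open_openin)
    moreover have "x \<in> U" using x e by (auto simp: U_def)
    moreover have "G y \<in> V" if "y \<in> U" for y
    proof -
      have "dist (G x n) (G y n) \<le> e/2" for n
      proof (cases "n \<le> N")
        case True
        have "\<bar>f n x - f n y\<bar> * (1/2)^n \<le> \<bar>f n x - f n y\<bar>"
          by (intro mult_right_le_one_le) (auto intro: power_le_one)
        moreover have "\<bar>f n x - f n y\<bar> < e/2" using that True by (auto simp: U_def dist_real_def)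
        ultimately show ?thesis
          by (simp add: G dist_real_def abs_mult flip: left_diff_distrib)
      next
        case False
        then have "(1/2::real)^n \<le> (1/2)^N" by (intro power_decreasing) auto
        then show ?thesis using le[of n x] le[of n y] N unfolding G dist_real_def by linarith
      qed
      then have "dist (G x) (G y) \<le> e/2" by (rule dist_bound)
      then show ?thesis using e by (auto simp: subset_eq)
    qed
    ultimately show "\<exists>U. openin M U \<and> x \<in> U \<and> (\<forall>y\<in>U. G y \<in> V)" by blast
  qed auto
  ultimately show ?thesis using that by blast
qed

text \<open>The sheets over y are small neighbourhoods of the finitely many points above y, cut down so
  that nothing outside them lies over the base neighbourhood; this is where compactness enters.\<close>
lemma compact_local_homeo_imp_covering:
  fixes p :: "'a::metric_space \<Rightarrow> 'b::t2_space"
  assumes "compact C" and contp: "continuous_on C p" and im: "p ` C = S"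
    and loc: "\<And>x. x \<in> C \<Longrightarrow> \<exists>U. openin (top_of_set C) U \<and> x \<in> U \<and> inj_on p U \<and>
        (\<forall>V. openin (top_of_set C) V \<and> V \<subseteq> U \<longrightarrow> openin (top_of_set S) (p ` V))"
  shows "covering_space C p S"
proof (rule covering_spaceI[OF contp im])
  fix y assume y: "y \<in> S"
  obtain U where U: "\<And>x. x \<in> C \<Longrightarrow> openin (top_of_set C) (U x)" "\<And>x. x \<in> C \<Longrightarrow> x \<in> U x"
    "\<And>x. x \<in> C \<Longrightarrow> inj_on p (U x)"
    "\<And>x V. x \<in> C \<Longrightarrow> openin (top_of_set C) V \<Longrightarrow> V \<subseteq> U x \<Longrightarrow> openin (top_of_set S) (p ` V)"
    using loc by metis
  define F where "F = {x \<in> C. p x = y}"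
  have "closedin (top_of_set C) (C \<inter> p -` {y})"
    using contp by (intro continuous_closedin_preimage) auto
  moreover have "C \<inter> p -` {y} = F" by (auto simp: F_def)
  ultimately have "compact F" using assms(1) closedin_compact by metis
  \<comment> \<open>The fibre is compact and discrete: by injectivity \<open>U z\<close> contains no
    point of it other than \<open>z\<close>.\<close>
  have "finite F"
  proof -
    obtain O' where O': "\<And>x. x \<in> C \<Longrightarrow> open (O' x) \<and> U x = C \<inter> O' x"
      using U(1) unfolding openin_open by metis
    have "F \<subseteq> (\<Union>x\<in>F. O' x)"
    proof
      fix x assume "x \<in> F"
      moreover then have "x \<in> O' x" using O'[of x] U(2)[of x] by (auto simp: F_def)
      ultimately show "x \<in> (\<Union>x\<in>F. O' x)" by blast
    qed
    then obtain D where D: "D \<subseteq> F" "finite D" "F \<subseteq> (\<Union>x\<in>D. O' x)"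
      using compactE_image[OF \<open>compact F\<close>, of F O'] O' by (metis (no_types, lifting) F_def mem_Collect_eq)
    have "F \<subseteq> D"
    proof
      fix x assume x: "x \<in> F"
      then obtain z where z: "z \<in> D" "x \<in> O' z" using D by blast
      then have "x \<in> U z" "z \<in> U z" using x D O'[of z] U(2)[of z] by (auto simp: F_def)
      moreover have "z \<in> C" "p x = p z" using x z D by (auto simp: F_def)
      ultimately have "x = z" using U(3) by (meson inj_onD)
      then show "x \<in> D" using z by simp
    qed
    then show ?thesis using D finite_subset by blast
  qed
  have "\<exists>\<delta>>0. \<forall>x\<in>F. \<forall>z\<in>F. x \<noteq> z \<longrightarrow> \<delta> \<le> dist x z"
  proof -
    have "\<exists>\<delta>>0. \<forall>z\<in>F. x \<noteq> z \<longrightarrow> \<delta> \<le> dist x z" for x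
      using finite_set_avoid[OF \<open>finite F\<close>, of x] by metis
    then obtain d where d: "\<And>x. d x > 0" "\<And>x z. z \<in> F \<Longrightarrow> x \<noteq> z \<Longrightarrow> d x \<le> dist x z" by metis
    have "Min (insert 1 (d ` F)) > 0" using d \<open>finite F\<close> by simp
    moreover have "Min (insert 1 (d ` F)) \<le> dist x z" if "x \<in> F" "z \<in> F" "x \<noteq> z" for x z
    proof -
      have "Min (insert 1 (d ` F)) \<le> d x" using that \<open>finite F\<close> by (intro Min_le) auto
      then show ?thesis using d(2)[of z x] that by simp
    qed
    ultimately show ?thesis by blast
  qed
  then obtain \<delta> where \<delta>: "\<delta> > 0" "\<And>x z. x \<in> F \<Longrightarrow> z \<in> F \<Longrightarrow> x \<noteq> z \<Longrightarrow> \<delta> \<le> dist x z" by blast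
  define W where "W x = U x \<inter> ball x (\<delta>/2)" for x
  have FC: "F \<subseteq> C" by (auto simp: F_def)
  have W: "openin (top_of_set C) (W x)" "x \<in> W x" "inj_on p (W x)" "W x \<subseteq> U x" if "x \<in> F" for x
  proof -
    have xC: "x \<in> C" using that FC by blast
    show "openin (top_of_set C) (W x)" unfolding W_def
      using U(1)[OF xC] open_ball by (metis inf_commute openin_Int_open)
    show "x \<in> W x" using U(2)[OF xC] \<delta> by (simp add: W_def)
    show "W x \<subseteq> U x" by (simp add: W_def)
    then show "inj_on p (W x)" using U(3)[OF xC] inj_on_subset by blast
  qed
  have WC: "W x \<subseteq> C" if "x \<in> F" for x using W(1)[OF that] openin_imp_subset by blast
  have disj: "W x \<inter> W z = {}" if "x \<in> F" "z \<in> F" "x \<noteq> z" for x z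
  proof -
    have False if "u \<in> W x" "u \<in> W z" for u
      using that \<delta>(2)[OF \<open>x \<in> F\<close> \<open>z \<in> F\<close> \<open>x \<noteq> z\<close>] dist_triangle[of x z u] by (simp add: W_def dist_commute)
    then show ?thesis by blast
  qed
  define R where "R = C - (\<Union>x\<in>F. W x)"
  have "closedin (top_of_set C) R" unfolding R_def using W(1) by (intro closedin_diff) auto
  then have "compact R" using assms(1) closedin_compact by blast
  have "R \<subseteq> C" by (auto simp: R_def)
  then have "compact (p ` R)" using \<open>compact R\<close> contp compact_continuous_image continuous_on_subset by blast
  then have "closed (p ` R)" by (rule compact_imp_closed)
  have "F \<noteq> {}" using y im by (auto simp: F_def)
  define T where "T = (\<Inter>x\<in>F. p ` W x) \<inter> (S - p ` R)"
  have "openin (top_of_set S) (S - p ` R)"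
    unfolding Diff_eq using \<open>closed (p ` R)\<close> by (intro openin_open_Int open_Compl)
  moreover have "openin (top_of_set S) (\<Inter>x\<in>F. p ` W x)"
  proof (intro openin_INT2 \<open>finite F\<close> \<open>F \<noteq> {}\<close>)
    fix x assume x: "x \<in> F"
    show "openin (top_of_set S) (p ` W x)"
      by (rule U(4)[OF _ W(1)[OF x] W(4)[OF x]]) (use x FC in blast)
  qed
  ultimately have oT: "openin (top_of_set S) T" unfolding T_def by (rule openin_Int[rotated])
  have yT: "y \<in> T"
  proof -
    have "y \<in> p ` W x" if "x \<in> F" for x using W(2)[OF that] that by (auto simp: F_def)
    moreover have "y \<notin> p ` R" using W(2) by (auto simp: R_def F_def)
    ultimately show ?thesis using y by (simp add: T_def)
  qed
  have oW: "openin (top_of_set C) (W x \<inter> p -` T)" if "x \<in> F" for x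
  proof -
    have "openin (top_of_set C) (C \<inter> p -` T)"
      using contp im oT by (intro continuous_openin_preimage) auto
    then have "openin (top_of_set C) (W x \<inter> (C \<inter> p -` T))" using W(1)[OF that] by (rule openin_Int[rotated])
    moreover have "W x \<inter> (C \<inter> p -` T) = W x \<inter> p -` T" using WC[OF that] by blast
    ultimately show ?thesis by simp
  qed
  have hom: "\<exists>q. homeomorphism (W x \<inter> p -` T) T p q" if x: "x \<in> F" for x
  proof -
    have *: "openin (top_of_set T) (p ` V)" if "openin (top_of_set (W x \<inter> p -` T)) V" for V
    proof -
      have "openin (top_of_set C) V" "V \<subseteq> W x \<inter> p -` T"
        using openin_trans[OF that oW[OF x]] openin_imp_subset[OF that] by auto
      moreover from this have "V \<subseteq> U x" using W(4)[OF x] by blast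
      moreover have "x \<in> C" using x FC by blast
      ultimately have "openin (top_of_set S) (p ` V)" using U(4) by simp
      moreover have "p ` V \<subseteq> T" using \<open>V \<subseteq> W x \<inter> p -` T\<close> by blast
      moreover have "T \<subseteq> S" by (auto simp: T_def)
      ultimately show ?thesis by (meson openin_subset_trans)
    qed
    have "T \<subseteq> p ` W x" using x by (auto simp: T_def)
    then have "p ` (W x \<inter> p -` T) = T" by blast
    moreover have "continuous_on (W x \<inter> p -` T) p" using contp WC[OF x] by (meson continuous_on_subset inf.coboundedI1)
    moreover have "inj_on p (W x \<inter> p -` T)" using W(3)[OF x] by (meson inf_le1 inj_on_subset)
    ultimately show ?thesis by (metis homeomorphism_injective_open_map[OF _ _ _ *])
  qed
  show "\<exists>T. y \<in> T \<and> openin (top_of_set S) T \<and>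
      (\<exists>v. \<Union>v = C \<inter> p -` T \<and> (\<forall>u\<in>v. openin (top_of_set C) u) \<and> pairwise disjnt v \<and>
           (\<forall>u\<in>v. \<exists>q. homeomorphism u T p q))"
  proof (intro exI[of _ T] conjI yT oT exI[of _ "(\<lambda>x. W x \<inter> p -` T) ` F"])
    show "\<Union>((\<lambda>x. W x \<inter> p -` T) ` F) = C \<inter> p -` T"
      using WC by (auto simp: T_def R_def)
    show "pairwise disjnt ((\<lambda>x. W x \<inter> p -` T) ` F)"
      using disj by (auto simp: pairwise_def disjnt_def)
  qed (use oW hom in auto)
qed

text \<open>The image is open and closed, hence all of \<open>S\<close>, and \<open>p\<close> is a
  covering. Lifting the identity of \<open>S\<close> gives a section \<open>g\<close> with
  \<open>g (p a) = a\<close>. Both \<open>g\<close> after \<open>p\<close> and the identity of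
  \<open>C\<close> lift \<open>p\<close> and agree at \<open>a\<close>, so they are equal and
  \<open>p\<close> is injective.\<close>

lemma compact_local_homeo_simply_connected:
  fixes p :: "'a::real_normed_vector \<Rightarrow> 'b::real_normed_vector"
  assumes "compact C" "connected C" "C \<noteq> {}" "continuous_on C p" "p ` C \<subseteq> S"
    and S: "simply_connected S" "locally path_connected S"
    and loc: "\<And>x. x \<in> C \<Longrightarrow> \<exists>U. openin (top_of_set C) U \<and> x \<in> U \<and> inj_on p U \<and>
        (\<forall>V. openin (top_of_set C) V \<and> V \<subseteq> U \<longrightarrow> openin (top_of_set S) (p ` V))"
  shows "bij_betw p C S"
proof -
  have "openin (top_of_set S) (p ` C)"
  proof -
    have "\<exists>T. openin (top_of_set S) T \<and> y \<in> T \<and> T \<subseteq> p ` C" if "y \<in> p ` C" for y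
    proof -
      from that obtain x where x: "x \<in> C" "y = p x" by auto
      obtain U where U: "openin (top_of_set C) U" "x \<in> U" "openin (top_of_set S) (p ` U)"
        using loc[OF x(1)] by blast
      then show ?thesis using x openin_imp_subset[OF U(1)] by (intro exI[of _ "p ` U"]) auto
    qed
    then show ?thesis by (subst openin_subopen) blast
  qed
  moreover have "closedin (top_of_set S) (p ` C)"
    using assms(1,4,5) compact_continuous_image compact_imp_closed by (metis closed_subset)
  moreover have "connected S" using S(1) by (rule simply_connected_imp_connected)
  ultimately have im: "p ` C = S" using assms(3) by (metis connected_clopen image_is_empty)
  have cov: "covering_space C p S" using assms(1,4) im loc by (rule compact_local_homeo_imp_covering)
  have "inj_on p C"
  proof (rule inj_onI)
    fix a b assume ab: "a \<in> C" "b \<in> C" "p a = p b"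
    have pa: "p a \<in> S" using ab im by blast
    have "\<exists>g. continuous_on S g \<and> g \<in> S \<rightarrow> C \<and> g (p a) = a \<and> (\<forall>y\<in>S. p (g y) = y)"
    proof (rule covering_space_lift_strong[OF cov ab(1) pa S continuous_on_id])
      show "(\<lambda>x. x) \<in> S \<rightarrow> S" by simp
    qed auto
    then obtain g where g: "continuous_on S g" "g \<in> S \<rightarrow> C" "g (p a) = a" "\<And>y. y \<in> S \<Longrightarrow> p (g y) = y"
      by auto
    have pS: "p \<in> C \<rightarrow> S" using im by blast
    have "g (p b) = b"
    proof (rule covering_space_lift_unique[OF cov, where f = p and ?g1.0 = "\<lambda>x. g (p x)" and a = a and ?g2.0 = "\<lambda>x. x" and T = C])
      show "continuous_on C (\<lambda>x. g (p x))"
        using continuous_on_compose2[OF g(1) assms(4)] im by simp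
      show "(\<lambda>x. g (p x)) \<in> C \<rightarrow> C" using g(2) pS by blast
      show "p x = p (g (p x))" if "x \<in> C" for x using g(4) pS that by (simp add: Pi_iff)
    qed (use g(3) assms(2,4) pS ab in \<open>auto simp: continuous_on_id\<close>)
    then show "a = b" using g(3) ab(3) by simp
  qed
  then show ?thesis using im by (simp add: bij_betw_def)
qed

text \<open>The embedding is a homeomorphism onto its image, being a continuous injection of a
  compact space into a Hausdorff one; everything is transported along it.\<close>

lemma local_homeo_simply_connected_bij:
  fixes f :: "'p \<Rightarrow> 'b::real_normed_vector"
  assumes "compact_space M" "Hausdorff_space M" "second_countable M" "connected_space M" "topspace M \<noteq> {}"
    and f: "continuous_map M euclidean f" "f ` topspace M \<subseteq> S"
    and S: "simply_connected S" "locally path_connected S"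
    and loc: "\<And>x. x \<in> topspace M \<Longrightarrow> \<exists>U. openin M U \<and> x \<in> U \<and> inj_on f U \<and>
        (\<forall>V. openin M V \<and> V \<subseteq> U \<longrightarrow> openin (top_of_set S) (f ` V))"
  shows "bij_betw f (topspace M) S"
proof -
  obtain G :: "'p \<Rightarrow> (nat \<Rightarrow>\<^sub>C real)" where G: "continuous_map M euclidean G" "inj_on G (topspace M)"
    using compact_Hausdorff_embedding[OF assms(1-3)] by blast
  define C where "C = G ` topspace M"
  have hom: "homeomorphic_map M (top_of_set C) G"
    using G assms(1) by (intro continuous_imp_homeomorphic_map)
      (auto simp: C_def continuous_map_in_subtopology Hausdorff_space_subtopology)
  obtain H where H: "homeomorphic_maps M (top_of_set C) G H"
    using hom homeomorphic_map_maps by blast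
  then have HG: "H (G x) = x" if "x \<in> topspace M" for x
    using that by (simp add: homeomorphic_maps_def)
  from H have contH: "continuous_map (top_of_set C) M H" by (simp add: homeomorphic_maps_def)
  define p where "p = f \<circ> H"
  have pG: "p (G x) = f x" if "x \<in> topspace M" for x using HG that by (simp add: p_def)
  have pim: "p ` G ` V = f ` V" if "V \<subseteq> topspace M" for V
    using pG that by (force simp: image_image)
  have "continuous_map (top_of_set C) euclidean p"
    unfolding p_def using contH f(1) by (rule continuous_map_compose)
  then have cp: "continuous_on C p" by simp
  have "compact C" unfolding C_def using image_compactin[of M "topspace M" euclidean G] G(1) assms(1)
    by (simp add: compact_space_def)
  moreover have "connected C" unfolding C_def
    using connectedin_continuous_map_image[OF G(1), of "topspace M"] assms(4)
    by (simp add: connectedin_topspace)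
  moreover have "C \<noteq> {}" using assms(5) by (simp add: C_def)
  moreover have "p ` C \<subseteq> S" using f(2) pim[of "topspace M"] by (simp add: C_def)
  moreover have "\<exists>U. openin (top_of_set C) U \<and> x \<in> U \<and> inj_on p U \<and>
        (\<forall>V. openin (top_of_set C) V \<and> V \<subseteq> U \<longrightarrow> openin (top_of_set S) (p ` V))" if x: "x \<in> C" for x
  proof -
    obtain z where z: "z \<in> topspace M" "x = G z" using x by (auto simp: C_def)
    obtain U where U: "openin M U" "z \<in> U" "inj_on f U"
        "\<And>V. openin M V \<Longrightarrow> V \<subseteq> U \<Longrightarrow> openin (top_of_set S) (f ` V)"
      using loc[OF z(1)] by blast
    have UM: "U \<subseteq> topspace M" using U(1) by (rule openin_subset)
    show ?thesis
    proof (intro exI[of _ "G ` U"] conjI allI impI)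
      show "openin (top_of_set C) (G ` U)" using homeomorphic_map_openness_eq[OF hom] U(1) by blast
      show "x \<in> G ` U" using z U by blast
      show "inj_on p (G ` U)" using U(3) UM pG by (auto simp: inj_on_def subset_eq)
      fix V assume V: "openin (top_of_set C) V \<and> V \<subseteq> G ` U"
      then obtain W where W: "W \<subseteq> U" "V = G ` W" by (metis subset_imageE)
      then have "openin M W" using homeomorphic_map_openness[OF hom, of W] V UM by auto
      then show "openin (top_of_set S) (p ` V)" using U(4) W pim[of W] UM by auto
    qed
  qed
  ultimately have "bij_betw p C S" using compact_local_homeo_simply_connected[OF _ _ _ cp _ S] by blast
  moreover have "bij_betw G (topspace M) C" using G by (simp add: C_def bij_betw_def)
  ultimately have "bij_betw (p \<circ> G) (topspace M) S" by (rule bij_betw_trans[rotated])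
  then show ?thesis using pG by (simp cong: bij_betw_cong)
qed


section \<open>Hypersurfaces in local coordinates\<close>

abbreviation D1 :: "('a::real_normed_vector \<Rightarrow> 'b::real_normed_vector) \<Rightarrow> 'a \<Rightarrow> 'a \<Rightarrow> 'b" where
  "D1 f x \<equiv> frechet_derivative f (at x)"

definition D2 :: "('a::real_normed_vector \<Rightarrow> 'b::real_normed_vector) \<Rightarrow> 'a \<Rightarrow> 'a \<Rightarrow> 'a \<Rightarrow> 'b" where
  "D2 f x v = D1 (\<lambda>y. D1 f y v) x"

lemma smooth_on_D1:
  assumes "smooth_on S f" "x \<in> S"
  shows "(f has_derivative D1 f x) (at x)"
proof -
  have "Ck_on (Suc 0) S f" using assms by (simp only: smooth_on_def)
  then show ?thesis using assms(2) frechet_derivative_works by auto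
qed

lemma smooth_on_D2:
  assumes "smooth_on S f" "x \<in> S"
  shows "((\<lambda>y. D1 f y v) has_derivative D2 f x v) (at x)"
proof -
  have "Ck_on (Suc (Suc 0)) S f" using assms by (simp only: smooth_on_def)
  then have "(\<lambda>y. D1 f y v) differentiable at x" using assms(2) by simp
  then show ?thesis unfolding D2_def by (rule frechet_derivative_works[THEN iffD1])
qed

lemma smooth_on_continuous_D1: "smooth_on S f \<Longrightarrow> continuous_on S (\<lambda>x. D1 f x v)"
proof -
  assume "smooth_on S f"
  then have "Ck_on (Suc 0) S f" by (simp only: smooth_on_def)
  then show ?thesis by simp
qed

lemma smooth_on_continuous_D2: "smooth_on S f \<Longrightarrow> continuous_on S (\<lambda>x. D2 f x v w)"
proof -
  assume "smooth_on S f"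
  then have "Ck_on (Suc (Suc 0)) S f" by (simp only: smooth_on_def)
  then show ?thesis by (simp add: D2_def)
qed

lemma smooth_on_continuous: "smooth_on S f \<Longrightarrow> continuous_on S f"
  using smooth_on_D1 by (meson continuous_at_imp_continuous_on has_derivative_continuous)

lemma D2_sym:
  assumes "open S" "smooth_on S f" "x \<in> S"
  shows "D2 f x v w = D2 f x w v"
  by (rule mixed_derivatives_commute[OF assms(1,3), of f "D1 f"])
    (use assms in \<open>auto intro: smooth_on_D1 smooth_on_D2 smooth_on_continuous_D2\<close>)

lemma linear_sum_axis:
  fixes L :: "real ^ 'm::finite \<Rightarrow> 'b::real_vector"
  assumes "linear L"
  shows "L v = (\<Sum>i\<in>UNIV. v $ i *\<^sub>R L (axis i 1))"
proof -
  have "L v = L (\<Sum>i\<in>UNIV. v $ i *s axis i 1)" by (simp add: basis_expansion)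
  then show ?thesis using assms by (simp add: linear_sum linear_scale scalar_mult_eq_scaleR)
qed

text \<open>The hypersurface seen in one chart: \<open>F\<close> and \<open>N\<close> will be
  \<open>X\<close> and \<open>\<nu>\<close> after the inverse of the chart.\<close>

locale param_hypersurface =
  fixes \<Omega> :: "(real ^ 'm::finite) set" and F N :: "real ^ 'm \<Rightarrow> real ^ 'n::finite"
  assumes open_dom: "open \<Omega>" and smooth_F: "smooth_on \<Omega> F" and smooth_N: "smooth_on \<Omega> N"
    and dims: "CARD('n) = CARD('m) + 1"
    and inj_D1: "x \<in> \<Omega> \<Longrightarrow> inj (D1 F x)"
    and norm_N: "x \<in> \<Omega> \<Longrightarrow> norm (N x) = 1"
    and N_orth: "x \<in> \<Omega> \<Longrightarrow> N x \<bullet> D1 F x v = 0"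
begin

text \<open>\<open>is_principal_curvatures\<close> with the chart fixed.\<close>

definition frame :: "real ^ 'm \<Rightarrow> ('m \<Rightarrow> real ^ 'm) \<Rightarrow> ('m \<Rightarrow> real) \<Rightarrow> bool" where
  "frame x e \<kappa> \<longleftrightarrow> (\<forall>i j. D1 F x (e i) \<bullet> D1 F x (e j) = (if i = j then 1 else 0)) \<and>
     (\<forall>i. D1 N x (e i) = \<kappa> i *\<^sub>R D1 F x (e i))"

lemma linear_D1F: "x \<in> \<Omega> \<Longrightarrow> linear (D1 F x)"
  using smooth_on_D1[OF smooth_F] has_derivative_linear by blast

lemma linear_D1N: "x \<in> \<Omega> \<Longrightarrow> linear (D1 N x)"
  using smooth_on_D1[OF smooth_N] has_derivative_linear by blast

lemma linear_D2F: "x \<in> \<Omega> \<Longrightarrow> linear (D2 F x v)"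
  using smooth_on_D2[OF smooth_F] has_derivative_linear by blast

text \<open>The derivative along \<open>w\<close> of the identity that \<open>N\<close> is
  orthogonal to \<open>D1 F y v\<close>.\<close>

lemma second_fundamental_form:
  assumes x: "x \<in> \<Omega>"
  shows "N x \<bullet> D2 F x v w = - (D1 N x w \<bullet> D1 F x v)"
proof -
  have "((\<lambda>y. N y \<bullet> D1 F y v) has_derivative (\<lambda>w. N x \<bullet> D2 F x v w + D1 N x w \<bullet> D1 F x v)) (at x)"
    using smooth_on_D1[OF smooth_N x] smooth_on_D2[OF smooth_F x] by (rule has_derivative_inner)
  moreover have "((\<lambda>y. N y \<bullet> D1 F y v) has_derivative (\<lambda>w. 0)) (at x)"
    by (rule has_derivative_transform_within_open[OF _ open_dom x, of "\<lambda>y. 0"]) (auto simp: N_orth)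
  ultimately have "(\<lambda>w. N x \<bullet> D2 F x v w + D1 N x w \<bullet> D1 F x v) = (\<lambda>w. 0)"
    by (rule has_derivative_unique)
  from fun_cong[OF this, of w] show ?thesis by simp
qed

lemma D1N_orth:
  assumes x: "x \<in> \<Omega>"
  shows "N x \<bullet> D1 N x w = 0"
proof -
  have "((\<lambda>y. N y \<bullet> N y) has_derivative (\<lambda>w. N x \<bullet> D1 N x w + D1 N x w \<bullet> N x)) (at x)"
    using smooth_on_D1[OF smooth_N x] by (intro has_derivative_inner)
  moreover have "1 = N y \<bullet> N y" if "y \<in> \<Omega>" for y
    using norm_N[OF that] by (simp add: norm_eq_1)
  then have "((\<lambda>y. N y \<bullet> N y) has_derivative (\<lambda>w. 0)) (at x)"
    by (rule has_derivative_transform_within_open[OF has_derivative_const open_dom x])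
  ultimately have "(\<lambda>w. N x \<bullet> D1 N x w + D1 N x w \<bullet> N x) = (\<lambda>w. 0)"
    by (rule has_derivative_unique)
  from fun_cong[OF this, of w] show ?thesis by (simp add: inner_commute)
qed

text \<open>Self-adjointness of the shape operator is the symmetry of the second derivatives of
  \<open>F\<close>.\<close>

lemma shape_sym:
  assumes x: "x \<in> \<Omega>"
  shows "D1 N x w \<bullet> D1 F x v = D1 N x v \<bullet> D1 F x w"
  using second_fundamental_form[OF x, of v w] second_fundamental_form[OF x, of w v]
    D2_sym[OF open_dom smooth_F x, of v w] by simp

lemma range_D1F:
  assumes x: "x \<in> \<Omega>"
  shows "range (D1 F x) = {y. N x \<bullet> y = 0}"
proof (rule subspace_dim_equal)
  have "dim (range (D1 F x)) = CARD('m)"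
    using dim_image_eq[OF linear_D1F[OF x], of UNIV] inj_D1[OF x] by (simp add: dim_UNIV)
  moreover have "N x \<noteq> 0" using norm_N[OF x] by auto
  then have "dim {y. N x \<bullet> y = 0} = CARD('n) - 1" by (simp add: dim_hyperplane)
  ultimately show "dim {y. N x \<bullet> y = 0} \<le> dim (range (D1 F x))" using dims by simp
  show "subspace (range (D1 F x))" using linear_D1F[OF x] by (simp add: linear_subspace_image)
  show "subspace {y. N x \<bullet> y = 0}" by (rule subspace_hyperplane)
qed (use N_orth[OF x] in auto)

lemma frame_exists:
  assumes x: "x \<in> \<Omega>"
  obtains e \<kappa> where "frame x e \<kappa>"
proof -
  let ?W = "range (D1 F x)"
  obtain g where g: "linear g" "g \<circ> D1 F x = id"
    using linear_injective_left_inverse[OF linear_D1F[OF x] inj_D1[OF x]] by blast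
  have gD: "g (D1 F x v) = v" for v using g(2) by (metis comp_apply id_apply)
  \<comment> \<open>The shape operator moved from coordinates to the tangent space. The left inverse
    \<open>g\<close> is defined on the whole ambient space, but \<open>L\<close> is shown invariant
    and symmetric only on the tangent space.\<close>
  define L where "L = D1 N x \<circ> g"
  have linL: "linear L" unfolding L_def using g(1) linear_D1N[OF x] by (rule linear_compose)
  have sub: "subspace ?W" using linear_D1F[OF x] by (simp add: linear_subspace_image)
  have im: "L ` ?W \<subseteq> ?W" using D1N_orth[OF x] range_D1F[OF x] by (auto simp: L_def)
  have sym: "L y \<bullet> z = y \<bullet> L z" if "y \<in> ?W" "z \<in> ?W" for y z
    using that shape_sym[OF x] by (auto simp: L_def gD inner_commute)
  obtain B where B: "B \<subseteq> ?W" "pairwise orthogonal B" "\<And>b. b \<in> B \<Longrightarrow> norm b = 1" "card B = dim ?W"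
    "\<And>b. b \<in> B \<Longrightarrow> \<exists>\<mu>. L b = \<mu> *\<^sub>R b"
    using self_adjoint_orthonormal_eigenbasis[OF linL sub im sym] by blast
  have "dim ?W = CARD('m)"
    using dim_image_eq[OF linear_D1F[OF x], of UNIV] inj_D1[OF x] by (simp add: dim_UNIV)
  moreover have "finite B" using B(2) pairwise_orthogonal_imp_finite by blast
  ultimately obtain h where h: "bij_betw h (UNIV::'m set) B"
    using B(4) by (metis finite finite_same_card_bij)
  obtain \<mu> where \<mu>: "\<And>b. b \<in> B \<Longrightarrow> L b = \<mu> b *\<^sub>R b" using B(5) by metis
  have hB: "h i \<in> B" for i using h by (auto simp: bij_betw_def)
  have DFg: "D1 F x (g (h i)) = h i" for i using hB[of i] B(1) gD by auto
  have "frame x (\<lambda>i. g (h i)) (\<lambda>i. \<mu> (h i))"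
    unfolding frame_def DFg
  proof (intro conjI allI)
    fix i j
    show "h i \<bullet> h j = (if i = j then 1 else 0)"
    proof (cases "i = j")
      case True then show ?thesis using B(3)[OF hB[of j]] by (simp add: norm_eq_1)
    next
      case False
      then have "h i \<noteq> h j" using h by (metis bij_betw_def injD)
      then show ?thesis using B(2) hB False by (simp add: pairwise_def orthogonal_def)
    qed
  next
    fix i show "D1 N x (g (h i)) = \<mu> (h i) *\<^sub>R h i" using \<mu>[OF hB[of i]] by (simp add: L_def)
  qed
  then show ?thesis by (rule that)
qed

lemma frame_expansion:
  assumes x: "x \<in> \<Omega>" and fr: "frame x e \<kappa>"
  shows "v = (\<Sum>i\<in>UNIV. (D1 F x (e i) \<bullet> D1 F x v) *\<^sub>R e i)"
proof -
  let ?b = "\<lambda>i. D1 F x (e i)"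
  have on: "?b i \<bullet> ?b j = (if i = j then 1 else 0)" for i j using fr by (simp add: frame_def)
  have "inj ?b" by (rule injI) (metis on zero_neq_one)
  have po: "pairwise orthogonal (range ?b)" using on by (auto simp: pairwise_def orthogonal_def)
  have n1: "norm b = 1" if "b \<in> range ?b" for b using that on by (auto simp: norm_eq_1)
  have "0 \<notin> range ?b" using n1 by fastforce
  then have "independent (range ?b)" using po by (rule pairwise_orthogonal_independent[rotated])
  moreover have "card (range ?b) = CARD('m)" using \<open>inj ?b\<close> by (simp add: card_image)
  moreover have "dim (range (D1 F x)) = CARD('m)"
    using dim_image_eq[OF linear_D1F[OF x], of UNIV] inj_D1[OF x] by (simp add: dim_UNIV)
  ultimately have "range (D1 F x) \<subseteq> span (range ?b)"
    by (intro card_ge_dim_independent) auto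
  then have "D1 F x v \<in> span (range ?b)" by blast
  from orthonormal_basis_expand[OF po n1 this] have
    "(\<Sum>b\<in>range ?b. (D1 F x v \<bullet> b) *\<^sub>R b) = D1 F x v" by simp
  then have "D1 F x v = (\<Sum>i\<in>UNIV. (?b i \<bullet> D1 F x v) *\<^sub>R ?b i)"
    by (simp add: sum.reindex[OF \<open>inj ?b\<close>] inner_commute)
  also have "\<dots> = D1 F x (\<Sum>i\<in>UNIV. (?b i \<bullet> D1 F x v) *\<^sub>R e i)"
    by (simp add: linear_sum[OF linear_D1F[OF x]] linear_scale[OF linear_D1F[OF x]])
  finally show ?thesis using inj_D1[OF x] by (meson injD)
qed

text \<open>\<open>t\<close> times the first fundamental form plus the second, in the coordinate
  basis. Its determinant encodes the symmetric functions of the curvatures without choosing a frame,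
  so it is continuous in \<open>x\<close>.\<close>

definition form_matrix :: "real ^ 'm \<Rightarrow> real \<Rightarrow> real ^ 'm ^ 'm" where
  "form_matrix x t = (\<chi> i j. (t *\<^sub>R D1 F x (axis i 1) + D1 N x (axis i 1)) \<bullet> D1 F x (axis j 1))"

definition gram_matrix :: "real ^ 'm \<Rightarrow> real ^ 'm ^ 'm" where
  "gram_matrix x = (\<chi> i j. D1 F x (axis i 1) \<bullet> D1 F x (axis j 1))"

lemma congruence_matrix:
  fixes L K :: "real ^ 'm \<Rightarrow> real ^ 'n"
  assumes "linear L" "linear K"
  shows "transpose (\<chi> i j. e j $ i) ** (\<chi> i j. L (axis i 1) \<bullet> K (axis j 1)) ** (\<chi> i j. e j $ i)
     = (\<chi> i j. L (e i) \<bullet> K (e j))"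
proof -
  have "L (e i) \<bullet> K (e j) = (\<Sum>l\<in>UNIV. (\<Sum>k\<in>UNIV. e i $ k * (L (axis k 1) \<bullet> K (axis l 1))) * e j $ l)" for i j
    unfolding linear_sum_axis[OF assms(1), of "e i"] linear_sum_axis[OF assms(2), of "e j"]
    by (simp add: inner_sum_left inner_sum_right sum_distrib_right sum_distrib_left mult_ac)
  then show ?thesis by (simp add: vec_eq_iff matrix_matrix_mult_def transpose_def)
qed

text \<open>With the frame vectors as columns of \<open>?P\<close>, congruence makes the Gram matrix
  the identity and the form matrix diagonal. Both determinants acquire the factor
  \<open>(det ?P)\<^sup>2\<close>, which therefore drops out of their ratio.\<close>

lemma det_form_matrix:
  assumes x: "x \<in> \<Omega>" and fr: "frame x e \<kappa>"
  shows "det (gram_matrix x) > 0"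
    and "det (form_matrix x t) = det (gram_matrix x) * (\<Prod>i\<in>UNIV. t + \<kappa> i)"
proof -
  let ?P = "(\<chi> i j. e j $ i) :: real ^ 'm ^ 'm"
  have lin: "linear (\<lambda>v. t *\<^sub>R D1 F x v + D1 N x v)"
    using linear_D1F[OF x] linear_D1N[OF x] by (intro linear_compose_add linear_compose_scale_right)
  have "transpose ?P ** gram_matrix x ** ?P = mat 1"
    unfolding gram_matrix_def congruence_matrix[OF linear_D1F[OF x] linear_D1F[OF x]]
    using fr by (simp add: frame_def vec_eq_iff mat_def)
  from arg_cong[OF this, of det] have g: "(det ?P)\<^sup>2 * det (gram_matrix x) = 1"
    by (simp add: det_mul det_transpose power2_eq_square mult_ac)
  then have "(det ?P)\<^sup>2 > 0" by (metis mult_zero_left zero_less_power2 zero_neq_one zero_power2)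
  with g show "det (gram_matrix x) > 0" by (metis zero_less_mult_pos zero_less_one)
  have "(t *\<^sub>R D1 F x (e i) + D1 N x (e i)) \<bullet> D1 F x (e j) = (if i = j then t + \<kappa> i else 0)" for i j
    using fr by (simp add: frame_def inner_add_left)
  then have "transpose ?P ** form_matrix x t ** ?P = (\<chi> i j. if i = j then t + \<kappa> i else 0)"
    unfolding form_matrix_def congruence_matrix[OF lin linear_D1F[OF x]] by simp
  from arg_cong[OF this, of det] have "(det ?P)\<^sup>2 * det (form_matrix x t) = (\<Prod>i\<in>UNIV. t + \<kappa> i)"
    by (simp add: det_mul det_transpose power2_eq_square mult_ac det_diagonal)
  then have "det (gram_matrix x) * ((det ?P)\<^sup>2 * det (form_matrix x t)) = det (gram_matrix x) * (\<Prod>i\<in>UNIV. t + \<kappa> i)"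
    by simp
  moreover have "det (gram_matrix x) * ((det ?P)\<^sup>2 * det (form_matrix x t)) = det (form_matrix x t)"
    using g by (metis mult.assoc mult.commute mult_1)
  ultimately show "det (form_matrix x t) = det (gram_matrix x) * (\<Prod>i\<in>UNIV. t + \<kappa> i)" by simp
qed

lemma continuous_det_form_matrix: "continuous_on \<Omega> (\<lambda>x. det (form_matrix x t))"
  unfolding det_def form_matrix_def
  by (auto intro!: continuous_intros smooth_on_continuous_D1 smooth_F smooth_N)

end

text \<open>Replacing t by 2 t and subtracting the matching power of 2 times the original cancels the leading coefficient, so
  induction on m applies.\<close>
lemma continuous_on_coefficients:
  fixes c :: "nat \<Rightarrow> 'a::topological_space \<Rightarrow> real"
  assumes "\<And>t. continuous_on S (\<lambda>x. \<Sum>l\<le>m. c l x * t ^ l)" "l \<le> m"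
  shows "continuous_on S (c l)"
  using assms
proof (induction m arbitrary: c l)
  case 0
  have "continuous_on S (\<lambda>x. c 0 x)" using "0.prems"(1)[of 1] by simp
  then show ?case using "0.prems"(2) by simp
next
  case (Suc m)
  have lower: "continuous_on S (c l)" if "l \<le> m" for l
  proof -
    define d where "d l x = c l x * (2 ^ l - 2 ^ Suc m)" for l x
    have "continuous_on S (\<lambda>x. \<Sum>l\<le>m. d l x * t ^ l)" for t
    proof -
      have "continuous_on S (\<lambda>x. (\<Sum>l\<le>Suc m. c l x * (2 * t) ^ l) - 2 ^ Suc m * (\<Sum>l\<le>Suc m. c l x * t ^ l))"
        by (intro continuous_on_diff continuous_on_mult_left Suc.prems(1))
      moreover have "(\<Sum>l\<le>Suc m. c l x * (2 * t) ^ l) - 2 ^ Suc m * (\<Sum>l\<le>Suc m. c l x * t ^ l)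
          = (\<Sum>l\<le>m. d l x * t ^ l)" for x
        by (simp add: d_def power_mult_distrib sum_distrib_left algebra_simps sum_subtractf)
      ultimately show ?thesis by simp
    qed
    then have "continuous_on S (d l)" using Suc.IH[of d l] that by blast
    moreover have ne: "(2::real) ^ l - 2 ^ Suc m \<noteq> 0"
      using that power_strict_increasing[of l "Suc m" "2::real"] by simp
    ultimately have "continuous_on S (\<lambda>x. d l x / (2 ^ l - 2 ^ Suc m))"
      by (intro continuous_on_divide continuous_on_const) auto
    then show ?thesis using ne by (simp add: d_def)
  qed
  show ?case
  proof (cases "l \<le> m")
    case True then show ?thesis by (rule lower)
  next
    case False
    then have l: "l = Suc m" using Suc.prems by simp
    have "continuous_on S (\<lambda>x. \<Sum>l\<le>m. c l x)"
      by (rule continuous_on_sum) (use lower in auto)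
    from continuous_on_diff[OF Suc.prems(1)[of 1] this] show ?thesis by (simp add: l)
  qed
qed

context param_hypersurface
begin

text \<open>No continuity of \<open>\<kappa>\<close> is assumed: the functions in question are the
  coefficients in \<open>t\<close> of \<open>det (form_matrix x t)\<close>. The positive Gram factor
  may stay, since only signs are read off later.\<close>

lemma continuous_elem_sym:
  assumes fr: "\<And>x. x \<in> \<Omega> \<Longrightarrow> \<exists>e. frame x e (\<kappa> x)" and "j \<le> CARD('m)"
  shows "continuous_on \<Omega> (\<lambda>x. det (gram_matrix x) * elem_sym j (\<kappa> x))"
proof -
  let ?m = "CARD('m)"
  define c where "c l x = det (gram_matrix x) * elem_sym (?m - l) (\<kappa> x)" for l x
  have "continuous_on \<Omega> (\<lambda>x. \<Sum>l\<le>?m. c l x * t ^ l)" for t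
  proof -
    have "(\<Sum>l\<le>?m. c l x * t ^ l) = det (form_matrix x t)" if x: "x \<in> \<Omega>" for x
    proof -
      have "(\<Sum>l\<le>?m. c l x * t ^ l) = (\<Sum>l\<le>?m. c (?m - l) x * t ^ (?m - l))"
        by (rule sum.reindex_bij_witness[of _ "\<lambda>l. ?m - l" "\<lambda>l. ?m - l"]) auto
      also have "\<dots> = det (gram_matrix x) * (\<Prod>i\<in>UNIV. t + \<kappa> x i)"
        unfolding prod_linear_eq_elem_sym sum_distrib_left by (intro sum.cong) (auto simp: c_def)
      finally show ?thesis using fr[OF x] det_form_matrix(2)[OF x] by metis
    qed
    then show ?thesis using continuous_det_form_matrix[of t] by (simp cong: continuous_on_cong)
  qed
  then have "continuous_on \<Omega> (c (?m - j))" by (rule continuous_on_coefficients) simp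
  then show ?thesis using assms(2) by (simp add: c_def)
qed

section \<open>The squared distance to a point in coordinates\<close>

definition sqdist :: "real ^ 'n \<Rightarrow> real ^ 'm \<Rightarrow> real" where
  "sqdist z x = (F x - z) \<bullet> (F x - z)"

definition sqdist' :: "real ^ 'n \<Rightarrow> real ^ 'm \<Rightarrow> real ^ 'm \<Rightarrow> real" where
  "sqdist' z x v = 2 * ((F x - z) \<bullet> D1 F x v)"

definition sqdist'' :: "real ^ 'n \<Rightarrow> real ^ 'm \<Rightarrow> real ^ 'm \<Rightarrow> real ^ 'm \<Rightarrow> real" where
  "sqdist'' z x v w = 2 * ((F x - z) \<bullet> D2 F x v w + D1 F x w \<bullet> D1 F x v)"

lemma sqdist_derivative: "x \<in> \<Omega> \<Longrightarrow> (sqdist z has_derivative sqdist' z x) (at x)"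
proof -
  assume x: "x \<in> \<Omega>"
  have "((\<lambda>x. F x - z) has_derivative D1 F x) (at x)"
    using has_derivative_diff[OF smooth_on_D1[OF smooth_F x] has_derivative_const] by simp
  from has_derivative_inner[OF this this] show ?thesis
    unfolding sqdist_def[abs_def] sqdist'_def[abs_def] by (simp add: inner_commute)
qed

lemma sqdist'_derivative: "x \<in> \<Omega> \<Longrightarrow> ((\<lambda>y. sqdist' z y v) has_derivative sqdist'' z x v) (at x)"
proof -
  assume x: "x \<in> \<Omega>"
  have "((\<lambda>x. F x - z) has_derivative D1 F x) (at x)"
    using has_derivative_diff[OF smooth_on_D1[OF smooth_F x] has_derivative_const] by simp
  from has_derivative_mult_right[OF has_derivative_inner[OF this smooth_on_D2[OF smooth_F x]], of 2 v] show ?thesis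
    unfolding sqdist'_def[abs_def] sqdist''_def[abs_def] by simp
qed

text \<open>At a point farthest from \<open>z\<close> the first derivative of the squared distance
  vanishes, so \<open>F x - z\<close> is normal. Its second derivative along the unit principal
  direction \<open>e i\<close> is 2 - 2 c \<open>\<kappa> i\<close>, with c the normal component of
  \<open>F x - z\<close>, and cannot be positive.\<close>

lemma touching_sphere:
  assumes x: "x \<in> \<Omega>" and fr: "frame x e \<kappa>"
    and far: "\<And>y. y \<in> \<Omega> \<Longrightarrow> dist z (F y) \<le> dist z (F x)"
  shows "F x - z = ((F x - z) \<bullet> N x) *\<^sub>R N x" and "1 \<le> ((F x - z) \<bullet> N x) * \<kappa> i"
proof -
  obtain r where r: "r > 0" "ball x r \<subseteq> \<Omega>" using open_dom x open_contains_ball by metis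
  have mx: "- sqdist z x \<le> - sqdist z y" if "y \<in> \<Omega>" for y
  proof -
    have "(dist (F y) z)\<^sup>2 \<le> (dist (F x) z)\<^sup>2"
      using far[OF that] by (intro power_mono) (auto simp: dist_commute)
    then show ?thesis by (simp add: sqdist_def dist_norm power2_norm_eq_inner)
  qed
  have der: "sqdist' z x v = 0 \<and> sqdist'' z x v v \<le> 0" for v
    using local_min_derivatives[OF r(1), of x "\<lambda>y. - sqdist z y" "\<lambda>y w. - sqdist' z y w" v "\<lambda>w. - sqdist'' z x v w"]
      has_derivative_minus[OF sqdist_derivative] has_derivative_minus[OF sqdist'_derivative[OF x]] r mx
    by (auto simp: subset_eq)
  define c where "c = (F x - z) \<bullet> N x"
  \<comment> \<open>The tangential part of \<open>F x - z\<close>; the vanishing first derivative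
    makes it orthogonal to itself.\<close>
  let ?y = "F x - z - c *\<^sub>R N x"
  have "N x \<bullet> ?y = 0" using norm_N[OF x] by (simp add: c_def inner_diff_right inner_commute norm_eq_1)
  then have "?y \<in> range (D1 F x)" using range_D1F[OF x] by blast
  then obtain w where w: "?y = D1 F x w" by blast
  have "?y \<bullet> ?y = (F x - z) \<bullet> D1 F x w - c * (N x \<bullet> D1 F x w)"
    by (subst (2) w) (simp add: inner_diff_left)
  also have "\<dots> = 0" using der[of w] N_orth[OF x] by (simp add: sqdist'_def)
  finally have eq: "F x - z = c *\<^sub>R N x" by simp
  then show "F x - z = ((F x - z) \<bullet> N x) *\<^sub>R N x" by (simp add: c_def)
  have on: "D1 F x (e i) \<bullet> D1 F x (e i) = 1" using fr by (simp add: frame_def)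
  have "(F x - z) \<bullet> D2 F x (e i) (e i) = - c * (D1 N x (e i) \<bullet> D1 F x (e i))"
    unfolding eq using second_fundamental_form[OF x] by simp
  also have "\<dots> = - c * \<kappa> i" using fr on by (simp add: frame_def)
  finally have "(F x - z) \<bullet> D2 F x (e i) (e i) = - c * \<kappa> i" .
  then show "1 \<le> ((F x - z) \<bullet> N x) * \<kappa> i"
    using der[of "e i"] on by (simp add: sqdist''_def c_def)
qed

text \<open>By homogeneity only unit vectors matter, and \<open>K\<close> times the unit sphere is
  compact; the lower bound is positive because \<open>D1 F x\<close> is injective. These constants
  yield the uniform ellipticity required by the minimum principle.\<close>

lemma compact_bounds:
  assumes "compact K" "K \<subseteq> \<Omega>"
  obtains c C B where "c > 0" "C > 0" "B > 0"
    "\<And>x v. x \<in> K \<Longrightarrow> c * norm v \<le> norm (D1 F x v)"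
    "\<And>x v. x \<in> K \<Longrightarrow> norm (D1 F x v) \<le> C * norm v"
    "\<And>x v. x \<in> K \<Longrightarrow> norm (D2 F x v v) \<le> B * (norm v)\<^sup>2"
proof -
  let ?S = "K \<times> sphere (0::real^'m) 1"
  have comp: "compact ?S" using assms(1) by (intro compact_Times) auto
  have cfst: "continuous_on ?S (\<lambda>p. g (fst p))" if "continuous_on \<Omega> g" for g :: "real^'m \<Rightarrow> real^'n"
    using assms(2) that by (intro continuous_on_compose2[OF that] continuous_intros) auto
  have c1: "continuous_on ?S (\<lambda>p. D1 F (fst p) (snd p))"
  proof -
    have "continuous_on ?S (\<lambda>p. \<Sum>i\<in>UNIV. snd p $ i *\<^sub>R D1 F (fst p) (axis i 1))"
      by (intro continuous_intros cfst smooth_on_continuous_D1 smooth_F)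
    then show ?thesis
      by (rule continuous_on_eq) (use assms(2) linear_sum_axis[OF linear_D1F] in auto)
  qed
  have c2: "continuous_on ?S (\<lambda>p. D2 F (fst p) (snd p) (snd p))"
  proof -
    have "continuous_on ?S (\<lambda>p. \<Sum>i\<in>UNIV. snd p $ i *\<^sub>R (\<Sum>j\<in>UNIV. snd p $ j *\<^sub>R D2 F (fst p) (axis i 1) (axis j 1)))"
      by (intro continuous_intros cfst smooth_on_continuous_D2 smooth_F)
    moreover have "(\<Sum>i\<in>UNIV. v $ i *\<^sub>R (\<Sum>j\<in>UNIV. v $ j *\<^sub>R D2 F x (axis i 1) (axis j 1))) = D2 F x v v"
      if "x \<in> K" for x v
    proof -
      have x: "x \<in> \<Omega>" using that assms(2) by blast
      have "D2 F x v v = (\<Sum>i\<in>UNIV. v $ i *\<^sub>R D2 F x v (axis i 1))"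
        by (rule linear_sum_axis[OF linear_D2F[OF x]])
      \<comment> \<open>As a derivative, \<open>D2 F x v\<close> is linear in its last argument;
        expanding in the other one goes through the symmetry.\<close>
      also have "\<dots> = (\<Sum>i\<in>UNIV. v $ i *\<^sub>R D2 F x (axis i 1) v)"
        by (simp only: D2_sym[OF open_dom smooth_F x, of v])
      also have "\<dots> = (\<Sum>i\<in>UNIV. v $ i *\<^sub>R (\<Sum>j\<in>UNIV. v $ j *\<^sub>R D2 F x (axis i 1) (axis j 1)))"
        by (subst linear_sum_axis[OF linear_D2F[OF x], of _ v]) simp
      finally show ?thesis by simp
    qed
    ultimately show ?thesis by (rule continuous_on_eq) auto
  qed
  have scale: "v = norm v *\<^sub>R (v /\<^sub>R norm v)" "v \<noteq> 0 \<Longrightarrow> v /\<^sub>R norm v \<in> sphere 0 1" for v :: "real^'m"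
    by (cases "v = 0"; simp)+
  have lin: "norm (D1 F x v) = norm v * norm (D1 F x (v /\<^sub>R norm v))" if "x \<in> K" for x v
    using linear_scale[OF linear_D1F, of x "norm v" "v /\<^sub>R norm v"] that assms(2) by (cases "v = 0") (auto simp: linear_0[OF linear_D1F] subset_eq)
  have lin2: "norm (D2 F x v v) = (norm v)\<^sup>2 * norm (D2 F x (v /\<^sub>R norm v) (v /\<^sub>R norm v))" if "x \<in> K" "v \<noteq> 0" for x v
  proof -
    let ?u = "v /\<^sub>R norm v"
    have x: "x \<in> \<Omega>" using that assms(2) by blast
    have v: "v = norm v *\<^sub>R ?u" using that by simp
    have "D2 F x v v = norm v *\<^sub>R D2 F x v ?u" by (subst (2) v) (rule linear_scale[OF linear_D2F[OF x]])
    also have "D2 F x v ?u = D2 F x ?u v" by (rule D2_sym[OF open_dom smooth_F x])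
    also have "D2 F x ?u v = norm v *\<^sub>R D2 F x ?u ?u" by (subst (2) v) (rule linear_scale[OF linear_D2F[OF x]])
    finally show ?thesis by (simp add: power2_eq_square)
  qed
  have "\<exists>c>0. \<forall>p\<in>?S. c \<le> norm (D1 F (fst p) (snd p))"
  proof (cases "?S = {}")
    case False
    obtain p where p: "p \<in> ?S" "\<And>q. q \<in> ?S \<Longrightarrow> norm (D1 F (fst p) (snd p)) \<le> norm (D1 F (fst q) (snd q))"
      using continuous_attains_inf[OF comp False continuous_on_norm[OF c1]] by blast
    have "fst p \<in> \<Omega>" "snd p \<noteq> 0" using p(1) assms(2) by (auto simp: mem_Times_iff)
    then have "D1 F (fst p) (snd p) \<noteq> 0"
      using inj_D1 linear_0[OF linear_D1F] by (metis injD)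
    then show ?thesis using p by (intro exI[of _ "norm (D1 F (fst p) (snd p))"]) auto
  qed (auto intro: zero_less_one)
  then obtain c where c: "c > 0" "\<And>x u. x \<in> K \<Longrightarrow> u \<in> sphere 0 1 \<Longrightarrow> c \<le> norm (D1 F x u)" by force
  have bd: "\<exists>C>0. \<forall>p\<in>?S. norm (g p) \<le> C" if "continuous_on ?S g" for g :: "(real^'m) \<times> (real^'m) \<Rightarrow> real^'n"
    using compact_imp_bounded[OF compact_continuous_image[OF that comp]] bounded_pos by (metis image_eqI)
  obtain C where C: "C > 0" "\<And>x u. x \<in> K \<Longrightarrow> u \<in> sphere 0 1 \<Longrightarrow> norm (D1 F x u) \<le> C" using bd[OF c1] by force
  obtain B where B: "B > 0" "\<And>x u. x \<in> K \<Longrightarrow> u \<in> sphere 0 1 \<Longrightarrow> norm (D2 F x u u) \<le> B" using bd[OF c2] by force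
  show ?thesis
  proof
    show "c > 0" "C > 0" "B > 0" by fact+
    fix x v assume x: "x \<in> K"
    then have x': "x \<in> \<Omega>" using assms(2) by blast
    show "c * norm v \<le> norm (D1 F x v)"
    proof (cases "v = 0")
      case False
      then show ?thesis using lin[OF x, of v] c(2)[OF x scale(2)] by (metis mult.commute mult_left_mono norm_ge_zero)
    qed simp
    show "norm (D1 F x v) \<le> C * norm v"
    proof (cases "v = 0")
      case False
      then show ?thesis using lin[OF x, of v] C(2)[OF x scale(2)] by (metis mult.commute mult_left_mono norm_ge_zero)
    qed (simp add: linear_0[OF linear_D1F[OF x']])
    show "norm (D2 F x v v) \<le> B * (norm v)\<^sup>2"
    proof (cases "v = 0")
      case False
      then show ?thesis using lin2[OF x False] B(2)[OF x scale(2)] by (metis mult.commute mult_left_mono zero_le_power2)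
    qed (simp add: linear_0[OF linear_D2F[OF x']])
  qed
qed

text \<open>The inverse function argument needs \<open>D1 F\<close> continuous in operator norm.
  Smoothness gives continuity along each fixed direction, and expansion in the standard basis turns
  finitely many of these into the operator norm.\<close>

lemma locally_injective:
  assumes x: "x \<in> \<Omega>"
  obtains s where "s > 0" "ball x s \<subseteq> \<Omega>" "inj_on F (ball x s)"
proof -
  obtain g where g: "linear g" "g \<circ> D1 F x = id"
    using linear_injective_left_inverse[OF linear_D1F[OF x] inj_D1[OF x]] by blast
  have cont: "\<exists>d>0. \<forall>y. dist x y < d \<longrightarrow> onorm (\<lambda>v. D1 F y v - D1 F x v) < \<epsilon>" if "\<epsilon> > 0" for \<epsilon>
  proof -
    let ?m = "real CARD('m)"
    \<comment> \<open>Summed over all basis directions this gives \<open>\<epsilon>\<close> /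
      2.\<close>
    define \<eta> where "\<eta> = \<epsilon> / (2 * ?m)"
    have \<eta>: "\<eta> > 0" using that by (simp add: \<eta>_def)
    have "isCont (\<lambda>y. D1 F y (axis i 1)) x" for i
      using smooth_on_continuous_D1[OF smooth_F] open_dom x by (simp add: continuous_on_eq_continuous_at)
    then have "\<exists>d>0. \<forall>y. dist y x < d \<longrightarrow> dist (D1 F y (axis i 1)) (D1 F x (axis i 1)) < \<eta>" for i
      using \<eta> unfolding continuous_at_eps_delta by blast
    then obtain d where d: "\<And>i. d i > 0"
      "\<And>i y. dist y x < d i \<Longrightarrow> dist (D1 F y (axis i 1)) (D1 F x (axis i 1)) < \<eta>" by metis
    obtain d0 where d0: "d0 > 0" "ball x d0 \<subseteq> \<Omega>" using open_dom x open_contains_ball by metis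
    define \<delta> where "\<delta> = Min (insert d0 (range d))"
    have "\<delta> > 0" using d d0 by (simp add: \<delta>_def)
    moreover have "onorm (\<lambda>v. D1 F y v - D1 F x v) < \<epsilon>" if "dist x y < \<delta>" for y
    proof -
      have "\<delta> \<le> d0" "\<And>i. \<delta> \<le> d i" unfolding \<delta>_def by (rule Min_le; simp)+
      then have y: "y \<in> \<Omega>" and dy: "\<And>i. dist y x < d i"
        using that d0 by (auto simp: dist_commute subset_eq order_less_le_trans)
      have "norm (D1 F y v - D1 F x v) \<le> (?m * \<eta>) * norm v" for v
      proof -
        have "D1 F y v - D1 F x v = (\<Sum>i\<in>UNIV. v $ i *\<^sub>R (D1 F y (axis i 1) - D1 F x (axis i 1)))"
          by (subst (1 2) linear_sum_axis[of _ v])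
            (simp_all add: linear_D1F x y sum_subtractf scaleR_diff_right)
        also have "norm \<dots> \<le> (\<Sum>i\<in>(UNIV::'m set). norm v * \<eta>)"
        proof (rule sum_norm_le)
          fix i
          have "norm (D1 F y (axis i 1) - D1 F x (axis i 1)) \<le> \<eta>"
            using d(2)[OF dy, of i] by (simp add: dist_norm)
          then show "norm (v $ i *\<^sub>R (D1 F y (axis i 1) - D1 F x (axis i 1))) \<le> norm v * \<eta>"
            using component_le_norm_cart[of v i] by (simp add: mult_mono)
        qed
        finally show ?thesis by (simp add: mult_ac)
      qed
      then have "onorm (\<lambda>v. D1 F y v - D1 F x v) \<le> ?m * \<eta>" by (rule onorm_le)
      also have "\<dots> < \<epsilon>" using \<open>\<epsilon> > 0\<close> by (simp add: \<eta>_def)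
      finally show ?thesis .
    qed
    ultimately show ?thesis by blast
  qed
  show ?thesis
  proof (rule has_derivative_locally_injective[where f = F and f' = "D1 F" and g' = g and S = \<Omega> and a = x])
    show "bounded_linear g" using g(1) by (simp add: linear_conv_bounded_linear)
    show "(F has_derivative D1 F y) (at y)" if "y \<in> \<Omega>" for y using smooth_on_D1[OF smooth_F that] .
    show "x \<in> \<Omega>" "open \<Omega>" "g \<circ> D1 F x = id" by (rule x open_dom g(2))+
    show "thesis" if "0 < s" "ball x s \<subseteq> \<Omega>" "inj_on F (ball x s)" for s
      using that by (rule \<open>\<And>s. 0 < s \<Longrightarrow> ball x s \<subseteq> \<Omega> \<Longrightarrow> inj_on F (ball x s) \<Longrightarrow> thesis\<close>)
  qed (use cont in blast)
qed

text \<open>Coordinate second derivatives are not the intrinsic Hessian, but along the principal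
  frame their sum is twice the left minus the right side of \<open>super\<close>, plus a term
  pairing \<open>D2 F\<close> with the tangential part of \<open>F\<close>. That part is controlled
  by the gradient of \<open>sqdist 0\<close>, so this term is of first order, as the minimum
  principle allows.\<close>

lemma sqdist_strong_minimum:
  assumes fr: "\<And>x. x \<in> \<Omega> \<Longrightarrow> \<exists>e. frame x e (\<kappa> x)"
    and super: "\<And>x. x \<in> \<Omega> \<Longrightarrow> real CARD('m) \<le> (F x \<bullet> N x) * (\<Sum>i\<in>UNIV. \<kappa> x i)"
    and x0: "x0 \<in> \<Omega>" "\<And>x. x \<in> \<Omega> \<Longrightarrow> sqdist 0 x0 \<le> sqdist 0 x"
  shows "\<exists>r>0. ball x0 r \<subseteq> \<Omega> \<and> (\<forall>x\<in>ball x0 r. sqdist 0 x = sqdist 0 x0)"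
proof (rule strong_minimum_principle[OF open_dom x0(1) refl sqdist_derivative sqdist'_derivative x0(2),
      where ?'i = 'm])
  fix K assume K: "compact K" "K \<subseteq> \<Omega>"
  let ?m = "real CARD('m)"
  obtain c C B where b: "c > 0" "C > 0" "B > 0"
    and lo: "\<And>x v. x \<in> K \<Longrightarrow> c * norm v \<le> norm (D1 F x v)"
    and hi: "\<And>x v. x \<in> K \<Longrightarrow> norm (D1 F x v) \<le> C * norm v"
    and d2: "\<And>x v. x \<in> K \<Longrightarrow> norm (D2 F x v v) \<le> B * (norm v)\<^sup>2"
    using compact_bounds[OF K] by metis
  \<comment> \<open>The three entries serve the length of the frame vectors, the spanning inequality
    and the gradient term, in this order.\<close>
  define Q where "Q = max (1/c) (max (C\<^sup>2 * ?m) (?m * B * (1/c)\<^sup>2 * (1/c)))"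
  have "Q > 0" using b(1) unfolding Q_def by (simp add: less_max_iff_disj)
  moreover have "\<exists>e::'m \<Rightarrow> real ^ 'm. (\<forall>i. norm (e i) \<le> Q) \<and> (\<forall>y. (norm y)\<^sup>2 \<le> Q * (\<Sum>i\<in>UNIV. (e i \<bullet> y)\<^sup>2)) \<and>
       (\<forall>G. (\<forall>w. \<bar>sqdist' 0 x w\<bar> \<le> G * norm w) \<longrightarrow> (\<Sum>i\<in>UNIV. sqdist'' 0 x (e i) (e i)) \<le> Q * G)"
    if xK: "x \<in> K" for x
  proof -
    have x: "x \<in> \<Omega>" using xK K by blast
    obtain e where e: "frame x e (\<kappa> x)" using fr[OF x] by blast
    have on: "D1 F x (e i) \<bullet> D1 F x (e i) = 1" for i using e by (simp add: frame_def)
    have ne: "norm (e i) \<le> 1/c" for i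
      using lo[OF xK, of "e i"] on[of i] b by (simp add: norm_eq_1[symmetric] field_simps)
    show ?thesis
    proof (intro exI[of _ e] conjI allI impI)
      fix i show "norm (e i) \<le> Q" using ne[of i] by (simp add: Q_def)
    next
      fix y :: "real ^ 'm"
      have "y \<bullet> y = (\<Sum>i\<in>UNIV. (D1 F x (e i) \<bullet> D1 F x y) * (e i \<bullet> y))"
        by (subst frame_expansion[OF x e, of y]) (simp add: inner_sum_left)
      also have "\<dots> \<le> (\<Sum>i\<in>UNIV. (C * norm y) * \<bar>e i \<bullet> y\<bar>)"
      proof (rule sum_mono)
        fix i
        have "\<bar>D1 F x (e i) \<bullet> D1 F x y\<bar> \<le> norm (D1 F x (e i)) * norm (D1 F x y)" by (rule Cauchy_Schwarz_ineq2)
        also have "\<dots> \<le> C * norm y" using on[of i] hi[OF xK, of y] by (simp add: norm_eq_1[symmetric])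
        finally have "\<bar>(D1 F x (e i) \<bullet> D1 F x y) * (e i \<bullet> y)\<bar> \<le> (C * norm y) * \<bar>e i \<bullet> y\<bar>"
          unfolding abs_mult by (rule mult_right_mono) simp
        then show "(D1 F x (e i) \<bullet> D1 F x y) * (e i \<bullet> y) \<le> (C * norm y) * \<bar>e i \<bullet> y\<bar>" by linarith
      qed
      finally have "norm y * norm y \<le> norm y * (C * (\<Sum>i\<in>UNIV. \<bar>e i \<bullet> y\<bar>))"
        by (simp add: power2_norm_eq_inner[symmetric] power2_eq_square sum_distrib_left mult_ac)
      then have "norm y \<le> C * (\<Sum>i\<in>UNIV. \<bar>e i \<bullet> y\<bar>)"
        using b by (cases "y = 0") (auto intro!: mult_nonneg_nonneg sum_nonneg)
      then have "(norm y)\<^sup>2 \<le> (C * (\<Sum>i\<in>UNIV. \<bar>e i \<bullet> y\<bar>))\<^sup>2" by (intro power_mono) auto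
      also have "\<dots> = C\<^sup>2 * (\<Sum>i\<in>UNIV. \<bar>e i \<bullet> y\<bar>)\<^sup>2" by (simp add: power_mult_distrib)
      also have "\<dots> \<le> C\<^sup>2 * (?m * (\<Sum>i\<in>UNIV. (e i \<bullet> y)\<^sup>2))"
        using sum_squared_le_sum_of_squares[of "\<lambda>i. \<bar>e i \<bullet> y\<bar>" UNIV]
        by (intro mult_left_mono) (simp_all add: mult.commute)
      also have "\<dots> \<le> Q * (\<Sum>i\<in>UNIV. (e i \<bullet> y)\<^sup>2)"
        unfolding mult.assoc[symmetric] by (intro mult_right_mono sum_nonneg) (auto simp: Q_def)
      finally show "(norm y)\<^sup>2 \<le> Q * (\<Sum>i\<in>UNIV. (e i \<bullet> y)\<^sup>2)" .
    next
      fix G assume G: "\<forall>w. \<bar>sqdist' 0 x w\<bar> \<le> G * norm w"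
      define u where "u = F x \<bullet> N x"
      have "N x \<bullet> (F x - u *\<^sub>R N x) = 0"
        using norm_N[OF x] by (simp add: u_def inner_diff_right inner_commute norm_eq_1)
      then have "F x - u *\<^sub>R N x \<in> range (D1 F x)" using range_D1F[OF x] by blast
      then obtain w where w: "F x - u *\<^sub>R N x = D1 F x w" by blast
      then have Fx: "F x = u *\<^sub>R N x + D1 F x w" by (simp add: algebra_simps)
      have Gnn: "G \<ge> 0"
      proof -
        obtain k :: 'm where True by blast
        have "0 \<le> G * norm (axis k 1 :: real ^ 'm)" using G abs_ge_zero order_trans by blast
        then show ?thesis by simp
      qed
      \<comment> \<open>The gradient bound is tested on the coordinate vector \<open>w\<close> of
        the tangential part of \<open>F x\<close> itself.\<close>
      have "2 * (norm (D1 F x w))\<^sup>2 = sqdist' 0 x w"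
        unfolding sqdist'_def by (simp add: Fx inner_add_left N_orth[OF x] power2_norm_eq_inner)
      also have "\<dots> \<le> G * norm w" using G abs_le_D1 by blast
      also have "\<dots> \<le> G * (norm (D1 F x w) / c)"
        using lo[OF xK, of w] b Gnn by (intro mult_left_mono) (auto simp: field_simps)
      finally have "norm (D1 F x w) * (2 * norm (D1 F x w)) \<le> norm (D1 F x w) * (G / c)"
        by (simp add: power2_eq_square mult_ac)
      then have nw: "2 * norm (D1 F x w) \<le> G / c"
      proof (cases "D1 F x w = 0")
        case False
        then have "0 < norm (D1 F x w)" by simp
        from mult_le_cancel_left_pos[OF this] show ?thesis using \<open>norm (D1 F x w) * _ \<le> _\<close> by blast
      qed (use b Gnn in simp)
      have tm: "sqdist'' 0 x (e i) (e i) \<le> 2 - 2 * u * \<kappa> x i + (G / c) * (B * (1/c)\<^sup>2)" for i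
      proof -
        have "N x \<bullet> D2 F x (e i) (e i) = - \<kappa> x i"
          using second_fundamental_form[OF x, of "e i" "e i"] e on[of i] by (simp add: frame_def)
        then have "sqdist'' 0 x (e i) (e i) = 2 - 2 * u * \<kappa> x i + 2 * (D1 F x w \<bullet> D2 F x (e i) (e i))"
          unfolding sqdist''_def by (simp add: Fx inner_add_left on)
        moreover have "2 * (D1 F x w \<bullet> D2 F x (e i) (e i)) \<le> (2 * norm (D1 F x w)) * norm (D2 F x (e i) (e i))"
          using norm_cauchy_schwarz[of "D1 F x w" "D2 F x (e i) (e i)"] by simp
        moreover have "norm (D2 F x (e i) (e i)) \<le> B * (1/c)\<^sup>2"
          using d2[OF xK, of "e i"] ne[of i] b by (meson mult_left_mono norm_ge_zero order_trans power_mono less_imp_le)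
        then have "(2 * norm (D1 F x w)) * norm (D2 F x (e i) (e i)) \<le> (G / c) * (B * (1/c)\<^sup>2)"
          using nw b Gnn by (intro mult_mono) auto
        ultimately show ?thesis by linarith
      qed
      have "(\<Sum>i\<in>UNIV. sqdist'' 0 x (e i) (e i)) \<le> (\<Sum>i\<in>UNIV. 2 - 2 * u * \<kappa> x i + (G / c) * (B * (1/c)\<^sup>2))"
        by (intro sum_mono tm)
      also have "\<dots> = 2 * (?m - u * (\<Sum>i\<in>UNIV. \<kappa> x i)) + ?m * B * (1/c)\<^sup>2 * (1/c) * G"
        by (simp add: sum.distrib sum_subtractf sum_distrib_left algebra_simps)
      also have "\<dots> \<le> ?m * B * (1/c)\<^sup>2 * (1/c) * G" using super[OF x] by (simp add: u_def)
      also have "\<dots> \<le> Q * G" using Gnn by (intro mult_right_mono) (auto simp: Q_def)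
      finally show "(\<Sum>i\<in>UNIV. sqdist'' 0 x (e i) (e i)) \<le> Q * G" .
    qed
  qed
  ultimately show "\<exists>C>0. \<forall>x\<in>K. \<exists>e::'m \<Rightarrow> real ^ 'm. (\<forall>i. norm (e i) \<le> C) \<and>
          (\<forall>y. (norm y)\<^sup>2 \<le> C * (\<Sum>i\<in>UNIV. (e i \<bullet> y)\<^sup>2)) \<and>
          (\<forall>G. (\<forall>w. \<bar>sqdist' 0 x w\<bar> \<le> G * norm w) \<longrightarrow> (\<Sum>i\<in>UNIV. sqdist'' 0 x (e i) (e i)) \<le> C * G)"
    by blast
qed

end


section \<open>Closed immersed hypersurfaces\<close>

locale closed_hypersurface =
  fixes M :: "'p topology" and A :: "('p, 'm::finite) chart set" and X \<nu> :: "'p \<Rightarrow> real ^ 'n::finite"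
  assumes hyp: "closed_immersed_hypersurface M A X" and normal: "unit_normal_field A X \<nu>"
begin

lemma manifold:
  shows "topspace M \<noteq> {}" "Hausdorff_space M" "second_countable M" "compact_space M" "connected_space M"
    and dim: "CARD('n) = CARD('m) + 1"
  using hyp by (auto simp: closed_immersed_hypersurface_def closed_smooth_manifold_def)

lemma atlas: "smooth_atlas M A"
  using hyp by (auto simp: closed_immersed_hypersurface_def closed_smooth_manifold_def)

lemma chart_at:
  assumes "p \<in> topspace M"
  obtains U \<phi> where "(U, \<phi>) \<in> A" "p \<in> U"
  using atlas assms unfolding smooth_atlas_def by blast

lemma chart:
  assumes "(U, \<phi>) \<in> A"
  shows "openin M U" "open (\<phi> ` U)"
    and chart_homeo: "homeomorphic_map (subtopology M U) (top_of_set (\<phi> ` U)) \<phi>"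
    and chart_inj: "inj_on \<phi> U"
proof -
  show o: "openin M U" "open (\<phi> ` U)"
    and h: "homeomorphic_map (subtopology M U) (top_of_set (\<phi> ` U)) \<phi>"
    using atlas assms unfolding smooth_atlas_def by blast+
  from homeomorphic_imp_injective_map[OF h] openin_subset[OF o(1)] show "inj_on \<phi> U"
    by (simp add: topspace_subtopology Int_absorb1)
qed

lemma chart_param:
  assumes "(U, \<phi>) \<in> A"
  shows "param_hypersurface (\<phi> ` U) (X \<circ> inv_into U \<phi>) (\<nu> \<circ> inv_into U \<phi>)"
proof
  show "open (\<phi> ` U)" using chart(2)[OF assms] .
  show "smooth_on (\<phi> ` U) (X \<circ> inv_into U \<phi>)"
    using hyp assms unfolding closed_immersed_hypersurface_def smooth_map_def by blast
  show "smooth_on (\<phi> ` U) (\<nu> \<circ> inv_into U \<phi>)"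
    using normal assms unfolding unit_normal_field_def smooth_map_def by blast
  show "CARD('n) = CARD('m) + 1" by (rule dim)
  fix x assume "x \<in> \<phi> ` U"
  then obtain p where p: "p \<in> U" "x = \<phi> p" by blast
  have inv: "inv_into U \<phi> x = p" using p chart_inj[OF assms] by simp
  have d: "chart_differential (U, \<phi>) X p = D1 (X \<circ> inv_into U \<phi>) x"
    by (simp add: chart_differential_def p)
  show "inj (D1 (X \<circ> inv_into U \<phi>) x)"
    using hyp assms p(1) unfolding closed_immersed_hypersurface_def d[symmetric] by fastforce
  show "norm ((\<nu> \<circ> inv_into U \<phi>) x) = 1"
    using normal assms p(1) inv unfolding unit_normal_field_def by fastforce
  fix v
  show "(\<nu> \<circ> inv_into U \<phi>) x \<bullet> D1 (X \<circ> inv_into U \<phi>) x v = 0"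
    using normal assms p(1) inv unfolding unit_normal_field_def d[symmetric] by fastforce
qed

lemma chart_preimage_open:
  fixes g :: "real ^ 'm \<Rightarrow> 'b::topological_space"
  assumes "(U, \<phi>) \<in> A" "continuous_on (\<phi> ` U) g" "open T"
  shows "openin M {q \<in> U. g (\<phi> q) \<in> T}"
proof -
  have "continuous_map (subtopology M U) (top_of_set (\<phi> ` U)) \<phi>"
    using chart_homeo[OF assms(1)] by (rule homeomorphic_imp_continuous_map)
  moreover have "continuous_map (top_of_set (\<phi> ` U)) euclidean g" using assms(2) by simp
  ultimately have "continuous_map (subtopology M U) euclidean (g \<circ> \<phi>)" by (rule continuous_map_compose)
  from openin_continuous_map_preimage[OF this, of T] assms(3)
  have "openin (subtopology M U) {q \<in> topspace (subtopology M U). (g \<circ> \<phi>) q \<in> T}" by simp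
  moreover have "{q \<in> topspace (subtopology M U). (g \<circ> \<phi>) q \<in> T} = {q \<in> U. g (\<phi> q) \<in> T}"
    using openin_subset[OF chart(1)[OF assms(1)]] by auto
  ultimately have "openin (subtopology M U) {q \<in> U. g (\<phi> q) \<in> T}" by (simp only:)
  then show ?thesis using openin_open_subtopology[OF chart(1)[OF assms(1)]] by blast
qed

lemma chart_image_open:
  assumes "(U, \<phi>) \<in> A" "openin M V" "V \<subseteq> U"
  shows "open (\<phi> ` V)"
proof -
  have "openin (subtopology M U) V"
    using assms(2,3) chart(1)[OF assms(1)] by (simp add: openin_open_subtopology)
  then have "openin (top_of_set (\<phi> ` U)) (\<phi> ` V)"
    using homeomorphic_map_openness_eq[OF chart_homeo[OF assms(1)]] by blast
  then show ?thesis using chart(2)[OF assms(1)] by (simp add: openin_open_eq)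
qed

text \<open>The function \<open>g\<close> may change with the chart, as the Gram determinant
  does.\<close>

lemma locally_open:
  fixes T :: "'b::topological_space set"
  assumes "open T"
    and "\<And>U \<phi>. (U, \<phi>) \<in> A \<Longrightarrow> \<exists>g. continuous_on (\<phi> ` U) g \<and> (\<forall>q\<in>U. P q \<longleftrightarrow> g (\<phi> q) \<in> T)"
  shows "openin M {q \<in> topspace M. P q}"
proof (subst openin_subopen, intro ballI)
  fix p assume "p \<in> {q \<in> topspace M. P q}"
  then have p: "p \<in> topspace M" "P p" by auto
  obtain U \<phi> where c: "(U, \<phi>) \<in> A" "p \<in> U" using chart_at[OF p(1)] by blast
  obtain g where g: "continuous_on (\<phi> ` U) g" "\<forall>q\<in>U. P q \<longleftrightarrow> g (\<phi> q) \<in> T"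
    using assms(2)[OF c(1)] by blast
  show "\<exists>V. openin M V \<and> p \<in> V \<and> V \<subseteq> {q \<in> topspace M. P q}"
  proof (intro exI conjI)
    show "openin M {q \<in> U. g (\<phi> q) \<in> T}" using chart_preimage_open[OF c(1) g(1) assms(1)] .
    show "p \<in> {q \<in> U. g (\<phi> q) \<in> T}" using p c g by blast
    show "{q \<in> U. g (\<phi> q) \<in> T} \<subseteq> {q \<in> topspace M. P q}"
      using g(2) openin_subset[OF chart(1)[OF c(1)]] by blast
  qed
qed

lemma continuous_X: "continuous_map M euclidean X"
  unfolding continuous_map_def
proof (intro conjI allI impI)
  fix V :: "(real ^ 'n) set" assume "openin euclidean V"
  then have "open V" by simp
  then show "openin M {q \<in> topspace M. X q \<in> V}"
  proof (rule locally_open)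
    fix U \<phi> assume c: "(U, \<phi>) \<in> A"
    interpret P: param_hypersurface "\<phi> ` U" "X \<circ> inv_into U \<phi>" "\<nu> \<circ> inv_into U \<phi>"
      using c by (rule chart_param)
    show "\<exists>g. continuous_on (\<phi> ` U) g \<and> (\<forall>q\<in>U. X q \<in> V \<longleftrightarrow> g (\<phi> q) \<in> V)"
      using smooth_on_continuous[OF P.smooth_F] chart_inj[OF c]
      by (intro exI[of _ "X \<circ> inv_into U \<phi>"]) simp
  qed
qed simp

section \<open>Chart-independent curvatures and their signs\<close>

definition curv :: "'p \<Rightarrow> 'm \<Rightarrow> real" where
  "curv p = principal_curvatures A X \<nu> p"

text \<open>By the chain rule the derivative of the transition map carries the frame over with the
  same \<open>\<kappa>\<close>. This matters because the chosen principal curvatures come with an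
  unspecified chart.\<close>

lemma frame_change_chart:
  assumes c: "(U, \<phi>) \<in> A" and c': "(V, \<psi>) \<in> A" and p: "p \<in> U" "p \<in> V"
    and fr: "param_hypersurface.frame (X \<circ> inv_into V \<psi>) (\<nu> \<circ> inv_into V \<psi>) (\<psi> p) e \<kappa>"
  shows "\<exists>e. param_hypersurface.frame (X \<circ> inv_into U \<phi>) (\<nu> \<circ> inv_into U \<phi>) (\<phi> p) e \<kappa>"
proof -
  interpret P: param_hypersurface "\<phi> ` U" "X \<circ> inv_into U \<phi>" "\<nu> \<circ> inv_into U \<phi>"
    using c by (rule chart_param)
  interpret Q: param_hypersurface "\<psi> ` V" "X \<circ> inv_into V \<psi>" "\<nu> \<circ> inv_into V \<psi>"
    using c' by (rule chart_param)
  define \<tau> where "\<tau> = \<phi> \<circ> inv_into V \<psi>"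
  have "smooth_on (\<psi> ` (V \<inter> U)) \<tau>"
    using atlas c c' unfolding smooth_atlas_def \<tau>_def by blast
  then have d\<tau>: "(\<tau> has_derivative D1 \<tau> (\<psi> p)) (at (\<psi> p))" using p by (intro smooth_on_D1) auto
  have o: "open (\<psi> ` (V \<inter> U))" using chart(1)[OF c] chart(1)[OF c'] by (intro chart_image_open[OF c']) auto
  have \<tau>p: "\<tau> (\<psi> p) = \<phi> p" using p chart_inj[OF c'] by (simp add: \<tau>_def)
  have D: "D1 (f \<circ> inv_into V \<psi>) (\<psi> p) v = D1 (f \<circ> inv_into U \<phi>) (\<phi> p) (D1 \<tau> (\<psi> p) v)"
    if "smooth_on (\<phi> ` U) (f \<circ> inv_into U \<phi>)" for f :: "'p \<Rightarrow> real ^ 'n" and v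
  proof -
    have "((f \<circ> inv_into U \<phi>) has_derivative D1 (f \<circ> inv_into U \<phi>) (\<phi> p)) (at (\<tau> (\<psi> p)))"
      unfolding \<tau>p using that p by (intro smooth_on_D1) auto
    from diff_chain_at[OF d\<tau> this]
    have "((f \<circ> inv_into U \<phi> \<circ> \<tau>) has_derivative (D1 (f \<circ> inv_into U \<phi>) (\<phi> p) \<circ> D1 \<tau> (\<psi> p))) (at (\<psi> p))" .
    then have "((f \<circ> inv_into V \<psi>) has_derivative (D1 (f \<circ> inv_into U \<phi>) (\<phi> p) \<circ> D1 \<tau> (\<psi> p))) (at (\<psi> p))"
    proof (rule has_derivative_transform_within_open[OF _ o])
      show "\<psi> p \<in> \<psi> ` (V \<inter> U)" using p by blast
      fix y assume "y \<in> \<psi> ` (V \<inter> U)"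
      then show "(f \<circ> inv_into U \<phi> \<circ> \<tau>) y = (f \<circ> inv_into V \<psi>) y"
        using chart_inj[OF c] chart_inj[OF c'] by (auto simp: \<tau>_def)
    qed
    from frechet_derivative_at[OF this] show ?thesis by (metis comp_apply)
  qed
  have "P.frame (\<phi> p) (\<lambda>i. D1 \<tau> (\<psi> p) (e i)) \<kappa>"
    using fr unfolding P.frame_def Q.frame_def D[OF P.smooth_F] D[OF P.smooth_N] .
  then show ?thesis by blast
qed

lemma curv_frame:
  assumes c: "(U, \<phi>) \<in> A" and p: "p \<in> U"
  shows "\<exists>e. param_hypersurface.frame (X \<circ> inv_into U \<phi>) (\<nu> \<circ> inv_into U \<phi>) (\<phi> p) e (curv p)"
proof -
  interpret P: param_hypersurface "\<phi> ` U" "X \<circ> inv_into U \<phi>" "\<nu> \<circ> inv_into U \<phi>"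
    using c by (rule chart_param)
  obtain e \<kappa> where fr: "P.frame (\<phi> p) e \<kappa>" using P.frame_exists[of "\<phi> p"] p by blast
  have "is_principal_curvatures A X \<nu> p \<kappa>"
    unfolding is_principal_curvatures_def
  proof (intro bexI[of _ "(U, \<phi>)"] conjI exI[of _ e])
  qed (use fr c p in \<open>simp_all add: P.frame_def chart_differential_def\<close>)
  then have "is_principal_curvatures A X \<nu> p (curv p)"
    unfolding curv_def principal_curvatures_def by (rule someI[where P = "is_principal_curvatures A X \<nu> p"])
  then obtain V \<psi> e' where c': "(V, \<psi>) \<in> A" "p \<in> V"
    and e': "\<forall>i j. chart_differential (V, \<psi>) X p (e' i) \<bullet> chart_differential (V, \<psi>) X p (e' j) = (if i = j then 1 else 0)"
      "\<forall>i. chart_differential (V, \<psi>) \<nu> p (e' i) = curv p i *\<^sub>R chart_differential (V, \<psi>) X p (e' i)"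
    unfolding is_principal_curvatures_def by (metis fst_conv prod.exhaust_sel)
  interpret Q: param_hypersurface "\<psi> ` V" "X \<circ> inv_into V \<psi>" "\<nu> \<circ> inv_into V \<psi>"
    using c'(1) by (rule chart_param)
  have "Q.frame (\<psi> p) e' (curv p)"
    using e' unfolding Q.frame_def chart_differential_def by simp
  then show ?thesis using frame_change_chart[OF c c'(1) p c'(2)] by blast
qed

lemma curv_frame_coord:
  assumes c: "(U, \<phi>) \<in> A" and x: "x \<in> \<phi> ` U"
  shows "\<exists>e. param_hypersurface.frame (X \<circ> inv_into U \<phi>) (\<nu> \<circ> inv_into U \<phi>) x e (curv (inv_into U \<phi> x))"
  using curv_frame[OF c, of "inv_into U \<phi> x"] x by (simp add: inv_into_into f_inv_into_f)

lemma mean_curvature_eq: "mean_curvature A X \<nu> j p = norm_elem_sym j (curv p)"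
  by (simp add: mean_curvature_def norm_elem_sym_def curv_def)

text \<open>What is continuous in a chart is the symmetric function times a positive factor
  depending on the chart, so \<open>T\<close> has to be invariant under positive scaling.\<close>

lemma open_norm_elem_sym:
  fixes T :: "real set"
  assumes "open T" "j \<le> CARD('m)" and scale: "\<And>c r. c > 0 \<Longrightarrow> c * r \<in> T \<longleftrightarrow> r \<in> T"
  shows "openin M {p \<in> topspace M. norm_elem_sym j (curv p) \<in> T}"
proof (rule locally_open[OF assms(1)])
  fix U \<phi> assume c: "(U, \<phi>) \<in> A"
  interpret P: param_hypersurface "\<phi> ` U" "X \<circ> inv_into U \<phi>" "\<nu> \<circ> inv_into U \<phi>"
    using c by (rule chart_param)
  let ?g = "\<lambda>x. det (P.gram_matrix x) * elem_sym j (curv (inv_into U \<phi> x))"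
  have "continuous_on (\<phi> ` U) ?g"
    using curv_frame_coord[OF c] assms(2) by (rule P.continuous_elem_sym)
  moreover have "norm_elem_sym j (curv q) \<in> T \<longleftrightarrow> ?g (\<phi> q) \<in> T" if q: "q \<in> U" for q
  proof -
    obtain e where "P.frame (\<phi> q) e (curv q)" using curv_frame[OF c q] by blast
    then have "det (P.gram_matrix (\<phi> q)) > 0" using P.det_form_matrix(1)[of "\<phi> q"] q by blast
    moreover have b: "real (CARD('m) choose j) > 0" using assms(2) by simp
    ultimately have "det (P.gram_matrix (\<phi> q)) * real (CARD('m) choose j) > 0" by (rule mult_pos_pos)
    from scale[OF this, of "norm_elem_sym j (curv q)"] show ?thesis
      using b q chart_inj[OF c] by (simp add: norm_elem_sym_def)
  qed
  ultimately show "\<exists>g. continuous_on (\<phi> ` U) g \<and> (\<forall>q\<in>U. norm_elem_sym j (curv q) \<in> T \<longleftrightarrow> g (\<phi> q) \<in> T)"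
    by blast
qed

text \<open>The set where the first k mean curvatures are positive is open, and where it fails one of
  them is negative, which is an open condition too.\<close>
lemma mean_curvatures_pos:
  assumes k: "k \<le> CARD('m)" and Hk: "\<And>p. p \<in> topspace M \<Longrightarrow> norm_elem_sym k (curv p) > 0"
    and p0: "p0 \<in> topspace M" "\<And>j. j \<le> k \<Longrightarrow> norm_elem_sym j (curv p0) > 0"
    and p: "p \<in> topspace M" and j: "j \<le> k"
  shows "norm_elem_sym j (curv p) > 0"
proof -
  define P where "P = {p \<in> topspace M. \<forall>j\<le>k. norm_elem_sym j (curv p) > 0}"
  have "openin M {p \<in> topspace M. norm_elem_sym j (curv p) \<in> {0<..}}" if "j \<le> k" for j
    by (rule open_norm_elem_sym) (use that k in \<open>auto simp: zero_less_mult_iff\<close>)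
  then have "openin M (\<Inter>j\<in>{..k}. {p \<in> topspace M. norm_elem_sym j (curv p) \<in> {0<..}})"
    by (intro openin_INT2) auto
  moreover have "(\<Inter>j\<in>{..k}. {p \<in> topspace M. norm_elem_sym j (curv p) \<in> {0<..}}) = P"
    by (auto simp: P_def)
  ultimately have "openin M P" by simp
  have neg: "openin M {p \<in> topspace M. norm_elem_sym j (curv p) \<in> {..<0}}" if "j \<le> k" for j
    by (rule open_norm_elem_sym) (use that k in \<open>auto simp: mult_less_0_iff\<close>)
  have "topspace M - P = (\<Union>j\<in>{..k}. {p \<in> topspace M. norm_elem_sym j (curv p) \<in> {..<0}})"
  proof -
    have "\<exists>j\<le>k. norm_elem_sym j (curv q) < 0" if "q \<in> topspace M" "q \<notin> P" for q
    proof (rule ccontr)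
      assume "\<not> (\<exists>j\<le>k. norm_elem_sym j (curv q) < 0)"
      then have "\<And>l. l \<le> k \<Longrightarrow> norm_elem_sym l (curv q) \<ge> 0" by force
      from norm_elem_sym_closure_pos[OF k this Hk[OF that(1)]] that show False by (auto simp: P_def)
    qed
    moreover have "q \<notin> P" if "j \<le> k" "norm_elem_sym j (curv q) < 0" for q j
      using that by (force simp: P_def)
    ultimately show ?thesis by (fastforce simp: set_eq_iff)
  qed
  moreover have "openin M (\<Union>j\<in>{..k}. {p \<in> topspace M. norm_elem_sym j (curv p) \<in> {..<0}})"
    using neg by (intro openin_Union) auto
  ultimately have "openin M (topspace M - P)" by simp
  then have "closedin M P" by (simp add: closedin_def P_def)
  moreover have "p0 \<in> P" using p0 by (simp add: P_def)
  ultimately have "P = topspace M"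
    using manifold(5) \<open>openin M P\<close> unfolding connected_space_clopen_in by blast
  then show ?thesis using p j by (auto simp: P_def)
qed

lemma touching_enclosing_sphere:
  assumes p: "p \<in> topspace M" and far: "\<And>q. q \<in> topspace M \<Longrightarrow> dist z (X q) \<le> dist z (X p)"
  shows "X p - z = ((X p - z) \<bullet> \<nu> p) *\<^sub>R \<nu> p" and "1 \<le> ((X p - z) \<bullet> \<nu> p) * curv p i"
proof -
  obtain U \<phi> where c: "(U, \<phi>) \<in> A" "p \<in> U" using chart_at[OF p] by blast
  interpret P: param_hypersurface "\<phi> ` U" "X \<circ> inv_into U \<phi>" "\<nu> \<circ> inv_into U \<phi>"
    using c(1) by (rule chart_param)
  obtain e where e: "P.frame (\<phi> p) e (curv p)" using curv_frame[OF c] by blast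
  have inv: "inv_into U \<phi> (\<phi> q) = q" if "q \<in> U" for q using chart_inj[OF c(1)] that by simp
  have "dist z ((X \<circ> inv_into U \<phi>) y) \<le> dist z ((X \<circ> inv_into U \<phi>) (\<phi> p))" if "y \<in> \<phi> ` U" for y
    using that far openin_subset[OF chart(1)[OF c(1)]] inv c(2) by auto
  from P.touching_sphere[OF _ e this] c(2) inv[OF c(2)]
  show "X p - z = ((X p - z) \<bullet> \<nu> p) *\<^sub>R \<nu> p" and "1 \<le> ((X p - z) \<bullet> \<nu> p) * curv p i" by auto
qed

section \<open>Constant distance to the origin and bijectivity onto the sphere\<close>

lemma norm_attained:
  obtains p q where "p \<in> topspace M" "\<And>x. x \<in> topspace M \<Longrightarrow> norm (X x) \<le> norm (X p)"
    "q \<in> topspace M" "\<And>x. x \<in> topspace M \<Longrightarrow> norm (X q) \<le> norm (X x)"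
proof -
  have comp: "compact (X ` topspace M)"
    using image_compactin[OF _ continuous_X, of "topspace M"] manifold(4) by (simp add: compact_space_def)
  have ne: "X ` topspace M \<noteq> {}" using manifold(1) by simp
  obtain y where "y \<in> X ` topspace M" "\<And>x. x \<in> X ` topspace M \<Longrightarrow> norm x \<le> norm y"
    using continuous_attains_sup[OF comp ne, of norm] continuous_on_norm[OF continuous_on_id] by blast
  moreover obtain z where "z \<in> X ` topspace M" "\<And>x. x \<in> X ` topspace M \<Longrightarrow> norm z \<le> norm x"
    using continuous_attains_inf[OF comp ne, of norm] continuous_on_norm[OF continuous_on_id] by blast
  ultimately show ?thesis using that by blast
qed

text \<open>The set where the norm of \<open>X\<close> is minimal is closed by continuity and open
  by the minimum principle in charts.\<close>

lemma superharmonic_imp_norm_constant: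
  assumes super: "\<And>p. p \<in> topspace M \<Longrightarrow> real CARD('m) \<le> (X p \<bullet> \<nu> p) * (\<Sum>i\<in>UNIV. curv p i)"
  shows "\<exists>r. \<forall>p\<in>topspace M. norm (X p) = r"
proof -
  obtain q where q: "q \<in> topspace M" "\<And>x. x \<in> topspace M \<Longrightarrow> norm (X q) \<le> norm (X x)"
    using norm_attained by metis
  define Z where "Z = {p \<in> topspace M. norm (X p) = norm (X q)}"
  have "continuous_map M euclideanreal (\<lambda>p. norm (X p))"
    using continuous_X by (rule continuous_map_norm)
  then have "closedin M {p \<in> topspace M. norm (X p) \<in> {norm (X q)}}"
    by (rule closedin_continuous_map_preimage) (simp flip: closed_closedin)
  then have "closedin M Z" by (simp add: Z_def)
  moreover have "openin M Z"
  proof (subst openin_subopen, intro ballI)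
    fix p assume "p \<in> Z"
    then have p: "p \<in> topspace M" "norm (X p) = norm (X q)" by (auto simp: Z_def)
    obtain U \<phi> where c: "(U, \<phi>) \<in> A" "p \<in> U" using chart_at[OF p(1)] by blast
    interpret P: param_hypersurface "\<phi> ` U" "X \<circ> inv_into U \<phi>" "\<nu> \<circ> inv_into U \<phi>"
      using c(1) by (rule chart_param)
    have inv: "inv_into U \<phi> (\<phi> q) = q" if "q \<in> U" for q using chart_inj[OF c(1)] that by simp
    have UM: "U \<subseteq> topspace M" using openin_subset[OF chart(1)[OF c(1)]] .
    have sq: "P.sqdist 0 (\<phi> x) = (norm (X x))\<^sup>2" if "x \<in> U" for x
      using inv[OF that] by (simp add: P.sqdist_def power2_norm_eq_inner)
    have "\<exists>r>0. ball (\<phi> p) r \<subseteq> \<phi> ` U \<and> (\<forall>x\<in>ball (\<phi> p) r. P.sqdist 0 x = P.sqdist 0 (\<phi> p))"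
    proof (rule P.sqdist_strong_minimum[where \<kappa> = "\<lambda>x. curv (inv_into U \<phi> x)"])
      show "\<exists>e. P.frame x e (curv (inv_into U \<phi> x))" if "x \<in> \<phi> ` U" for x
        using curv_frame_coord[OF c(1) that] .
      show "real CARD('m) \<le> ((X \<circ> inv_into U \<phi>) x \<bullet> (\<nu> \<circ> inv_into U \<phi>) x) * (\<Sum>i\<in>UNIV. curv (inv_into U \<phi> x) i)"
        if "x \<in> \<phi> ` U" for x
        using super[of "inv_into U \<phi> x"] inv_into_into[OF that] UM by auto
      show "\<phi> p \<in> \<phi> ` U" using c(2) by blast
      show "P.sqdist 0 (\<phi> p) \<le> P.sqdist 0 x" if "x \<in> \<phi> ` U" for x
        using that sq c(2) p(2) q(2) UM by (auto intro!: power_mono)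
    qed
    then obtain r where r: "r > 0" "ball (\<phi> p) r \<subseteq> \<phi> ` U" "\<forall>x\<in>ball (\<phi> p) r. P.sqdist 0 x = P.sqdist 0 (\<phi> p)"
      by blast
    show "\<exists>V. openin M V \<and> p \<in> V \<and> V \<subseteq> Z"
    proof (intro exI conjI)
      show "openin M {x \<in> U. \<phi> x \<in> ball (\<phi> p) r}"
        by (rule chart_preimage_open[OF c(1) continuous_on_id]) simp
      show "p \<in> {x \<in> U. \<phi> x \<in> ball (\<phi> p) r}" using c(2) r(1) by simp
      show "{x \<in> U. \<phi> x \<in> ball (\<phi> p) r} \<subseteq> Z"
      proof clarify
        fix x assume x: "x \<in> U" "\<phi> x \<in> ball (\<phi> p) r"
        then have "(norm (X x))\<^sup>2 = (norm (X p))\<^sup>2" using r(3) sq[OF x(1)] sq[OF c(2)] by metis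
        then show "x \<in> Z" using x UM p(2) by (auto simp: Z_def)
      qed
    qed
  qed
  moreover have "q \<in> Z" using q by (simp add: Z_def)
  ultimately have "Z = topspace M"
    using manifold(5) unfolding connected_space_clopen_in by blast
  then show ?thesis unfolding Z_def by blast
qed

lemma sphere_open_image:
  fixes F :: "real ^ 'm \<Rightarrow> real ^ 'n"
  assumes "open B" "continuous_on B F" "inj_on F B" "F ` B \<subseteq> sphere 0 r" "r > 0"
  shows "openin (top_of_set (sphere 0 r)) (F ` B)"
proof -
  define G where "G = (\<lambda>(x, s). s *\<^sub>R F x)"
  have "open (G ` (B \<times> {0<..}))"
  proof (rule invariance_of_domain_gen)
    show "open (B \<times> {0::real<..})" using assms(1) by (intro open_Times) auto
    show "continuous_on (B \<times> {0<..}) G"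
      unfolding G_def case_prod_unfold
      by (intro continuous_intros continuous_on_compose2[OF assms(2)]) auto
    show "inj_on G (B \<times> {0<..})"
    proof (rule inj_onI, clarify)
      fix x s y t
      assume h: "x \<in> B" "y \<in> B" "0 < s" "0 < t" "G (x, s) = G (y, t)"
      have n: "norm (F x) = r" "norm (F y) = r" using h assms(4) by auto
      have "norm (s *\<^sub>R F x) = norm (t *\<^sub>R F y)" using h by (simp add: G_def)
      then have "s = t" using n h assms(5) by simp
      then have "F x = F y" using h by (simp add: G_def)
      then show "x = y \<and> s = t" using h assms(3) \<open>s = t\<close> by (auto dest: inj_onD)
    qed
    show "DIM(real ^ 'n) \<le> DIM((real ^ 'm) \<times> real)" using dim by simp
  qed
  moreover have "F ` B = sphere 0 r \<inter> G ` (B \<times> {0<..})"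
  proof (intro equalityI subsetI)
    fix y assume "y \<in> F ` B"
    then obtain x where x: "x \<in> B" "y = F x" by blast
    then have "y = G (x, 1)" by (simp add: G_def)
    moreover have "(x, 1::real) \<in> B \<times> {0<..}" using x(1) by simp
    ultimately have "y \<in> G ` (B \<times> {0<..})" by (rule image_eqI)
    moreover have "y \<in> sphere 0 r" using x assms(4) by blast
    ultimately show "y \<in> sphere 0 r \<inter> G ` (B \<times> {0<..})" by simp
  next
    fix y assume "y \<in> sphere 0 r \<inter> G ` (B \<times> {0<..})"
    then obtain x s where x: "x \<in> B" "s > 0" "y = s *\<^sub>R F x" "norm y = r" by (auto simp: G_def)
    moreover have "norm (F x) = r" using x(1) assms(4) by auto
    ultimately have "s = 1" using assms(5) by simp
    then show "y \<in> F ` B" using x by simp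
  qed
  ultimately show ?thesis by (metis openin_open_Int)
qed

text \<open>The bound on \<open>CARD('n)\<close> makes the sphere simply connected; a circle can be
  wrapped several times around itself.\<close>

lemma norm_constant_imp_bij_sphere:
  assumes "CARD('n) \<ge> 3" "r > 0" "\<And>p. p \<in> topspace M \<Longrightarrow> norm (X p) = r"
  shows "bij_betw X (topspace M) (sphere 0 r)"
proof (rule local_homeo_simply_connected_bij[OF manifold(4,2,3,5,1) continuous_X])
  show "X ` topspace M \<subseteq> sphere 0 r" using assms(3) by auto
  show "simply_connected (sphere (0::real^'n) r)" using assms(1) by (intro simply_connected_sphere) simp
  show "locally path_connected (sphere (0::real^'n) r)" by (rule locally_path_connected_sphere)
  fix p assume p: "p \<in> topspace M"
  obtain U \<phi> where c: "(U, \<phi>) \<in> A" "p \<in> U" using chart_at[OF p] by blast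
  let ?F = "X \<circ> inv_into U \<phi>"
  interpret P: param_hypersurface "\<phi> ` U" ?F "\<nu> \<circ> inv_into U \<phi>"
    using c(1) by (rule chart_param)
  have px: "\<phi> p \<in> \<phi> ` U" using c(2) by blast
  have UM: "U \<subseteq> topspace M" using openin_subset[OF chart(1)[OF c(1)]] .
  obtain s where s: "s > 0" "ball (\<phi> p) s \<subseteq> \<phi> ` U" "inj_on ?F (ball (\<phi> p) s)"
    using P.locally_injective[OF px] by blast
  define W where "W = {q \<in> U. \<phi> q \<in> ball (\<phi> p) s}"
  have FX: "?F (\<phi> q) = X q" if "q \<in> U" for q using chart_inj[OF c(1)] that by simp
  show "\<exists>W. openin M W \<and> p \<in> W \<and> inj_on X W \<and>
      (\<forall>V. openin M V \<and> V \<subseteq> W \<longrightarrow> openin (top_of_set (sphere 0 r)) (X ` V))"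
  proof (intro exI[of _ W] conjI allI impI)
    show "openin M W" unfolding W_def by (rule chart_preimage_open[OF c(1) continuous_on_id]) simp
    show "p \<in> W" using c(2) s(1) by (simp add: W_def)
    show "inj_on X W"
    proof (rule inj_onI)
      fix x y assume "x \<in> W" "y \<in> W" "X x = X y"
      then have h: "x \<in> U" "y \<in> U" "\<phi> x \<in> ball (\<phi> p) s" "\<phi> y \<in> ball (\<phi> p) s" "?F (\<phi> x) = ?F (\<phi> y)"
        using FX by (auto simp: W_def)
      then have "\<phi> x = \<phi> y" using s(3) by (meson inj_onD)
      then show "x = y" using h chart_inj[OF c(1)] by (meson inj_onD)
    qed
    fix V assume V: "openin M V \<and> V \<subseteq> W"
    have VU: "V \<subseteq> U" using V by (auto simp: W_def)
    have VB: "\<phi> ` V \<subseteq> ball (\<phi> p) s" using V by (auto simp: W_def)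
    have eq: "?F ` \<phi> ` V = X ` V" using FX VU by (force simp: image_image)
    have "openin (top_of_set (sphere 0 r)) (?F ` \<phi> ` V)"
    proof (rule sphere_open_image)
      show "open (\<phi> ` V)" using chart_image_open[OF c(1) _ VU] V by blast
      show "continuous_on (\<phi> ` V) ?F"
        using smooth_on_continuous[OF P.smooth_F] by (rule continuous_on_subset) (use VU in blast)
      show "inj_on ?F (\<phi> ` V)" using s(3) VB by (rule inj_on_subset)
      show "?F ` \<phi> ` V \<subseteq> sphere 0 r" unfolding eq using assms(3) VU UM by auto
    qed (rule assms(2))
    then show "openin (top_of_set (sphere 0 r)) (X ` V)" unfolding eq .
  qed
qed

end


section \<open>Self-expanders\<close>

lemma root_quotient_ge:
  assumes "a > 0" "b > 0" "h > 0" "b \<le> h ^ d * a" "d > 0"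
  shows "1 / h \<le> root d (a / b)"
proof -
  have "(1 / h) ^ d \<le> a / b" using assms by (simp add: field_simps power_divide)
  then have "root d ((1 / h) ^ d) \<le> root d (a / b)" using assms(5) by simp
  then show ?thesis using assms by (simp add: real_root_power_cancel)
qed

lemma root_quotient_le:
  assumes "a > 0" "b > 0" "s > 0" "a * s ^ d \<le> b" "d > 0"
  shows "root d (a / b) \<le> 1 / s"
proof -
  have "a / b \<le> (1 / s) ^ d" using assms by (simp add: field_simps power_divide)
  then have "root d (a / b) \<le> root d ((1 / s) ^ d)" using assms(5) by simp
  then show ?thesis using assms by (simp add: real_root_power_cancel)
qed

text \<open>Weights with sum one cannot all vanish, so the maximum is over a nonempty set; the
  weights beyond \<open>k\<close> vanish, so the sum up to \<open>k\<close> is still one.\<close>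

lemma top_index_properties:
  assumes "flow_weights d P a" "P \<noteq> {}"
  defines "k \<equiv> top_index d P a"
  shows "1 \<le> k" "k \<le> d"
    and "p \<in> P \<Longrightarrow> (\<Sum>j\<le>k. \<Sum>i<j. a i j p) = 1"
    and "p \<in> P \<Longrightarrow> j \<le> k \<Longrightarrow> i < j \<Longrightarrow> 0 \<le> a i j p"
proof -
  let ?J = "{j. j \<le> d \<and> (\<exists>i<j. \<exists>p\<in>P. a i j p \<noteq> 0)}"
  have fin: "finite ?J" by simp
  have one: "(\<Sum>j\<le>d. \<Sum>i<j. a i j p) = 1" if "p \<in> P" for p
    using assms(1) that by (simp add: flow_weights_def)
  have "?J \<noteq> {}"
  proof
    assume "?J = {}"
    moreover obtain p where "p \<in> P" using assms(2) by blast
    ultimately have "(\<Sum>j\<le>d. \<Sum>i<j. a i j p) = 0" by (intro sum.neutral ballI) auto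
    then show False using one[OF \<open>p \<in> P\<close>] by simp
  qed
  from Max_in[OF fin this] have k: "k \<in> ?J" by (simp add: k_def top_index_def)
  then show "1 \<le> k" "k \<le> d" by auto
  show "(\<Sum>j\<le>k. \<Sum>i<j. a i j p) = 1" if p: "p \<in> P"
  proof -
    have z: "a i j p = 0" if "j \<in> {..d} - {..k}" "i < j" for i j
    proof (rule ccontr)
      assume "a i j p \<noteq> 0"
      then have "j \<in> ?J" using that p by auto
      from Max_ge[OF fin this] show False using that by (simp add: k_def top_index_def)
    qed
    have "(\<Sum>j\<le>k. \<Sum>i<j. a i j p) = (\<Sum>j\<le>d. \<Sum>i<j. a i j p)"
      using \<open>k \<le> d\<close> z by (intro sum.mono_neutral_left) (auto intro!: sum.neutral)
    then show ?thesis using one[OF p] by simp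
  qed
  show "0 \<le> a i j p" if "p \<in> P" "j \<le> k" "i < j"
    using assms(1) that \<open>k \<le> d\<close> by (simp add: flow_weights_def)
qed

lemma weighted_sum_ge:
  fixes a c :: "nat \<Rightarrow> nat \<Rightarrow> real"
  assumes "(\<Sum>j\<le>k. \<Sum>i<j. a i j) = 1" "\<And>i j. j \<le> k \<Longrightarrow> i < j \<Longrightarrow> 0 \<le> a i j"
    and "\<And>i j. j \<le> k \<Longrightarrow> i < j \<Longrightarrow> b \<le> c i j"
  shows "b \<le> (\<Sum>j\<le>k. \<Sum>i<j. a i j * c i j)"
proof -
  have "b = (\<Sum>j\<le>k. \<Sum>i<j. a i j * b)" using assms(1) by (simp flip: sum_distrib_right)
  also have "\<dots> \<le> (\<Sum>j\<le>k. \<Sum>i<j. a i j * c i j)"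
    using assms(2,3) by (intro sum_mono mult_left_mono) auto
  finally show ?thesis .
qed

lemma weighted_sum_le:
  fixes a c :: "nat \<Rightarrow> nat \<Rightarrow> real"
  assumes "(\<Sum>j\<le>k. \<Sum>i<j. a i j) = 1" "\<And>i j. j \<le> k \<Longrightarrow> i < j \<Longrightarrow> 0 \<le> a i j"
    and "\<And>i j. j \<le> k \<Longrightarrow> i < j \<Longrightarrow> c i j \<le> b"
  shows "(\<Sum>j\<le>k. \<Sum>i<j. a i j * c i j) \<le> b"
  using weighted_sum_ge[of a k "- b" "\<lambda>i j. - c i j"] assms by (simp add: sum_negf)

theorem theorem3:
  fixes M :: "'p topology"
    and A :: "('p, 'm::finite) chart set"
    and X \<nu> :: "'p \<Rightarrow> real ^ 'n::finite"
    and a :: "nat \<Rightarrow> nat \<Rightarrow> 'p \<Rightarrow> real"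
  assumes "CARD('n) \<ge> 3"
    and "closed_immersed_hypersurface M A X"
    and "outward_unit_normal M A X \<nu>"
    and "flow_weights (CARD('n) - 1) (topspace M) a"
    and "self_expander M A X \<nu> a"
  shows "round_hypersphere_at_origin M X"
proof -
  let ?T = "topspace M" and ?m = "CARD('m)"
  interpret closed_hypersurface M A X \<nu>
    using assms(2,3) by unfold_locales (simp_all add: outward_unit_normal_def)
  define H where "H j p = norm_elem_sym j (curv p)" for j p
  define k where "k = top_index (CARD('n) - 1) ?T a"
  have d: "CARD('n) - 1 = ?m" using dim by simp
  note top = top_index_properties[OF assms(4) manifold(1), folded k_def, unfolded d]
  obtain \<mu> where Hk: "\<And>p. p \<in> ?T \<Longrightarrow> H k p > 0" and \<mu>: "\<mu> > 0"
    and expander: "\<And>p. p \<in> ?T \<Longrightarrow>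
      (\<Sum>j\<le>k. \<Sum>i<j. a i j p * root (j - i) (H i p / H j p)) = \<mu> * (X p \<bullet> \<nu> p)"
    using assms(5) unfolding self_expander_def Let_def k_def[symmetric] mean_curvature_eq H_def[symmetric]
    by blast
  obtain z p0 where p0: "p0 \<in> ?T" "\<And>q. q \<in> ?T \<Longrightarrow> dist z (X q) \<le> dist z (X p0)"
    and out: "(X p0 - z) \<bullet> \<nu> p0 > 0"
    using assms(3) unfolding outward_unit_normal_def by blast
  \<comment> \<open>The orientation of \<open>\<nu>\<close> enters here: the touching inequality
    bounds only the product with the normal component, and outwardness fixes its sign.\<close>
  have "curv p0 i > 0" for i
  proof -
    have "((X p0 - z) \<bullet> \<nu> p0) * curv p0 i > 0"
      using touching_enclosing_sphere(2)[OF p0, of i] by simp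
    then show ?thesis using out by (simp add: zero_less_mult_iff)
  qed
  then have "\<And>j. j \<le> k \<Longrightarrow> norm_elem_sym j (curv p0) > 0"
    using top(2) by (intro norm_elem_sym_pos) auto
  from mean_curvatures_pos[OF top(2) Hk[unfolded H_def] p0(1) this]
  have Hpos: "H j p > 0" if "p \<in> ?T" "j \<le> k" for j p using that unfolding H_def by blast
  have H1: "H 1 p = (\<Sum>i\<in>UNIV. curv p i) / ?m" for p
    by (simp add: H_def norm_elem_sym_def elem_sym_1[unfolded One_nat_def])
  obtain q where q: "q \<in> ?T" "\<And>x. x \<in> ?T \<Longrightarrow> norm (X x) \<le> norm (X q)"
    using norm_attained by metis
  define c where "c = X q \<bullet> \<nu> q"
  have ck: "1 \<le> c * curv q i" for i
    using touching_enclosing_sphere(2)[of q 0 i] q by (simp add: c_def)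
  \<comment> \<open>Outwardness is given at \<open>p0\<close> with respect to \<open>z\<close>, not
    at \<open>q\<close> with respect to the origin. The sign at \<open>q\<close> comes from
    \<open>H 1\<close>: with \<open>c\<close> nonpositive, \<open>ck\<close> would make all
    curvatures there nonpositive.\<close>
  have c: "c > 0"
  proof (rule ccontr)
    assume "\<not> c > 0"
    have "curv q i \<le> 0" for i
    proof (rule ccontr)
      assume "\<not> curv q i \<le> 0"
      then have "c * curv q i \<le> 0" using \<open>\<not> c > 0\<close> by (simp add: mult_nonpos_nonneg)
      then show False using ck[of i] by simp
    qed
    then have "H 1 q \<le> 0" unfolding H1 by (intro divide_nonpos_nonneg sum_nonpos) auto
    then show False using Hpos[OF q(1) top(1)] by simp
  qed
  \<comment> \<open>All curvatures at \<open>q\<close> are at least 1 / \<open>c\<close>, so each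
    quotient root, and with them their weighted mean, is at most \<open>c\<close>.\<close>
  have "\<mu> * c \<le> c"
  proof -
    have "(\<Sum>j\<le>k. \<Sum>i<j. a i j q * root (j - i) (H i q / H j q)) \<le> c"
    proof (rule weighted_sum_le[OF top(3,4)[OF q(1)]])
      fix i j assume ij: "j \<le> k" "i < j"
      have "curv q l \<ge> 1 / c" for l using ck[of l] c by (simp add: field_simps)
      from norm_elem_sym_ge_power[of "1 / c" "curv q" i "j - i", OF this] c ij top(2)
      have "H i q * (1 / c) ^ (j - i) \<le> H j q" by (simp add: H_def)
      from root_quotient_le[OF Hpos Hpos _ this] q(1) ij c
      show "root (j - i) (H i q / H j q) \<le> c" by simp
    qed
    then show ?thesis using expander[OF q(1)] by (simp add: c_def)
  qed
  then have \<mu>1: "\<mu> \<le> 1" using c by simp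
  have low: "1 / H 1 p \<le> \<mu> * (X p \<bullet> \<nu> p)" if p: "p \<in> ?T" for p
    unfolding expander[OF p, symmetric]
  proof (rule weighted_sum_ge[OF top(3,4)[OF p]])
    fix i j assume ij: "j \<le> k" "i < j"
    have "H j p \<le> H 1 p ^ (j - i) * H i p"
      using norm_elem_sym_le_power[of i "j - i" "curv p"] ij top(2) Hpos[OF p] by (simp add: H_def)
    from root_quotient_ge[OF Hpos Hpos Hpos this] p ij top(1)
    show "1 / H 1 p \<le> root (j - i) (H i p / H j p)" by simp
  qed
  have u: "X p \<bullet> \<nu> p > 0 \<and> 1 \<le> (X p \<bullet> \<nu> p) * H 1 p" if p: "p \<in> ?T" for p
  proof -
    have h: "H 1 p > 0" using Hpos[OF p top(1)] .
    then have "\<mu> * (X p \<bullet> \<nu> p) > 0" using low[OF p] by (meson less_le_trans zero_less_divide_1_iff)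
    then have pos: "X p \<bullet> \<nu> p > 0" using \<mu> by (simp add: zero_less_mult_iff)
    \<comment> \<open>Replacing \<open>\<mu>\<close> by 1 enlarges the right-hand side only because
      the support function was first shown to be positive.\<close>
    have "1 / H 1 p \<le> 1 * (X p \<bullet> \<nu> p)"
      using low[OF p] mult_right_mono[OF \<mu>1, of "X p \<bullet> \<nu> p"] pos by linarith
    then show ?thesis using pos h by (simp add: field_simps)
  qed
  have "real ?m \<le> (X p \<bullet> \<nu> p) * (\<Sum>i\<in>UNIV. curv p i)" if "p \<in> ?T" for p
  proof -
    have "real ?m * 1 \<le> real ?m * ((X p \<bullet> \<nu> p) * H 1 p)"
      using u[OF that] by (intro mult_left_mono) auto
    then show ?thesis by (simp add: H1[unfolded One_nat_def])
  qed
  from superharmonic_imp_norm_constant[OF this] obtain r where r: "\<And>p. p \<in> ?T \<Longrightarrow> norm (X p) = r"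
    by blast
  have "X q \<noteq> 0" using c by (auto simp: c_def)
  then have "r > 0" using r[OF q(1)] by auto
  from norm_constant_imp_bij_sphere[OF assms(1) this r] \<open>r > 0\<close> show ?thesis
    unfolding round_hypersphere_at_origin_def bij_betw_def by blast
qed


end
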